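(* Let $w:\mathbb{N}_0\to(0,\infty)$ be a function such that the numbers $\beta_l:=2^{2l+1}w(l+2)$, $l\in\mathbb{N}_0$, fulfill $$\sum_{l=0}^\infty\sqrt{\frac{\log\max\{\beta_l,e\}}{\beta_l}}<\infty .$$ For $N\in\mathbb{N}=\{1,2,\dots\}$ let $\Lambda_N=\{0,1\}^N$, and let $W$ be the hierarchical weight function $W_{ij}=w(d(i,j))$ for $i,j\in\Lambda_N$, $i\ne j$, where $d$ is the hierarchical distance. Let $P^{\Lambda_N}_{W,h}$ denote the law of the horospherical coordinates $(u_i,s_i)_{i\in\Lambda_N}$ of the $H^{2|2}$-model on $\Lambda_N$ with weights $W$ and pinning $h$. Then $$\lim_{M\to\infty}\ \sup_{N\in\mathbb{N}}\ \sup_h\ \sup_{p,q\in\Lambda_N}P^{\Lambda_N}_{W,h}\big(|u_p-u_q|\ge M\big)=0,$$ where the supremum over $h$ is taken over all uniform pinning functions $h=\epsilon 1=(\epsilon)_{i\in\Lambda_N}$ and all pinning functions at one point $h=\epsilon\delta_{i_0}=(\epsilon 1_{\{i=i_0\}})_{i\in\Lambda_N}$, with $\epsilon>0$ and $i_0\in\Lambda_N$.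
   Context: **Hierarchical distance.** For a nonempty binary word $j=(j_0,\dots,j_{n-1})\in\{0,1\}^n$ let $\mathrm{cut}(j)=(j_1,\dots,j_{n-1})$ be the word with its first letter removed; $\mathrm{cut}^l$ is the $l$-fold iterate ($\mathrm{cut}^0$ is the identity). For $i,j\in\Lambda_N=\{0,1\}^N$, $d(i,j):=\min\{l\in\mathbb{N}_0:\mathrm{cut}^l(i)=\mathrm{cut}^l(j)\}$. **The probability measure.** Let $\Lambda$ be a finite nonempty set, $W_{ij}=W_{ji}\ge 0$ weights for $i\neq j$ in $\Lambda$ (put $W_{ii}=0$), and $h:\Lambda\to[0,\infty)$ a pinning function with $h_i>0$ for at least one $i$ in every connected component of the graph on $\Lambda$ with edges $\{i,j\}$, $i\ne j$, $W_{ij}>0$. For $(u_\Lambda,s_\Lambda)=(u_i,s_i)_{i\in\Lambda}\in\mathbb{R}^\Lambda\times\mathbb{R}^\Lambda$ set $$B_{ij}:=\cosh(u_i-u_j)+\tfrac12(s_i-s_j)^2e^{u_i+u_j},\qquad B_j:=\cosh u_j+\tfrac12 s_j^2e^{u_j},$$ $$M_{ij}:=1_{\{i=j\}}\Big(h_ie^{u_i}+2\sum_{k\in\Lambda,k\ne i}W_{ik}e^{u_i+u_k}\Big)-1_{\{i\neq j\}}2W_{ij}e^{u_i+u_j}.$$ Then $P^\Lambda_{W,h}$ is the probability measure on $(\mathbb{R}^\Lambda)^2$ given by $$P^\Lambda_{W,h}(du_\Lambda\,ds_\Lambda)=e^{-\sum_{i,j\in\Lambda}W_{ij}(B_{ij}-1)}\,e^{-\sum_{i\in\Lambda}h_i(B_i-1)}\,\det(M_{ij})_{i,j\in\Lambda}\prod_{i\in\Lambda}\frac{e^{-u_i}\,du_i\,ds_i}{2\pi},$$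 where sums over $i,j\in\Lambda$ run over ordered pairs. This is the law of the even horospherical coordinates of the $H^{2|2}$-model with action $\sum_{i,j\in\Lambda}W_{ij}(1+\langle v_i,v_j\rangle)+\sum_{i\in\Lambda}h_i(1+\langle v_i,o\rangle)$. *)

theory Defs
  imports "HOL-Probability.Probability"
begin

subsection \<open>Hierarchical distance on binary words\<close>

definition words :: "nat \<Rightarrow> bool list set" where
  "words N = {i. length i = N}"

text \<open>
  The cut map is \<^const>\<open>tl\<close>.  Its library value \<^prop>\<open>tl [] = []\<close> on the empty word is
  irrelevant here: for words of equal length \<^term>\<open>N\<close> the minimum is attained at some
  \<^prop>\<open>l \<le> N\<close>.
\<close>

definition hdist :: "bool list \<Rightarrow> bool list \<Rightarrow> nat" where
  "hdist i j = (LEAST l. (tl ^^ l) i = (tl ^^ l) j)"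

definition hweight :: "(nat \<Rightarrow> real) \<Rightarrow> bool list \<Rightarrow> bool list \<Rightarrow> real" where
  "hweight w i j = (if i = j then 0 else w (hdist i j))"


subsection \<open>The law of the even horospherical coordinates\<close>

text \<open>
  The vertex set is a finite set \<open>V\<close> instead of a finite type, because its size varies within
  the statement.  For the same reason the determinant is the Leibniz sum that defines
  \<^const>\<open>det\<close> in HOL-Analysis, with permutations of the index set \<open>V\<close> in place of permutations
  of the index type.
\<close>

definition det_on :: "'v set \<Rightarrow> ('v \<Rightarrow> 'v \<Rightarrow> real) \<Rightarrow> real" where
  "det_on V A = (\<Sum>\<pi> | \<pi> permutes V. of_int (sign \<pi>) * (\<Prod>i\<in>V. A i (\<pi> i)))"

definition B_edge :: "('v \<Rightarrow> real) \<Rightarrow> ('v \<Rightarrow> real) \<Rightarrow> 'v \<Rightarrow> 'v \<Rightarrow> real" where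
  "B_edge u s i j = cosh (u i - u j) + (s i - s j)\<^sup>2 * exp (u i + u j) / 2"

definition B_pin :: "('v \<Rightarrow> real) \<Rightarrow> ('v \<Rightarrow> real) \<Rightarrow> 'v \<Rightarrow> real" where
  "B_pin u s j = cosh (u j) + (s j)\<^sup>2 * exp (u j) / 2"

definition M_mat ::
  "'v set \<Rightarrow> ('v \<Rightarrow> 'v \<Rightarrow> real) \<Rightarrow> ('v \<Rightarrow> real) \<Rightarrow> ('v \<Rightarrow> real) \<Rightarrow> 'v \<Rightarrow> 'v \<Rightarrow> real" where
  "M_mat V W h u i j =
     (if i = j then h i * exp (u i) + 2 * (\<Sum>k\<in>V - {i}. W i k * exp (u i + u k))
      else - 2 * W i j * exp (u i + u j))"

definition h22_density ::
  "'v set \<Rightarrow> ('v \<Rightarrow> 'v \<Rightarrow> real) \<Rightarrow> ('v \<Rightarrow> real) \<Rightarrow> ('v \<Rightarrow> real) \<Rightarrow> ('v \<Rightarrow> real) \<Rightarrow> real" where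
  "h22_density V W h u s =
     exp (- (\<Sum>i\<in>V. \<Sum>j\<in>V. W i j * (B_edge u s i j - 1))) *
     exp (- (\<Sum>i\<in>V. h i * (B_pin u s i - 1))) *
     det_on V (M_mat V W h u) *
     (\<Prod>i\<in>V. exp (- u i) / (2 * pi))"

text \<open>
  The underlying space \<open>(\<real>\<^sup>V)\<^sup>2\<close> consists of pairs \<open>(u, s)\<close> of functions that are
  \<^const>\<open>undefined\<close> outside \<open>V\<close>.  The cast \<^const>\<open>ennreal\<close> does not truncate for symmetric
  weights \<open>W \<ge> 0\<close> and pinning \<open>h \<ge> 0\<close>: then \<open>M_mat V W h u\<close> is symmetric and diagonally
  dominant with nonnegative diagonal, so its determinant is nonnegative.
\<close>

definition h22_law ::
  "'v set \<Rightarrow> ('v \<Rightarrow> 'v \<Rightarrow> real) \<Rightarrow> ('v \<Rightarrow> real) \<Rightarrow> (('v \<Rightarrow> real) \<times> ('v \<Rightarrow> real)) measure" where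
  "h22_law V W h =
     density ((\<Pi>\<^sub>M i\<in>V. lborel) \<Otimes>\<^sub>M (\<Pi>\<^sub>M i\<in>V. lborel))
       (\<lambda>(u, s). ennreal (h22_density V W h u s))"

definition uniform_pinnings :: "('v \<Rightarrow> real) set" where
  "uniform_pinnings = {(\<lambda>i. \<epsilon>) | \<epsilon>. \<epsilon> > 0}"

definition one_point_pinnings :: "'v set \<Rightarrow> ('v \<Rightarrow> real) set" where
  "one_point_pinnings V = {(\<lambda>i. if i = i\<^sub>0 then \<epsilon> else 0) | \<epsilon> i\<^sub>0. \<epsilon> > 0 \<and> i\<^sub>0 \<in> V}"

end

theory Submission
  imports Defs "HOL-Library.Sublist"
begin

text \<open>
  Everything rests on one elementary identity about two vertices \<open>i\<close>, \<open>j\<close> that the rest of the graph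
  cannot tell apart (equal pinning, equal weights to every other vertex).  Integrating out the \<open>s\<close>-field
  is a Gaussian integral and leaves a density in \<open>u\<close> that contains the square root of a
  determinant.  Replace \<open>u i\<close>, \<open>u j\<close> by the logarithm \<open>u a\<close> of the average of
  \<open>exp (u i)\<close> and \<open>exp (u j)\<close> and by half the difference \<open>x = (u i - u j) / 2\<close>; then
  \<open>u i = u a + x - ln (cosh x)\<close> and \<open>u j = u a - x - ln (cosh x)\<close>, with constant Jacobian 2.  In these
  coordinates the density factorises exactly: one factor is the density of the model in which
  \<open>i\<close> and \<open>j\<close> are replaced by the single vertex \<open>a\<close> with the weights and pinnings added up, and the other
  one says that, given everything else, \<open>sinh x\<close> is a centred Gaussian variable of precision (half the inverse
  variance) at least \<open>4 * W i j\<close> (lemmas \<open>u_density_split\<close> and \<open>nn_integral_u_density_merge\<close>).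

  In the hierarchical model the two halves of a block are indistinguishable as soon as each of them
  has been merged to one vertex, so the merging can be iterated up the binary tree until a single vertex,
  the root, is left; its one-dimensional integral gives the normalisation.  The weight between the merged halves
  of a block of size \<open>2 ^ d\<close> is \<open>4 ^ (d - 1) * w d\<close>, so on the way from a leaf to the root the height
  \<open>u\<close> moves at level \<open>d\<close> by at most \<open>jump w d = 2 / sqrt (4 ^ d * w d)\<close> in mean.
  For \<open>d = l + 2\<close> this is at most the \<open>l\<close>-th term of the series in the hypothesis, hence
  the total displacement from leaf to root has a mean that is bounded uniformly
  in the size of the graph (lemma \<open>block_partition_bounds\<close>).  For uniform pinning the claim follows by Markov's
  inequality.

  One-point pinning destroys the symmetry between siblings.  But all ways to pin a massless field
  agree on differences of heights up to an explicit density: pinning at the root instead of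
  the leaf \<open>z\<close> costs the factor \<open>exp (u z - root_height)\<close>.  This rests on two facts: every rank-one
  perturbation of a graph Laplacian has the same determinant up to explicit factors
  (\<open>det_on_rank_one\<close>), and a shift-invariant density does not see at which height
  it is anchored (\<open>gauge_exchange\<close>).  Root pinning respects all symmetries, so the merging argument applies to it;
  it also bounds the second moment of the density factor by \<open>\<Prod>d. 1 + (jump w d)\<^sup>2\<close>,
  which transfers tightness back to the original pinning.
\<close>

section \<open>Determinants indexed by a finite set\<close>

lemma det_on_cong:
  assumes "\<And>i j. i \<in> V \<Longrightarrow> j \<in> V \<Longrightarrow> A i j = B i j"
  shows "det_on V A = det_on V B"
  unfolding det_on_def
  by (intro sum.cong refl arg_cong2[where f="(*)"] prod.cong) (auto simp: assms permutes_in_image)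

lemma det_on_transpose:
  assumes "finite V"
  shows "det_on V (\<lambda>i j. A j i) = det_on V A"
proof -
  have "(\<Prod>i\<in>V. A (inv p i) i) = (\<Prod>i\<in>V. A i (p i))" if p: "p permutes V" for p
  proof -
    have "(\<Prod>i\<in>V. A (inv p i) i) = (\<Prod>i\<in>V. A (inv p (p i)) (p i))"
      using prod.permute[OF p, of "\<lambda>i. A (inv p i) i"] by (simp add: o_def)
    then show ?thesis
      using permutes_inverses[OF p] by simp
  qed
  moreover have "sign (inv p) = sign p" if "p permutes V" for p
    using that assms permutation_permutes sign_inverse by blast
  ultimately show ?thesis
    unfolding det_on_def by (subst sum_permutations_inverse) (auto intro!: sum.cong)
qed

text \<open>
  Swapping the two rows is a reindexing of the Leibniz sum that changes its sign.
\<close>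

lemma det_on_identical_rows:
  assumes "finite V" "a \<in> V" "b \<in> V" "a \<noteq> b" and rows: "\<And>j. j \<in> V \<Longrightarrow> A a j = A b j"
  shows "det_on V A = 0"
proof -
  let ?t = "Transposition.transpose a b"
  have t: "?t permutes V"
    using assms by (simp add: permutes_swap_id)
  have "det_on V A = (\<Sum>p | p permutes V. of_int (sign (p \<circ> ?t)) * (\<Prod>i\<in>V. A i ((p \<circ> ?t) i)))"
    unfolding det_on_def by (rule sum_permutations_compose_right[OF t])
  also have "\<dots> = (\<Sum>p | p permutes V. - (of_int (sign p) * (\<Prod>i\<in>V. A i (p i))))"
  proof (rule sum.cong[OF refl], clarsimp)
    fix p assume p: "p permutes V"
    have "sign (p \<circ> ?t) = - sign p"
      using p t \<open>finite V\<close> \<open>a \<noteq> b\<close>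
      by (metis mult.right_neutral mult_minus_right permutation_permutes sign_compose sign_swap_id)
    moreover have "(\<Prod>i\<in>V. A i (p (?t i))) = (\<Prod>i\<in>V. A i (p i))"
    proof -
      have "(\<Prod>i\<in>V. A i (p (?t i))) = (\<Prod>i\<in>V. A (?t i) (p (?t (?t i))))"
        using prod.permute[OF t, of "\<lambda>i. A i (p (?t i))"] by (simp add: o_def)
      also have "\<dots> = (\<Prod>i\<in>V. A i (p i))"
        using rows assms permutes_in_image[OF p]
        by (intro prod.cong refl) (auto simp: Transposition.transpose_def)
      finally show ?thesis .
    qed
    ultimately show "real_of_int (sign (p \<circ> ?t)) * (\<Prod>i\<in>V. A i (p (?t i))) = - (real_of_int (sign p) * (\<Prod>i\<in>V. A i (p i)))"
      by simp
  qed
  also have "\<dots> = - det_on V A"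
    by (simp add: det_on_def sum_negf)
  finally show ?thesis by simp
qed

lemma det_on_row_linear:
  assumes "finite V" "a \<in> V"
  shows "det_on V (\<lambda>i j. if i = a then r j + c * s j else A i j) =
    det_on V (\<lambda>i j. if i = a then r j else A i j) + c * det_on V (\<lambda>i j. if i = a then s j else A i j)"
proof -
  have "(\<Prod>i\<in>V. if i = a then f (p i) else A i (p i)) = f (p a) * (\<Prod>i\<in>V - {a}. A i (p i))" for f p
    using assms by (subst prod.remove[of _ a]) (auto intro!: prod.cong)
  note * = this[of "\<lambda>x. r x + c * s x"] this[of r] this[of s]
  show ?thesis
    unfolding det_on_def * by (simp add: sum_distrib_left sum.distrib[symmetric] algebra_simps)
qed

lemma det_on_add_row:
  assumes "finite V" "a \<in> V" "b \<in> V" "a \<noteq> b"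
  shows "det_on V (\<lambda>i j. if i = a then A a j + c * A b j else A i j) = det_on V A"
proof -
  have "det_on V (\<lambda>i j. if i = a then A b j else A i j) = 0"
    by (rule det_on_identical_rows[of V a b]) (use assms in auto)
  moreover have "(\<lambda>i j. if i = a then A a j else A i j) = A"
    by (auto simp: fun_eq_iff)
  ultimately show ?thesis
    using det_on_row_linear[OF assms(1,2), of "A a" c "A b" A] by simp
qed

lemma det_on_add_column:
  assumes "finite V" "a \<in> V" "b \<in> V" "a \<noteq> b"
  shows "det_on V (\<lambda>i j. if j = a then A i a + c * A i b else A i j) = det_on V A"
  using det_on_add_row[OF assms, of "\<lambda>i j. A j i" c] det_on_transpose[OF assms(1)]
  by (metis (no_types, lifting) det_on_cong)

lemma det_on_scale_row:
  assumes "finite V" "a \<in> V"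
  shows "det_on V (\<lambda>i j. if i = a then c * A i j else A i j) = c * det_on V A"
proof -
  have z: "det_on V (\<lambda>i j. if i = a then 0 else A i j) = 0"
    unfolding det_on_def using assms by (intro sum.neutral) (auto intro!: prod_zero)
  have "(\<lambda>i j. if i = a then A a j else A i j) = A" "(\<lambda>i j. if i = a then c * A i j else A i j)
     = (\<lambda>i j. if i = a then 0 + c * A a j else A i j)"
    by (auto simp: fun_eq_iff)
  then show ?thesis
    using det_on_row_linear[OF assms, of "\<lambda>_. 0" c "A a" A] z by simp
qed

lemma det_on_expand:
  assumes "finite V" "v \<notin> V" and row: "\<And>j. j \<in> V \<Longrightarrow> A v j = 0"
  shows "det_on (insert v V) A = A v v * det_on V A"
proof -
  have "det_on (insert v V) A = (\<Sum>p | p permutes V. of_int (sign p) * (\<Prod>i\<in>insert v V. A i (p i)))"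
    unfolding det_on_def
  proof (rule sum.mono_neutral_right)
    show "{p. p permutes V} \<subseteq> {p. p permutes insert v V}"
      by (auto intro: permutes_subset)
    show "\<forall>p\<in>{p. p permutes insert v V} - {p. p permutes V}. real_of_int (sign p) * (\<Prod>i\<in>insert v V. A i (p i)) = 0"
    proof
      fix p assume "p \<in> {p. p permutes insert v V} - {p. p permutes V}"
      then have p: "p permutes insert v V" "\<not> p permutes V" by auto
      then have "p v \<noteq> v"
        using permutes_superset[OF p(1), of V] by auto
      then have "A v (p v) = 0"
        using p(1) row by (metis insertE insertI1 permutes_in_image)
      then show "real_of_int (sign p) * (\<Prod>i\<in>insert v V. A i (p i)) = 0"
        using assms(1) by auto
    qed
  qed (use assms in \<open>simp add: finite_permutations\<close>)
  also have "\<dots> = A v v * det_on V A"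
    unfolding det_on_def sum_distrib_left
  proof (rule sum.cong[OF refl])
    fix p assume "p \<in> {p. p permutes V}"
    then have "p v = v"
      using assms(2) by (auto simp: permutes_not_in)
    then show "real_of_int (sign p) * (\<Prod>i\<in>insert v V. A i (p i)) =
               A v v * (real_of_int (sign p) * (\<Prod>i\<in>V. A i (p i)))"
      using assms by simp
  qed
  finally show ?thesis .
qed

text \<open>
  Gaussian elimination: subtracting multiples of row \<open>v\<close> clears column \<open>v\<close> and leaves the Schur
  complement in the other rows.
\<close>

lemma det_on_schur:
  assumes V: "finite V" "v \<notin> V" and nz: "A v v \<noteq> 0"
  shows "det_on (insert v V) A = A v v * det_on V (\<lambda>i j. A i j - A i v * A v j / A v v)"
proof -
  let ?B = "\<lambda>S i j. if i \<in> S then A i j - A i v * A v j / A v v else A i j"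
  have "det_on (insert v V) (?B S) = det_on (insert v V) A" if "S \<subseteq> V" for S
    using finite_subset[OF that V(1)] that
  proof (induction S rule: finite_induct)
    case empty
    then show ?case by simp
  next
    case (insert k S)
    have "det_on (insert v V) (?B (insert k S)) =
        det_on (insert v V) (\<lambda>i j. if i = k then ?B S k j + (- A k v / A v v) * ?B S v j else ?B S i j)"
      using insert.hyps insert.prems V by (intro det_on_cong) auto
    also have "\<dots> = det_on (insert v V) (?B S)"
      using insert.hyps insert.prems V by (intro det_on_add_row) auto
    finally show ?case using insert by simp
  qed
  from this[of V] have "det_on (insert v V) A = det_on (insert v V) (?B V)"
    by simp
  also have "\<dots> = det_on (insert v V) (\<lambda>i j. ?B V j i)"
    using V by (subst det_on_transpose) auto
  also have "\<dots> = ?B V v v * det_on V (\<lambda>i j. ?B V j i)"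
    using V nz by (intro det_on_expand) auto
  also have "det_on V (\<lambda>i j. ?B V j i) = det_on V (\<lambda>i j. A i j - A i v * A v j / A v v)"
    using V by (subst det_on_transpose) (auto intro: det_on_cong)
  finally show ?thesis
    using V by simp
qed

text \<open>
  Merging introduces a new vertex name, so determinants over two different index sets must be compared.
\<close>

lemma det_on_rename:
  assumes V: "finite V" "a \<notin> V" "b \<notin> V"
    and eq: "A a a = B b b" "\<And>k. k \<in> V \<Longrightarrow> A a k = B b k" "\<And>k. k \<in> V \<Longrightarrow> A k a = B k b"
      "\<And>k l. k \<in> V \<Longrightarrow> l \<in> V \<Longrightarrow> A k l = B k l"
  shows "det_on (insert a V) A = det_on (insert b V) B"
proof -
  define f where "f = (\<lambda>k. if k = a then b else k)"
  have bij: "bij_betw f (insert a V) (insert b V)"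
    using V by (auto simp: bij_betw_def inj_on_def f_def)
  then have inj: "inj_on f (insert a V)"
    by (simp add: bij_betw_def)
  have A: "A i j = B (f i) (f j)" if "i \<in> insert a V" "j \<in> insert a V" for i j
    using that eq V by (auto simp: f_def)
  let ?g = "inv_into (insert a V) f"
  have g: "bij_betw ?g (insert b V) (insert a V)" "f (?g y) = y" if "y \<in> insert b V" for y
    using bij that by (auto simp: bij_betw_inv_into bij_betw_inv_into_right)
  have bijp: "bij_betw (map_permutation (insert a V) f) {p. p permutes insert a V} {p. p permutes insert b V}"
    by (rule bij_betw_byWitness[where f'="map_permutation (insert b V) (inv_into (insert a V) f)"])
      (use bij inj bij_betw_inv_into[OF bij] in \<open>auto intro!: map_permutation_permutes map_permutation_compose_inv
         simp: bij_betw_inv_into_left bij_betw_inv_into_right inv_into_into bij_betw_imp_surj_on\<close>)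
  have "(\<Sum>p | p permutes insert a V. of_int (sign p) * (\<Prod>i\<in>insert a V. A i (p i))) =
    (\<Sum>p | p permutes insert a V. of_int (sign (map_permutation (insert a V) f p)) *
         (\<Prod>i\<in>insert b V. B i (map_permutation (insert a V) f p i)))"
  proof (rule sum.cong[OF refl])
    fix p assume "p \<in> {p. p permutes insert a V}"
    then have p: "p permutes insert a V" by simp
    have "(\<Prod>i\<in>insert b V. B i (map_permutation (insert a V) f p i)) =
      (\<Prod>i\<in>insert a V. B (f i) (map_permutation (insert a V) f p (f i)))"
      by (rule prod.reindex_bij_betw[OF bij, symmetric])
    also have "\<dots> = (\<Prod>i\<in>insert a V. A i (p i))"
      using map_permutation_apply[OF inj] p A permutes_in_image[OF p]
      by (intro prod.cong refl) simp
    finally show "real_of_int (sign p) * (\<Prod>i\<in>insert a V. A i (p i)) =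
      real_of_int (sign (map_permutation (insert a V) f p)) *
       (\<Prod>i\<in>insert b V. B i (map_permutation (insert a V) f p i))"
      using sign_map_permutation[OF inj p] V by simp
  qed
  then show ?thesis
    unfolding det_on_def by (simp add: sum.reindex_bij_betw[OF bijp,
      of "\<lambda>p. of_int (sign p) * (\<Prod>i\<in>insert b V. B i (p i))"])
qed

lemma det_on_sum_column:
  assumes "finite V" "v \<notin> V"
  shows "det_on (insert v V) (\<lambda>i j. if j = v then (\<Sum>l\<in>insert v V. A i l) else A i j) = det_on (insert v V) A"
proof -
  let ?B = "\<lambda>S i j. if j = v then A i v + (\<Sum>l\<in>S. A i l) else A i j"
  have "det_on (insert v V) (?B S) = det_on (insert v V) A" if "S \<subseteq> V" for S
    using finite_subset[OF that assms(1)] that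
  proof (induction S rule: finite_induct)
    case empty
    show ?case by (intro det_on_cong) auto
  next
    case (insert k S)
    then have k: "k \<noteq> v" "k \<in> V" using assms by auto
    have "det_on (insert v V) (?B (insert k S)) =
      det_on (insert v V) (\<lambda>i j. if j = v then ?B S i v + 1 * ?B S i k else ?B S i j)"
      using insert.hyps k by (intro det_on_cong) (auto simp: add.assoc add.commute)
    also have "\<dots> = det_on (insert v V) (?B S)"
      using assms k by (intro det_on_add_column) auto
    finally show ?case using insert by simp
  qed
  moreover have "(\<Sum>l\<in>insert v V. A i l) = A i v + (\<Sum>l\<in>V. A i l)" for i
    using assms by simp
  ultimately show ?thesis
    by (simp only: subset_refl)
qed

text \<open>
  Adding all columns to column \<open>v\<close> and then all rows to row \<open>v\<close> annihilates the contribution of \<open>L\<close> there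
  and turns the entry at \<open>(v, v)\<close> into the product of the two sums; its Schur complement is \<open>L\<close> itself.
  Since the cofactor \<open>det_on V L\<close> does not involve \<open>a\<close> and \<open>b\<close>, pinning a Laplacian by different
  rank-one matrices changes its determinant by explicit factors only.
\<close>

lemma det_on_rank_one:
  assumes V: "finite V" "v \<notin> V"
    and rows: "\<And>i. i \<in> insert v V \<Longrightarrow> (\<Sum>j\<in>insert v V. L i j) = 0"
    and cols: "\<And>j. j \<in> insert v V \<Longrightarrow> (\<Sum>i\<in>insert v V. L i j) = 0"
    and nz: "(\<Sum>i\<in>insert v V. a i) \<noteq> 0" "(\<Sum>j\<in>insert v V. b j) \<noteq> 0"
  shows "det_on (insert v V) (\<lambda>i j. L i j + a i * b j) =
    (\<Sum>i\<in>insert v V. a i) * (\<Sum>j\<in>insert v V. b j) * det_on V L"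
proof -
  let ?U = "insert v V"
  define \<alpha> \<beta> where "\<alpha> = (\<Sum>i\<in>?U. a i)" and "\<beta> = (\<Sum>j\<in>?U. b j)"
  let ?A = "\<lambda>i j. L i j + a i * b j"
  let ?B = "\<lambda>i j. if j = v then a i * \<beta> else ?A i j"
  let ?C = "\<lambda>i j. if i = v then (if j = v then \<alpha> * \<beta> else \<alpha> * b j) else ?B i j"
  have "det_on ?U ?A = det_on ?U (\<lambda>i j. if j = v then (\<Sum>l\<in>?U. ?A i l) else ?A i j)"
    by (rule det_on_sum_column[OF V, symmetric])
  also have "\<dots> = det_on ?U ?B"
    using rows by (intro det_on_cong) (auto simp: sum.distrib sum_distrib_left[symmetric] \<beta>_def simp del: sum.insert)
  also have "\<dots> = det_on ?U (\<lambda>i j. ?B j i)"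
    using V by (subst det_on_transpose) auto
  also have "\<dots> = det_on ?U (\<lambda>i j. if j = v then (\<Sum>l\<in>?U. ?B l i) else ?B j i)"
    by (rule det_on_sum_column[OF V, symmetric])
  also have "\<dots> = det_on ?U (\<lambda>i j. ?C j i)"
    using cols by (intro det_on_cong) (auto simp: sum.distrib sum_distrib_right[symmetric] \<alpha>_def simp del: sum.insert)
  also have "\<dots> = det_on ?U ?C"
    using V by (subst det_on_transpose) auto
  also have "\<dots> = ?C v v * det_on V (\<lambda>i j. ?C i j - ?C i v * ?C v j / ?C v v)"
    using nz by (intro det_on_schur V) (simp add: \<alpha>_def \<beta>_def)
  also have "det_on V (\<lambda>i j. ?C i j - ?C i v * ?C v j / ?C v v) = det_on V L"
    using V nz[folded \<alpha>_def \<beta>_def] by (intro det_on_cong) auto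
  finally show ?thesis
    by (simp add: \<alpha>_def \<beta>_def)
qed

lemma det_on_scale:
  "finite V \<Longrightarrow> det_on V (\<lambda>i j. r * A i j) = r ^ card V * det_on V A"
  by (simp add: det_on_def prod.distrib sum_distrib_left mult_ac)

lemma borel_measurable_det_on:
  assumes "\<And>i j. i \<in> V \<Longrightarrow> j \<in> V \<Longrightarrow> (\<lambda>u. A u i j) \<in> borel_measurable M"
  shows "(\<lambda>u. det_on V (A u)) \<in> borel_measurable M"
  unfolding det_on_def
  by (intro borel_measurable_sum borel_measurable_times borel_measurable_const borel_measurable_prod assms)
    (auto simp: permutes_in_image)

section \<open>Gaussian integrals\<close>

lemma nn_integral_gaussian:
  fixes a b :: real
  assumes a: "a > 0"
  shows "(\<integral>\<^sup>+ s. ennreal (exp (- (a * (s + b)\<^sup>2) / 2)) \<partial>lborel) = ennreal (sqrt (2 * pi / a))"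
proof -
  let ?n = "normal_density (- b) (1 / sqrt a)"
  have e: "exp (- (a * (s + b)\<^sup>2 / 2)) = sqrt (2 * pi / a) * ?n s" for s
    using a by (simp add: normal_density_def real_sqrt_divide real_sqrt_mult power_divide field_simps)
  interpret prob_space "density lborel ?n"
    by (rule prob_space_normal_density) (use a in simp)
  have "(\<integral>\<^sup>+ s. ennreal (?n s) \<partial>lborel) = 1"
    using emeasure_space_1 by (simp add: emeasure_density)
  then show ?thesis
    using a by (simp add: e ennreal_mult nn_integral_cmult del: minus_divide_left)
qed

text \<open>
  The variables are integrated out one after the other.  Completing the square in \<open>s v\<close> leaves the quadratic form
  of the Schur complement, which matches \<open>det_on_schur\<close>; positivity of the determinant comes along in the
  same induction.
\<close>

lemma nn_integral_gaussian_quadratic_form: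
  fixes A :: "'v \<Rightarrow> 'v \<Rightarrow> real"
  assumes "finite V"
    and "\<And>i j. i \<in> V \<Longrightarrow> j \<in> V \<Longrightarrow> A i j = A j i"
    and "\<And>s. \<exists>i\<in>V. s i \<noteq> 0 \<Longrightarrow> 0 < (\<Sum>i\<in>V. \<Sum>j\<in>V. s i * A i j * s j)"
  shows "det_on V A > 0 \<and>
    (\<integral>\<^sup>+ s. ennreal (exp (- (\<Sum>i\<in>V. \<Sum>j\<in>V. s i * A i j * s j) / 2)) \<partial>(\<Pi>\<^sub>M i\<in>V. lborel))
      = ennreal (sqrt ((2 * pi) ^ card V / det_on V A))"
  using assms
proof (induction V arbitrary: A rule: finite_induct)
  case empty
  then show ?case
    by (simp add: det_on_def PiM_empty)
next
  case (insert v V)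
  interpret product_sigma_finite "\<lambda>_::'v. lborel :: real measure"
    by standard
  let ?Q = "\<lambda>V A s. \<Sum>i\<in>V. \<Sum>j\<in>V. s i * A i j * s j"
  define a where "a = A v v"
  define S where "S = (\<lambda>i j. A i j - A i v * A v j / a)"
  define L where "L = (\<lambda>s. (\<Sum>j\<in>V. A v j * s j) / a)"
  have sym: "A i v = A v i" if "i \<in> V" for i
    using insert.prems(1) that by auto
  have a: "a > 0"
  proof -
    have "(\<Sum>j\<in>V. A v j * (if j = v then 1 else 0)) = 0"
      "(\<Sum>i\<in>V. (if i = v then 1 else 0) * A i v) = 0"
      "(\<Sum>i\<in>V. \<Sum>j\<in>V. (if i = v then 1 else 0) * A i j * (if j = v then 1 else 0)) = 0"
      using insert.hyps by (auto intro!: sum.neutral)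
    then show ?thesis
      using insert.prems(2)[of "\<lambda>i. if i = v then 1 else 0"] insert.hyps
      by (simp add: a_def sum.distrib)
  qed
  have Q: "?Q (insert v V) A s = a * (s v + L s)\<^sup>2 + ?Q V S s" for s
  proof -
    have aL: "a * L s = (\<Sum>j\<in>V. A v j * s j)"
      using a by (simp add: L_def)
    have 1: "(\<Sum>i\<in>V. s i * A i v * s v) = s v * (a * L s)"
      unfolding aL sum_distrib_left by (intro sum.cong) (simp_all add: sym)
    have 2: "(\<Sum>j\<in>V. s v * A v j * s j) = s v * (a * L s)"
      unfolding aL sum_distrib_left by (intro sum.cong) simp_all
    have "?Q V S s = ?Q V A s - (\<Sum>i\<in>V. \<Sum>j\<in>V. (A v i * s i) * (A v j * s j)) / a"
      by (simp add: S_def sym algebra_simps sum_subtractf sum_divide_distrib)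
    also have "(\<Sum>i\<in>V. \<Sum>j\<in>V. (A v i * s i) * (A v j * s j)) = (a * L s)\<^sup>2"
      unfolding aL by (simp add: power2_eq_square sum_product)
    finally have 3: "?Q V S s = ?Q V A s - a * (L s)\<^sup>2"
      using a by (simp add: power2_eq_square)
    have "?Q (insert v V) A s = s v * a * s v + (\<Sum>j\<in>V. s v * A v j * s j)
        + ((\<Sum>i\<in>V. s i * A i v * s v) + ?Q V A s)"
      using insert.hyps by (simp add: a_def sum.distrib)
    then show ?thesis
      unfolding 1 2 3 by (simp add: power2_eq_square algebra_simps)
  qed
  have local: "L s = L s'" "?Q V S s = ?Q V S s'" if "\<And>i. i \<in> V \<Longrightarrow> s i = s' i" for s s'
    by (simp_all add: L_def that cong: sum.cong)
  have IH: "det_on V S > 0 \<and> (\<integral>\<^sup>+ s. ennreal (exp (- ?Q V S s / 2)) \<partial>(\<Pi>\<^sub>M i\<in>V. lborel))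
      = ennreal (sqrt ((2 * pi) ^ card V / det_on V S))"
  proof (rule insert.IH)
    show "S i j = S j i" if "i \<in> V" "j \<in> V" for i j
      using that insert.prems(1) by (auto simp: S_def)
    show "0 < ?Q V S s" if "\<exists>i\<in>V. s i \<noteq> 0" for s
    proof -
      obtain s' where s': "s' v = - L s" "\<And>i. i \<in> V \<Longrightarrow> s' i = s i"
        using insert.hyps by (intro that[of "s(v := - L s)"]) auto
      then have "L s' = L s" "?Q V S s' = ?Q V S s"
        by (auto intro!: local)
      moreover have "0 < ?Q (insert v V) A s'"
        using that s' by (intro insert.prems(2)) (metis insertI2)
      ultimately show ?thesis
        unfolding Q using s' by simp
    qed
  qed
  have det: "det_on (insert v V) A = a * det_on V S"
    using a insert.hyps by (simp add: det_on_schur a_def S_def)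
  have meas: "(\<lambda>s. ennreal (exp (- ?Q (insert v V) A s / 2))) \<in> borel_measurable (\<Pi>\<^sub>M i\<in>insert v V. lborel)"
    by (intro measurable_compose[OF _ measurable_ennreal] borel_measurable_exp borel_measurable_divide borel_measurable_uminus
       borel_measurable_sum borel_measurable_times borel_measurable_const) auto
  have "(\<integral>\<^sup>+ s. ennreal (exp (- ?Q (insert v V) A s / 2)) \<partial>(\<Pi>\<^sub>M i\<in>insert v V. lborel)) =
    (\<integral>\<^sup>+ x. (\<integral>\<^sup>+ y. ennreal (exp (- ?Q (insert v V) A (x(v := y)) / 2)) \<partial>lborel) \<partial>(\<Pi>\<^sub>M i\<in>V. lborel))"
    by (rule product_nn_integral_insert[OF insert.hyps(1,2) meas])
  also have "\<dots> = (\<integral>\<^sup>+ x. ennreal (exp (- ?Q V S x / 2)) * ennreal (sqrt (2 * pi / a)) \<partial>(\<Pi>\<^sub>M i\<in>V. lborel))"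
  proof (rule nn_integral_cong)
    fix x :: "'v \<Rightarrow> real"
    have off: "(x(v := y)) i = x i" if "i \<in> V" for i y
      using that insert.hyps by auto
    have *: "L (x(v := y)) = L x" "?Q V S (x(v := y)) = ?Q V S x" for y
      using off by (auto intro!: local)
    have "exp (- ?Q (insert v V) A (x(v := y)) / 2) = exp (- ?Q V S x / 2) * exp (- (a * (y + L x)\<^sup>2) / 2)" for y
      unfolding Q * by (simp add: exp_add[symmetric] add_divide_distrib[symmetric])
    then show "(\<integral>\<^sup>+ y. ennreal (exp (- ?Q (insert v V) A (x(v := y)) / 2)) \<partial>lborel) =
        ennreal (exp (- ?Q V S x / 2)) * ennreal (sqrt (2 * pi / a))"
      using nn_integral_gaussian[OF a, of "L x"] by (simp add: ennreal_mult nn_integral_cmult)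
  qed
  also have "\<dots> = ennreal (sqrt ((2 * pi) ^ card V / det_on V S)) * ennreal (sqrt (2 * pi / a))"
    using IH by (subst nn_integral_multc)
      (auto intro!: measurable_compose[OF _ measurable_ennreal] borel_measurable_exp borel_measurable_divide borel_measurable_uminus
       borel_measurable_sum borel_measurable_times borel_measurable_const)
  also have "\<dots> = ennreal (sqrt ((2 * pi) ^ card (insert v V) / det_on (insert v V) A))"
    using a IH insert.hyps by (simp add: det ennreal_mult[symmetric] real_sqrt_mult[symmetric] mult_ac)
  finally show ?case
    using det a IH by simp
qed

section \<open>The hyperbolic sine of a Gaussian variable\<close>

text \<open>
  The measure \<open>cosh x dx\<close> is transported to Lebesgue measure by \<open>sinh\<close>, because it gives the
  interval between \<open>x\<close> and \<open>y\<close> the mass \<open>sinh y - sinh x\<close>.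
\<close>

lemma nn_integral_sinh_substitution:
  fixes f :: "real \<Rightarrow> ennreal"
  assumes [measurable]: "f \<in> borel_measurable borel"
  shows "(\<integral>\<^sup>+ x. ennreal (cosh x) * f (sinh x) \<partial>lborel) = (\<integral>\<^sup>+ z. f z \<partial>lborel)"
proof -
  have c: "continuous_on UNIV (sinh :: real \<Rightarrow> real)" "continuous_on UNIV (cosh :: real \<Rightarrow> real)"
    by (auto intro!: continuous_intros)
  have [measurable]: "(sinh :: real \<Rightarrow> real) \<in> borel_measurable borel" "(cosh :: real \<Rightarrow> real) \<in> borel_measurable borel"
    using c by (auto intro: borel_measurable_continuous_onI)
  have "lborel = distr (density lborel (\<lambda>x. ennreal (cosh x))) borel (sinh :: real \<Rightarrow> real)"
  proof (rule lborel_eqI)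
    fix l u :: real
    assume "\<And>b. b \<in> Basis \<Longrightarrow> l \<bullet> b \<le> u \<bullet> b"
    then have lu: "l \<le> u" by simp
    obtain x y where xy: "sinh x = l" "sinh y = u"
      by (metis sinh_arsinh_real)
    have "x \<le> y" using lu xy by (metis sinh_real_le_iff)
    have "emeasure (distr (density lborel (\<lambda>x. ennreal (cosh x))) borel sinh) (box l u) =
      (\<integral>\<^sup>+ t. ennreal (cosh t) * indicator (sinh -` {l<..<u}) t \<partial>lborel)"
      using measurable_sets_borel[of sinh borel "{l<..<u}"]
      by (simp add: emeasure_distr emeasure_density box_real)
    also have "\<dots> = (\<integral>\<^sup>+ t. ennreal (cosh t) * indicator {x..y} t \<partial>lborel)"
    proof (rule nn_integral_cong_AE)
      have "AE t in lborel. t \<noteq> x" "AE t in lborel. t \<noteq> y"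
        by (auto simp: AE_lborel_singleton)
      then show "AE t in lborel. ennreal (cosh t) * indicator (sinh -` {l<..<u}) t = ennreal (cosh t) * indicator {x..y} t"
        by eventually_elim (auto simp: indicator_def xy[symmetric])
    qed
    also have "\<dots> = ennreal (sinh y - sinh x)"
      using \<open>x \<le> y\<close>
      by (intro nn_integral_FTC_Icc) (auto intro!: derivative_eq_intros simp: cosh_real_nonneg)
    finally show "emeasure (distr (density lborel (\<lambda>x. ennreal (cosh x))) borel sinh) (box l u) = (\<Prod>b\<in>Basis. (u - l) \<bullet> b)"
      using xy by simp
  qed simp
  then have "(\<integral>\<^sup>+ z. f z \<partial>lborel) = (\<integral>\<^sup>+ z. f z \<partial>distr (density lborel (\<lambda>x. ennreal (cosh x))) borel sinh)"
    by simp
  then show ?thesis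
    by (simp add: nn_integral_distr nn_integral_density)
qed

lemma borel_measurable_sinh_cosh [measurable]:
  "(sinh :: real \<Rightarrow> real) \<in> borel_measurable borel" "(cosh :: real \<Rightarrow> real) \<in> borel_measurable borel"
  by (auto intro!: borel_measurable_continuous_onI continuous_intros)

lemma nn_integral_reflect:
  fixes f :: "real \<Rightarrow> ennreal"
  assumes "f \<in> borel_measurable borel"
  shows "(\<integral>\<^sup>+ x. f (- x) \<partial>lborel) = (\<integral>\<^sup>+ x. f x \<partial>lborel)"
  using nn_integral_real_affine[OF assms, of "-1" 0] by simp

text \<open>
  The density of \<open>x\<close> when \<open>sinh x\<close> is a centred Gaussian variable with variance \<open>1 / (2 * q)\<close>.
\<close>

definition split_kernel :: "real \<Rightarrow> real \<Rightarrow> real" where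
  "split_kernel q x = cosh x * (sqrt (q / pi) * exp (- q * (sinh x)\<^sup>2))"

lemma split_kernel_nonneg: "q \<ge> 0 \<Longrightarrow> 0 \<le> split_kernel q x"
  by (simp add: split_kernel_def)

lemma split_kernel_minus [simp]: "split_kernel q (- x) = split_kernel q x"
  by (simp add: split_kernel_def)

lemma borel_measurable_split_kernel [measurable]:
  "split_kernel q \<in> borel_measurable borel"
  unfolding split_kernel_def by measurable

lemma normal_density_precision:
  assumes "q > 0"
  shows "normal_density 0 (1 / sqrt (2 * q)) z = sqrt (q / pi) * exp (- q * z\<^sup>2)"
  using assms by (simp add: normal_density_def power_divide real_sqrt_divide field_simps)

lemma split_kernel_total:
  assumes q: "q > 0"
  shows "(\<integral>\<^sup>+ x. ennreal (split_kernel q x) \<partial>lborel) = 1"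
proof -
  let ?n = "normal_density 0 (1 / sqrt (2 * q))"
  interpret prob_space "density lborel ?n"
    by (rule prob_space_normal_density) (use q in simp)
  have "(\<integral>\<^sup>+ s. ennreal (?n s) \<partial>lborel) = 1"
    using emeasure_space_1 by (simp add: emeasure_density)
  then show ?thesis
    using nn_integral_sinh_substitution[of "\<lambda>z. ennreal (?n z)"] q
    by (simp add: split_kernel_def normal_density_precision ennreal_mult)
qed

lemma split_kernel_variance:
  assumes q: "q > 0"
  shows "(\<integral>\<^sup>+ x. ennreal (split_kernel q x * (sinh x)\<^sup>2) \<partial>lborel) = ennreal (1 / (2 * q))"
proof -
  let ?n = "normal_density 0 (1 / sqrt (2 * q))"
  have "has_bochner_integral lborel (\<lambda>x. ?n x * (x - 0) ^ (2 * 1)) (fact (2 * 1) / ((2 / (1 / sqrt (2 * q))\<^sup>2) ^ 1 * fact 1))"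
    by (rule normal_moment_even) (use q in simp)
  then have "has_bochner_integral lborel (\<lambda>x. ?n x * x\<^sup>2) (1 / (2 * q))"
    using q by (simp add: power_divide)
  then have "(\<integral>\<^sup>+ s. ennreal (?n s * s\<^sup>2) \<partial>lborel) = ennreal (1 / (2 * q))"
    by (subst nn_integral_eq_integral) (auto simp: has_bochner_integral_iff)
  then show ?thesis
    using nn_integral_sinh_substitution[of "\<lambda>z. ennreal (?n z * z\<^sup>2)"] q
    by (simp add: split_kernel_def normal_density_precision ennreal_mult[symmetric] mult.assoc)
qed

text \<open>
  The coordinate \<open>t\<close> is the logarithm of the average of \<open>exp y\<close> and \<open>exp z\<close>, and \<open>x\<close> is half of \<open>y - z\<close>.
  For fixed \<open>x\<close> the change from \<open>t\<close> to \<open>z\<close> is a translation, and for fixed \<open>z\<close> the change from \<open>x\<close>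
  to \<open>y\<close> is affine with slope 2; no Jacobian matrix is needed.
\<close>

lemma nn_integral_split_coordinates:
  fixes f :: "real \<Rightarrow> real \<Rightarrow> ennreal"
  assumes [measurable]: "case_prod f \<in> borel_measurable (lborel \<Otimes>\<^sub>M lborel)"
  shows "(\<integral>\<^sup>+ z. \<integral>\<^sup>+ y. f y z \<partial>lborel \<partial>lborel) =
    (\<integral>\<^sup>+ t. \<integral>\<^sup>+ x. 2 * f (t + x - ln (cosh x)) (t - x - ln (cosh x)) \<partial>lborel \<partial>lborel)"
proof -
  have "(\<integral>\<^sup>+ t. \<integral>\<^sup>+ x. 2 * f (t + x - ln (cosh x)) (t - x - ln (cosh x)) \<partial>lborel \<partial>lborel) =
    (\<integral>\<^sup>+ x. \<integral>\<^sup>+ t. 2 * f (t + x - ln (cosh x)) (t - x - ln (cosh x)) \<partial>lborel \<partial>lborel)"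
    by (rule lborel_pair.Fubini') measurable
  also have "\<dots> = (\<integral>\<^sup>+ x. \<integral>\<^sup>+ z. 2 * f (z + 2 * x) z \<partial>lborel \<partial>lborel)"
  proof (rule nn_integral_cong)
    fix x :: real
    show "(\<integral>\<^sup>+ t. 2 * f (t + x - ln (cosh x)) (t - x - ln (cosh x)) \<partial>lborel) = (\<integral>\<^sup>+ z. 2 * f (z + 2 * x) z \<partial>lborel)"
      using nn_integral_real_affine[of "\<lambda>z. 2 * f (z + 2 * x) z" 1 "- x - ln (cosh x)"]
      by (simp add: algebra_simps)
  qed
  also have "\<dots> = (\<integral>\<^sup>+ z. \<integral>\<^sup>+ x. 2 * f (z + 2 * x) z \<partial>lborel \<partial>lborel)"
    by (rule lborel_pair.Fubini') measurable
  also have "\<dots> = (\<integral>\<^sup>+ z. \<integral>\<^sup>+ y. f y z \<partial>lborel \<partial>lborel)"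
  proof (rule nn_integral_cong)
    fix z :: real
    show "(\<integral>\<^sup>+ x. 2 * f (z + 2 * x) z \<partial>lborel) = (\<integral>\<^sup>+ y. f y z \<partial>lborel)"
      using nn_integral_real_affine[of "\<lambda>y. f y z" 2 z] by (simp add: nn_integral_cmult)
  qed
  finally show ?thesis ..
qed

text \<open>
  The law of the height of a graph that consists of a single vertex with pinning \<open>H\<close>.
\<close>

definition root_density :: "real \<Rightarrow> real \<Rightarrow> real" where
  "root_density H t = sqrt (H / (2 * pi)) * exp (- t / 2) * exp (- H * (cosh t - 1))"

lemma borel_measurable_root_density [measurable]: "root_density H \<in> borel_measurable borel"
  unfolding root_density_def by measurable

text \<open>
  Symmetrising in \<open>t\<close> replaces \<open>exp (- t / 2)\<close> by \<open>cosh (t / 2)\<close>, and since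
  \<open>cosh t - 1 = 2 * (sinh (t / 2))\<^sup>2\<close> the result is again the Gaussian kernel in the variable \<open>sinh (t / 2)\<close>.
\<close>

lemma root_density_total:
  assumes H: "H > 0"
  shows "(\<integral>\<^sup>+ t. ennreal (root_density H t) \<partial>lborel) = 1"
proof -
  have nn: "root_density H t \<ge> 0" for t
    using H by (simp add: root_density_def)
  have sym: "root_density H (2 * x) + root_density H (- (2 * x)) = split_kernel (2 * H) x" for x
  proof -
    have factor: "A * e * B + A * e' * B = A * (e + e') * B" for A e B e' :: real
      by (simp add: algebra_simps)
    have "cosh (2 * x) - 1 = 2 * (sinh x)\<^sup>2"
      using cosh_double_cosh[of x] cosh_square_eq[of x] by simp
    moreover have "sqrt (2 * H / pi) = 2 * sqrt (H / (2 * pi))"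
      using real_sqrt_mult[of 4 "H / (2 * pi)"] by simp
    moreover have "exp (- x) + exp x = 2 * cosh x"
      by (simp add: cosh_def)
    then have "root_density H (2 * x) + root_density H (- (2 * x)) =
        sqrt (H / (2 * pi)) * (2 * cosh x) * exp (- H * (cosh (2 * x) - 1))"
      using factor[of "sqrt (H / (2 * pi))" "exp (- x)" "exp (- H * (cosh (2 * x) - 1))" "exp x"]
      by (simp add: root_density_def)
    ultimately show ?thesis
      by (simp add: split_kernel_def)
  qed
  have refl: "(\<integral>\<^sup>+ x. ennreal (root_density H (- (2 * x))) \<partial>lborel) =
      (\<integral>\<^sup>+ x. ennreal (root_density H (2 * x)) \<partial>lborel)"
    using nn_integral_reflect[of "\<lambda>x. ennreal (root_density H (2 * x))"]
    unfolding mult_minus_right by measurable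
  have "(\<integral>\<^sup>+ t. ennreal (root_density H t) \<partial>lborel) = 2 * (\<integral>\<^sup>+ x. ennreal (root_density H (2 * x)) \<partial>lborel)"
    using nn_integral_real_affine[of "\<lambda>t. ennreal (root_density H t)" 2 0] by simp
  also have "\<dots> = (\<integral>\<^sup>+ x. ennreal (root_density H (2 * x)) \<partial>lborel) + (\<integral>\<^sup>+ x. ennreal (root_density H (- (2 * x))) \<partial>lborel)"
    unfolding refl by (rule mult_2)
  also have "\<dots> = (\<integral>\<^sup>+ x. ennreal (split_kernel (2 * H) x) \<partial>lborel)"
    unfolding sym[symmetric] ennreal_plus[OF nn nn] by (rule nn_integral_add[symmetric]) measurable
  also have "\<dots> = 1"
    using H by (simp add: split_kernel_total)
  finally show ?thesis .
qed

section \<open>Merging a pair of indistinguishable vertices\<close>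

text \<open>
  For \<open>\<eta> = 0\<close> this is the density of the heights \<open>u\<close> after integration over \<open>s\<close>.  The term with \<open>\<eta>\<close> adds to the
  Laplacian the rank-one matrix of the vector \<open>\<eta> i * exp (u i)\<close>, which merging turns into a matrix of the same form.
  It makes the determinant nonzero when \<open>h = 0\<close>.
\<close>

definition u_density ::
  "'v set \<Rightarrow> ('v \<Rightarrow> 'v \<Rightarrow> real) \<Rightarrow> ('v \<Rightarrow> real) \<Rightarrow> ('v \<Rightarrow> real) \<Rightarrow> ('v \<Rightarrow> real) \<Rightarrow> real" where
  "u_density V W h \<eta> u =
     exp (- (\<Sum>i\<in>V. \<Sum>j\<in>V. W i j * (cosh (u i - u j) - 1))) *
     exp (- (\<Sum>i\<in>V. h i * (cosh (u i) - 1))) *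
     sqrt (det_on V (\<lambda>i j. M_mat V W h u i j + (\<eta> i * exp (u i)) * (\<eta> j * exp (u j)))) *
     (\<Prod>i\<in>V. exp (- u i) / sqrt (2 * pi))"

text \<open>
  Half the inverse variance of the Gaussian variable \<open>sinh x\<close> that describes how the merged vertex \<open>a\<close> splits into \<open>i\<close> and \<open>j\<close>.
\<close>

definition split_precision ::
  "'v set \<Rightarrow> ('v \<Rightarrow> 'v \<Rightarrow> real) \<Rightarrow> ('v \<Rightarrow> real) \<Rightarrow> ('v \<Rightarrow> real) \<Rightarrow> 'v \<Rightarrow> 'v \<Rightarrow> 'v \<Rightarrow> real" where
  "split_precision V W h u a i j =
     (h a + 2 * (\<Sum>k\<in>V. W a k * exp (u k))) / (2 * exp (u a)) + 4 * W i j"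

text \<open>
  Two vertices that look the same from outside, and the vertex \<open>a\<close> that is to replace them.  One weight function
  serves both graphs: additivity \<open>W a k = W i k + W j k\<close> together with symmetry between \<open>i\<close> and \<open>j\<close> is
  expressed by halving.
\<close>

locale sibling_pair =
  fixes V :: "'v set" and W :: "'v \<Rightarrow> 'v \<Rightarrow> real" and h \<eta> :: "'v \<Rightarrow> real" and a i j :: 'v
  assumes fin: "finite V"
    and new: "a \<notin> V" "i \<notin> V" "j \<notin> V" "i \<noteq> j" "a \<noteq> i" "a \<noteq> j"
    and W_sym: "\<And>k l. W k l = W l k"
    and W_half: "\<And>k. k \<in> V \<Longrightarrow> W i k = W a k / 2" "\<And>k. k \<in> V \<Longrightarrow> W j k = W a k / 2"
    and h_half: "h i = h a / 2" "h j = h a / 2"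
    and \<eta>_half: "\<eta> i = \<eta> a / 2" "\<eta> j = \<eta> a / 2"

text \<open>
  With \<open>x k = exp (u k)\<close>, rows \<open>i\<close> and \<open>j\<close> divided by \<open>x i\<close> and \<open>x j\<close> agree outside the pair, and
  their difference is proportional to the difference of two unit vectors.  Hence one row operation followed by one
  column operation isolates an entry, and the remaining minor is the Laplacian of the merged graph.
\<close>

lemma (in sibling_pair) det_on_merge_laplacian:
  fixes u :: "'v \<Rightarrow> real"
  assumes avg: "exp (u i) + exp (u j) = 2 * exp (u a)"
  shows "det_on (insert i (insert j V)) (M_mat (insert i (insert j V)) W h u) =
    exp (u i) * exp (u j) / 2 * split_precision V W h u a i j *
      det_on (insert a V) (M_mat (insert a V) W h u)"
proof -
  let ?U = "insert i (insert j V)" and ?x = "\<lambda>k. exp (u k)"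
  let ?A = "M_mat ?U W h u" and ?C = "M_mat (insert a V) W h u"
  \<comment> \<open>The multiple of row \<open>i\<close> that cancels row \<open>j\<close> outside the pair.\<close>
  define r where "r = ?x j / ?x i"
  define B1 where "B1 = (\<lambda>k l. if k = j then ?A j l + (- r) * ?A i l else ?A k l)"
  define B2 where "B2 = (\<lambda>k l. if l = i then B1 k i + 1 * B1 k j else B1 k l)"
  define s where "s = (\<Sum>k\<in>V. W a k * ?x k)"
  have rx: "r * ?x i = ?x j"
    by (simp add: r_def)
  have s_i: "(\<Sum>k\<in>V. W i k * exp (u i + u k)) = ?x i * s / 2"
    and s_j: "(\<Sum>k\<in>V. W j k * exp (u j + u k)) = ?x j * s / 2"
    and s_a: "(\<Sum>k\<in>V. W a k * exp (u a + u k)) = ?x a * s"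
    unfolding s_def sum_distrib_left sum_divide_distrib
    by (auto intro!: sum.cong simp: W_half exp_add)
  have Ui: "?U - {i} = insert j V" and Uj: "?U - {j} = insert i V" and Ua: "insert a V - {a} = V"
    using new by auto
  have Aii: "?A i i = ?x i * (h a / 2 + 2 * W i j * ?x j + s)"
  proof -
    have "?A i i = h i * ?x i + 2 * (W i j * exp (u i + u j) + (\<Sum>k\<in>V. W i k * exp (u i + u k)))"
      using fin new by (simp add: M_mat_def Ui)
    then show ?thesis
      unfolding s_i h_half unfolding exp_add by (simp add: algebra_simps)
  qed
  have Ajj: "?A j j = ?x j * (h a / 2 + 2 * W i j * ?x i + s)"
  proof -
    have "?A j j = h j * ?x j + 2 * (W i j * exp (u j + u i) + (\<Sum>k\<in>V. W j k * exp (u j + u k)))"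
      using fin new W_sym[of j i] by (simp add: M_mat_def Uj)
    then show ?thesis
      unfolding s_j h_half unfolding exp_add by (simp add: algebra_simps)
  qed
  have Aij: "?A i j = - 2 * W i j * ?x i * ?x j" and Aji: "?A j i = - 2 * W i j * ?x i * ?x j"
    using new W_sym[of j i] by (simp_all add: M_mat_def exp_add)
  have Aik: "?A i k = - W a k * ?x i * ?x k" and Ajk: "?A j k = - W a k * ?x j * ?x k"
    and Aki: "?A k i = - W a k * ?x i * ?x k" and Akj: "?A k j = - W a k * ?x j * ?x k" if "k \<in> V" for k
    using new that by (auto simp: M_mat_def exp_add W_half W_sym[of k i] W_sym[of k j])
  have Akl: "?A k l = ?C k l" if "k \<in> V" "l \<in> V" for k l
  proof (cases "k = l")
    case True
    have "?U - {k} = insert i (insert j (V - {k}))" "insert a V - {k} = insert a (V - {k})"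
      using that new by auto
    moreover have "W k i * exp (u k + u i) + W k j * exp (u k + u j) = W k a * exp (u k + u a)"
    proof -
      have "W k i * exp (u k + u i) + W k j * exp (u k + u j) = W a k / 2 * ?x k * (?x i + ?x j)"
        unfolding W_sym[of k i] W_sym[of k j] W_half[OF that(1)] exp_add by (simp add: algebra_simps)
      also have "\<dots> = W k a * exp (u k + u a)"
        unfolding avg by (simp add: exp_add W_sym[of k a])
      finally show ?thesis .
    qed
    ultimately show ?thesis
      using that new fin True by (simp add: M_mat_def add.assoc[symmetric])
  qed (use that new in \<open>auto simp: M_mat_def\<close>)
  have Caa: "?C a a = ?x a * (h a + 2 * s)"
  proof -
    have "?C a a = h a * ?x a + 2 * (\<Sum>k\<in>V. W a k * exp (u a + u k))"
      by (simp add: M_mat_def Ua)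
    also have "\<dots> = h a * ?x a + 2 * (?x a * s)"
      by (simp only: s_a)
    also have "\<dots> = ?x a * (h a + 2 * s)"
      by (simp only: distrib_left mult.commute mult.left_commute)
    finally show ?thesis .
  qed
  have Cak: "?C a k = - 2 * W a k * ?x a * ?x k" and Cka: "?C k a = - 2 * W a k * ?x a * ?x k"
    if "k \<in> V" for k
  proof -
    have "a \<noteq> k" using new that by auto
    then show "?C a k = - 2 * W a k * ?x a * ?x k" "?C k a = - 2 * W a k * ?x a * ?x k"
      by (simp_all add: M_mat_def exp_add W_sym[of k a])
  qed
  have q: "?x a * split_precision V W h u a i j = h a / 2 + s + 4 * W i j * ?x a"
    by (simp add: split_precision_def s_def field_simps)
  have "det_on ?U ?A = det_on ?U B1"
    unfolding B1_def using fin new by (intro det_on_add_row[symmetric]) auto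
  also have "\<dots> = det_on ?U B2"
    unfolding B2_def using fin new by (intro det_on_add_column[symmetric]) auto
  also have "?U = insert j (insert i V)"
    by auto
  also have "det_on (insert j (insert i V)) B2 = B2 j j * det_on (insert i V) B2"
  proof (rule det_on_expand)
    fix k assume "k \<in> insert i V"
    then show "B2 j k = 0"
    proof
      assume "k = i"
      have "B2 j i = (?A j i + ?A j j) - r * (?A i i + ?A i j)"
        by (simp add: B2_def B1_def algebra_simps)
      also have "\<dots> = (?x j - r * ?x i) * (h a / 2 + s)"
        unfolding Aii Aij Ajj Aji by (simp add: algebra_simps)
      finally show ?thesis using \<open>k = i\<close> rx by simp
    next
      assume k: "k \<in> V"
      then have "B2 j k = (r * ?x i - ?x j) * (W a k * ?x k)"
        using new by (auto simp: B2_def B1_def Aik Ajk algebra_simps)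
      then show ?thesis using rx by simp
    qed
  qed (use fin new in auto)
  also have "B2 j j = ?x j * (?x a * split_precision V W h u a i j)"
  proof -
    have "B2 j j = ?A j j - r * ?A i j"
      using new by (simp add: B2_def B1_def)
    also have "\<dots> = ?x j * (h a / 2 + s + 2 * W i j * (?x i + r * ?x i))"
      unfolding Ajj Aij by (simp add: algebra_simps)
    also have "?x i + r * ?x i = 2 * ?x a"
      using avg rx by simp
    finally show ?thesis
      unfolding q by simp
  qed
  also have "det_on (insert i V) B2 = ?x i / (2 * ?x a) * det_on (insert a V) ?C"
  proof -
    let ?c = "?x i / (2 * ?x a)"
    define D where "D = (\<lambda>k l. if k = i then (2 * ?x a / ?x i) * B2 k l else B2 k l)"
    have "det_on (insert i V) B2 = det_on (insert i V) (\<lambda>k l. if k = i then ?c * D k l else D k l)"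
      by (intro det_on_cong) (simp add: D_def)
    also have "\<dots> = ?c * det_on (insert i V) D"
      using fin by (intro det_on_scale_row) auto
    also have "det_on (insert i V) D = det_on (insert a V) ?C"
    proof (rule det_on_rename)
      have "B2 i i = ?A i i + ?A i j"
        using new by (simp add: B2_def B1_def)
      also have "\<dots> = ?x i * (h a / 2 + s)"
        unfolding Aii Aij by (simp add: algebra_simps)
      finally show "D i i = ?C a a"
        unfolding Caa by (simp add: D_def)
      fix k assume k: "k \<in> V"
      then have "k \<noteq> i" "k \<noteq> j" using new by auto
      have "B2 i k = - W a k * ?x i * ?x k"
        using new Aik[OF k] \<open>k \<noteq> i\<close> by (simp add: B2_def B1_def)
      then show "D i k = ?C a k"
        unfolding Cak[OF k] by (simp add: D_def)
      have "B2 k i = - W a k * (?x i + ?x j) * ?x k"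
        using Aki[OF k] Akj[OF k] \<open>k \<noteq> j\<close> by (simp add: B2_def B1_def algebra_simps)
      then show "D k i = ?C k a"
        unfolding Cka[OF k] avg using \<open>k \<noteq> i\<close> by (simp add: D_def)
      fix l assume l: "l \<in> V"
      then have "l \<noteq> i" using new by auto
      then show "D k l = ?C k l"
        using Akl[OF k l] \<open>k \<noteq> i\<close> \<open>k \<noteq> j\<close> by (simp add: D_def B2_def B1_def)
    qed (use fin new in auto)
    finally show ?thesis .
  qed
  finally show ?thesis
    by (simp add: mult_ac insert_commute[of i j])
qed

text \<open>
  The rank-one term can be hidden in the parameters of a plain Laplacian: it lowers the weights and
  raises the pinning by a multiple of \<open>R\<close>.  As \<open>R\<close> has the same value before and after merging,
  \<open>det_on_merge_laplacian\<close> extends to \<open>\<eta> \<noteq> 0\<close>, applied to a Laplacian whose weights may be negative.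
\<close>

lemma rank_one_pinning:
  assumes "finite V" "k \<in> V" and R: "R = (\<Sum>l\<in>V. \<eta> l * exp (u l))"
  shows "M_mat V W h u k l + (\<eta> k * exp (u k)) * (\<eta> l * exp (u l)) =
    M_mat V (\<lambda>k l. W k l - \<eta> k * \<eta> l / 2) (\<lambda>k. h k + \<eta> k * R) u k l"
proof (cases "k = l")
  case True
  have "R = \<eta> k * exp (u k) + (\<Sum>l\<in>V - {k}. \<eta> l * exp (u l))"
    unfolding R using assms(1,2) by (simp add: sum.remove)
  then have "\<eta> k * exp (u k) * R = (\<eta> k * exp (u k))\<^sup>2 + (\<Sum>l\<in>V - {k}. \<eta> k * \<eta> l * exp (u k + u l))"
    by (simp add: power2_eq_square distrib_left sum_distrib_left exp_add mult_ac)
  moreover have "2 * (\<Sum>l\<in>V - {k}. (W k l - \<eta> k * \<eta> l / 2) * exp (u k + u l)) =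
     2 * (\<Sum>l\<in>V - {k}. W k l * exp (u k + u l)) - (\<Sum>l\<in>V - {k}. \<eta> k * \<eta> l * exp (u k + u l))"
    by (simp add: left_diff_distrib sum_subtractf right_diff_distrib sum_divide_distrib[symmetric])
  ultimately show ?thesis
    using True by (simp add: M_mat_def power2_eq_square algebra_simps)
qed (simp add: M_mat_def exp_add algebra_simps)

lemma (in sibling_pair) det_on_merge:
  fixes u :: "'v \<Rightarrow> real"
  assumes avg: "exp (u i) + exp (u j) = 2 * exp (u a)"
  shows "det_on (insert i (insert j V))
      (\<lambda>k l. M_mat (insert i (insert j V)) W h u k l + (\<eta> k * exp (u k)) * (\<eta> l * exp (u l))) =
    exp (u i) * exp (u j) / 2 * split_precision V W h u a i j *
      det_on (insert a V) (\<lambda>k l. M_mat (insert a V) W h u k l + (\<eta> k * exp (u k)) * (\<eta> l * exp (u l)))"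
proof -
  define R where "R = (\<Sum>l\<in>insert a V. \<eta> l * exp (u l))"
  let ?W = "\<lambda>k l. W k l - \<eta> k * \<eta> l / 2" and ?h = "\<lambda>k. h k + \<eta> k * R"
  interpret rk: sibling_pair V ?W ?h \<eta> a i j
    using fin new W_sym W_half h_half \<eta>_half
    by unfold_locales (auto simp: field_simps)
  have R': "R = (\<Sum>l\<in>insert i (insert j V). \<eta> l * exp (u l))"
  proof -
    have "\<eta> i * exp (u i) + \<eta> j * exp (u j) = \<eta> a / 2 * (exp (u i) + exp (u j))"
      by (simp add: \<eta>_half algebra_simps)
    then show ?thesis
      unfolding avg R_def using fin new by simp
  qed
  have q: "split_precision V ?W ?h u a i j = split_precision V W h u a i j"
  proof -
    have "R = \<eta> a * exp (u a) + (\<Sum>k\<in>V. \<eta> k * exp (u k))"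
      unfolding R_def using fin new by simp
    then have "?h a + 2 * (\<Sum>k\<in>V. ?W a k * exp (u k)) = h a + 2 * (\<Sum>k\<in>V. W a k * exp (u k)) + (\<eta> a)\<^sup>2 * exp (u a)"
      by (simp add: left_diff_distrib sum_subtractf sum_distrib_left sum_divide_distrib[symmetric] power2_eq_square
        distrib_left right_diff_distrib mult_ac)
    then have "(?h a + 2 * (\<Sum>k\<in>V. ?W a k * exp (u k))) / (2 * exp (u a)) =
        (h a + 2 * (\<Sum>k\<in>V. W a k * exp (u k))) / (2 * exp (u a)) + (\<eta> a)\<^sup>2 / 2"
      by (simp only: add_divide_distrib) simp
    then show ?thesis
      by (simp add: split_precision_def \<eta>_half power2_eq_square)
  qed
  have fold: "det_on U (\<lambda>k l. M_mat U W h u k l + (\<eta> k * exp (u k)) * (\<eta> l * exp (u l))) = det_on U (M_mat U ?W ?h u)"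
    if "finite U" "R = (\<Sum>l\<in>U. \<eta> l * exp (u l))" for U
    by (rule det_on_cong) (rule rank_one_pinning[OF that(1) _ that(2)])
  show ?thesis
    using rk.det_on_merge_laplacian[OF avg, unfolded q] fin
    by (simp only: fold[OF _ R'] fold[OF _ R_def] finite_insert)
qed

text \<open>
  The exact factorisation.  Replacing \<open>exp (u i)\<close> and \<open>exp (u j)\<close> by their average does not change the part
  of the energy that involves \<open>exp (u i) + exp (u j)\<close>, whereas \<open>exp (- u i) + exp (- u j)\<close> equals
  \<open>2 * (cosh x)\<^sup>2 * exp (- u a)\<close>.  Because \<open>(cosh x)\<^sup>2 = 1 + (sinh x)\<^sup>2\<close>, the excess energy is a multiple of
  \<open>(sinh x)\<^sup>2\<close>.  The factor that the determinant contributes is the one that normalises the resulting Gaussian density.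
  The right-hand side has the factor one half because of the Jacobian in \<open>nn_integral_split_coordinates\<close>.
\<close>

lemma (in sibling_pair) u_density_split:
  fixes u :: "'v \<Rightarrow> real"
  assumes u: "u i = u a + x - ln (cosh x)" "u j = u a - x - ln (cosh x)"
  shows "u_density (insert i (insert j V)) W h \<eta> u =
    u_density (insert a V) W h \<eta> u * (split_kernel (split_precision V W h u a i j) x / 2)"
proof -
  let ?U = "insert i (insert j V)" and ?x = "\<lambda>k. exp (u k)" and ?C = "cosh x" and ?S = "(sinh x)\<^sup>2"
  define q where "q = split_precision V W h u a i j"
  define s where "s = (\<Sum>k\<in>V. W a k * ?x k)"
  have C: "?C > 0" by (rule cosh_real_pos)
  have xi: "?x i = ?x a * exp x / ?C" and xj: "?x j = ?x a * exp (- x) / ?C"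
    using C by (simp_all add: u exp_add exp_diff exp_minus divide_inverse)
  have xi': "exp (- u i) = ?C * exp (- x) / ?x a" and xj': "exp (- u j) = ?C * exp x / ?x a"
    using C by (simp_all add: u exp_add exp_diff exp_minus field_simps)
  have avg: "?x i + ?x j = 2 * ?x a"
  proof -
    have "?x i + ?x j = ?x a * (2 * ?C) / ?C"
      unfolding xi xj by (simp add: cosh_def distrib_left add_divide_distrib)
    then show ?thesis using C by simp
  qed
  have prod: "?x i * ?x j = (?x a / ?C)\<^sup>2"
    unfolding xi xj by (simp add: power2_eq_square exp_minus field_simps)
  have inv: "exp (- u i) + exp (- u j) = 2 * (1 + ?S) / ?x a"
  proof -
    have "exp (- u i) + exp (- u j) = ?C * (2 * ?C) / ?x a"
      unfolding xi' xj' by (simp add: cosh_def field_simps)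
    then show ?thesis
      using cosh_square_eq[of x] by (simp add: power2_eq_square)
  qed
  have pair: "cosh (u i - c) + cosh (u j - c) - 2 = 2 * (cosh (u a - c) - 1) + ?S * exp c / ?x a" for c
  proof -
    have "cosh (u i - c) + cosh (u j - c) =
      ((?x i + ?x j) * exp (- c) + (exp (- u i) + exp (- u j)) * exp c) / 2"
      by (simp add: cosh_def exp_diff exp_minus field_simps)
    also have "\<dots> = (2 * ?x a * exp (- c) + 2 * (1 + ?S) / ?x a * exp c) / 2"
      unfolding avg inv ..
    also have "\<dots> = 2 * cosh (u a - c) + ?S * exp c / ?x a"
      by (simp add: cosh_def exp_diff exp_minus field_simps)
    finally show ?thesis by simp
  qed
  have self: "cosh (u i - u j) - 1 = 2 * ?S"
  proof -
    have "u i - u j = 2 * x" by (simp add: u)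
    then show ?thesis
      using cosh_double_cosh[of x] cosh_square_eq[of x] by simp
  qed
  have edges: "(\<Sum>k\<in>?U. \<Sum>l\<in>?U. W k l * (cosh (u k - u l) - 1)) =
    (\<Sum>k\<in>insert a V. \<Sum>l\<in>insert a V. W k l * (cosh (u k - u l) - 1)) + ?S * (s / ?x a + 4 * W i j)"
  proof -
    let ?e = "\<lambda>k l. W k l * (cosh (u k - u l) - 1)"
    have e_sym: "?e k l = ?e l k" for k l
      using W_sym[of k l] cosh_minus[of "u k - u l"] by simp
    have "(\<Sum>l\<in>V. ?e i l) + (\<Sum>l\<in>V. ?e j l) = (\<Sum>l\<in>V. ?e a l + W a l * ?x l * (?S / (2 * ?x a)))"
      unfolding sum.distrib[symmetric]
    proof (rule sum.cong[OF refl])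
      fix l assume l: "l \<in> V"
      have "?e i l + ?e j l = W a l / 2 * (cosh (u i - u l) + cosh (u j - u l) - 2)"
        unfolding W_half[OF l] by (simp add: algebra_simps)
      also have "\<dots> = W a l / 2 * (2 * (cosh (u a - u l) - 1) + ?S * ?x l / ?x a)"
        unfolding pair ..
      finally show "?e i l + ?e j l = ?e a l + W a l * ?x l * (?S / (2 * ?x a))"
        by (simp add: field_simps)
    qed
    also have "\<dots> = (\<Sum>l\<in>V. ?e a l) + s * (?S / (2 * ?x a))"
      unfolding s_def sum_distrib_right sum.distrib ..
    finally have 1: "(\<Sum>l\<in>V. ?e i l) + (\<Sum>l\<in>V. ?e j l) = (\<Sum>l\<in>V. ?e a l) + s * (?S / (2 * ?x a))" .
    have star: "(\<Sum>k\<in>insert c Y. \<Sum>l\<in>insert c Y. ?e k l) = 2 * (\<Sum>l\<in>Y. ?e c l) + (\<Sum>k\<in>Y. \<Sum>l\<in>Y. ?e k l)"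
      if "finite Y" "c \<notin> Y" for c Y
    proof -
      have "(\<Sum>k\<in>Y. ?e k c) = (\<Sum>k\<in>Y. ?e c k)"
        by (rule sum.cong[OF refl]) (rule e_sym)
      then show ?thesis
        using that by (simp add: sum.distrib)
    qed
    have "(\<Sum>k\<in>?U. \<Sum>l\<in>?U. ?e k l) =
      2 * (\<Sum>l\<in>insert j V. ?e i l) + (2 * (\<Sum>l\<in>V. ?e j l) + (\<Sum>k\<in>V. \<Sum>l\<in>V. ?e k l))"
      using fin new by (subst star, simp, simp, subst star) auto
    also have "(\<Sum>l\<in>insert j V. ?e i l) = W i j * (2 * ?S) + (\<Sum>l\<in>V. ?e i l)"
      using fin new self by simp
    also have "2 * (W i j * (2 * ?S) + (\<Sum>l\<in>V. ?e i l)) + (2 * (\<Sum>l\<in>V. ?e j l) + (\<Sum>k\<in>V. \<Sum>l\<in>V. ?e k l)) =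
      4 * W i j * ?S + 2 * ((\<Sum>l\<in>V. ?e i l) + (\<Sum>l\<in>V. ?e j l)) + (\<Sum>k\<in>V. \<Sum>l\<in>V. ?e k l)"
      by simp
    also have "\<dots> = 4 * W i j * ?S + s * ?S / ?x a + (2 * (\<Sum>l\<in>V. ?e a l) + (\<Sum>k\<in>V. \<Sum>l\<in>V. ?e k l))"
      unfolding 1 by (simp add: field_simps)
    also have "2 * (\<Sum>l\<in>V. ?e a l) + (\<Sum>k\<in>V. \<Sum>l\<in>V. ?e k l) = (\<Sum>k\<in>insert a V. \<Sum>l\<in>insert a V. ?e k l)"
      using fin new by (subst star) auto
    finally show ?thesis
      by (simp add: algebra_simps)
  qed
  have pins: "(\<Sum>k\<in>?U. h k * (cosh (u k) - 1)) = (\<Sum>k\<in>insert a V. h k * (cosh (u k) - 1)) + ?S * (h a / (2 * ?x a))"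
  proof -
    have "h i * (cosh (u i) - 1) + h j * (cosh (u j) - 1) = h a / 2 * (cosh (u i - 0) + cosh (u j - 0) - 2)"
      by (simp add: h_half field_simps)
    also have "\<dots> = h a / 2 * (2 * (cosh (u a - 0) - 1) + ?S * exp 0 / ?x a)"
      unfolding pair ..
    also have "\<dots> = h a * (cosh (u a) - 1) + ?S * (h a / (2 * ?x a))"
      by (simp add: field_simps)
    finally show ?thesis
      using fin new by simp
  qed
  have prods: "(\<Prod>k\<in>?U. exp (- u k) / sqrt (2 * pi)) =
    (\<Prod>k\<in>insert a V. exp (- u k) / sqrt (2 * pi)) * (?C\<^sup>2 / (?x a * sqrt (2 * pi)))"
  proof -
    define f where "f = (\<lambda>k. exp (- u k) / sqrt (2 * pi))"
    have "exp (- u i) * exp (- u j) = exp (- u a) * (?C\<^sup>2 / ?x a)"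
      unfolding xi' xj' by (simp add: exp_minus power2_eq_square field_simps)
    then have "f i * f j = f a * (?C\<^sup>2 / (?x a * sqrt (2 * pi)))"
      by (simp add: f_def times_divide_times_eq)
    moreover have "prod f ?U = f i * f j * prod f V" "prod f (insert a V) = f a * prod f V"
      using fin new by simp_all
    ultimately show ?thesis
      unfolding f_def[symmetric] by simp
  qed
  have sq: "sqrt (?x i * ?x j / 2 * q * d) = ?x a / ?C * sqrt (q / 2) * sqrt d" for d
  proof -
    have "?x i * ?x j / 2 * q * d = (?x a / ?C)\<^sup>2 * (q / 2) * d"
      unfolding prod by simp
    then have "sqrt (?x i * ?x j / 2 * q * d) = sqrt ((?x a / ?C)\<^sup>2) * sqrt (q / 2) * sqrt d"
      by (simp only: real_sqrt_mult)
    then show ?thesis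
      using C by simp
  qed
  have qS: "?S * (s / ?x a + 4 * W i j) + ?S * (h a / (2 * ?x a)) = q * ?S"
  proof -
    have "S * (s / e + 4 * W i j) + S * (h a / (2 * e)) = ((h a + 2 * s) / (2 * e) + 4 * W i j) * S" for S e :: real
      by (simp add: add_divide_distrib algebra_simps)
    then show ?thesis
      unfolding q_def split_precision_def s_def by this
  qed
  have const: "?C\<^sup>2 / (?x a * sqrt (2 * pi)) * (?x a / ?C * sqrt (q / 2)) = ?C * sqrt (q / pi) / 2"
  proof -
    have "sqrt (q / 2) = sqrt ((2 * pi) * ((q / pi) / 2\<^sup>2))"
      by simp
    also have "\<dots> = sqrt (2 * pi) * (sqrt (q / pi) / 2)"
      unfolding real_sqrt_mult[of "2 * pi"] real_sqrt_divide[of "q / pi"] real_sqrt_abs by simp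
    finally have sqrt_q: "sqrt (q / 2) = sqrt (2 * pi) * (sqrt (q / pi) / 2)" .
    have "c\<^sup>2 / (e * p) * (e / c * (p * (r / 2))) = c * r / 2" if "c \<noteq> 0" "e \<noteq> 0" "p \<noteq> 0" for c e p r :: real
      using that by (simp add: power2_eq_square)
    from this[of ?C "?x a" "sqrt (2 * pi)"] show ?thesis
      unfolding sqrt_q using C by simp
  qed
  let ?E = "\<lambda>U. exp (- (\<Sum>k\<in>U. \<Sum>l\<in>U. W k l * (cosh (u k - u l) - 1))) * exp (- (\<Sum>k\<in>U. h k * (cosh (u k) - 1)))"
  have E: "?E ?U = ?E (insert a V) * exp (- q * ?S)"
    unfolding edges pins exp_add[symmetric] by (rule arg_cong[where f=exp]) (use qS in simp)
  \<comment> \<open>The three new factors are collected, with the constants in front of the Gaussian kernel.\<close>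
  have arrange: "E * e * (y * D) * (P * c) = E * D * P * (c * y * e)" for E e y D P c :: real
    by simp
  show ?thesis
    unfolding u_density_def det_on_merge[OF avg] prods E q_def[symmetric] sq
    unfolding arrange[of "?E (insert a V)"] const by (simp add: split_kernel_def)
qed

lemma abs_le_abs_sinh: "\<bar>x\<bar> \<le> \<bar>sinh x\<bar>" for x :: real
  using real_le_abs_sinh[of x] by (simp add: sinh_field_def exp_minus)

lemma split_displacement_le: "\<bar>x - ln (cosh x)\<bar> \<le> 2 * \<bar>sinh x\<bar>" for x :: real
proof -
  have "cosh x \<le> exp \<bar>x\<bar>"
    by (cases "x \<ge> 0") (auto simp: cosh_def)
  then have "ln (cosh x) \<le> \<bar>x\<bar>"
    by (metis cosh_real_pos ln_exp ln_le_cancel_iff exp_gt_zero)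
  moreover have "0 \<le> ln (cosh x)"
    using cosh_real_ge_1[of x] by simp
  ultimately show ?thesis
    using abs_le_abs_sinh[of x] by linarith
qed

text \<open>
  By \<open>2 * \<bar>y\<bar> \<le> c * y\<^sup>2 + 1 / c\<close> with \<open>c = sqrt q0\<close> the mean is controlled by the variance of \<open>sinh x\<close>.
\<close>

lemma split_kernel_displacement:
  assumes q0: "q0 > 0" "q0 \<le> q"
  shows "(\<integral>\<^sup>+ x. ennreal (split_kernel q x) * ennreal \<bar>x - ln (cosh x)\<bar> \<partial>lborel) \<le> ennreal (2 / sqrt q0)"
proof -
  have q: "q > 0" using q0 by simp
  let ?c = "sqrt q0"
  have c: "?c > 0" using q0 by simp
  have pt: "split_kernel q x * \<bar>x - ln (cosh x)\<bar> \<le> ?c * (split_kernel q x * (sinh x)\<^sup>2) + 1 / ?c * split_kernel q x" for x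
  proof -
    have "0 \<le> (?c * \<bar>sinh x\<bar> - 1)\<^sup>2" by simp
    also have "\<dots> = ?c * (?c * (sinh x)\<^sup>2 + 1 / ?c - 2 * \<bar>sinh x\<bar>)"
      using c by (simp add: power2_eq_square algebra_simps)
    finally have "2 * \<bar>sinh x\<bar> \<le> ?c * (sinh x)\<^sup>2 + 1 / ?c"
      using c by (simp add: zero_le_mult_iff)
    then have "\<bar>x - ln (cosh x)\<bar> \<le> ?c * (sinh x)\<^sup>2 + 1 / ?c"
      using split_displacement_le[of x] by linarith
    from mult_left_mono[OF this split_kernel_nonneg[of q x]] q show ?thesis
      by (simp add: algebra_simps)
  qed
  have "(\<integral>\<^sup>+ x. ennreal (split_kernel q x) * ennreal \<bar>x - ln (cosh x)\<bar> \<partial>lborel) \<le>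
    (\<integral>\<^sup>+ x. ennreal ?c * ennreal (split_kernel q x * (sinh x)\<^sup>2) + ennreal (1 / ?c) * ennreal (split_kernel q x) \<partial>lborel)"
    using pt c q split_kernel_nonneg[of q]
    by (intro nn_integral_mono) (simp add: ennreal_mult[symmetric] ennreal_plus[symmetric] ennreal_leI del: ennreal_plus)
  also have "\<dots> = ennreal ?c * ennreal (1 / (2 * q)) + ennreal (1 / ?c)"
    using split_kernel_variance[OF q] split_kernel_total[OF q]
    by (simp add: nn_integral_add nn_integral_cmult)
  also have "\<dots> = ennreal (?c / (2 * q) + 1 / ?c)"
    using c q by (simp add: ennreal_mult[symmetric] ennreal_plus[symmetric] del: ennreal_plus)
  also have "\<dots> \<le> ennreal (2 / ?c)"
  proof (rule ennreal_leI)
    have "?c * ?c \<le> q" using q0 by simp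
    then have "?c / (2 * q) \<le> 1 / ?c"
      using c q by (simp add: field_simps)
    then show "?c / (2 * q) + 1 / ?c \<le> 2 / ?c" by simp
  qed
  finally show ?thesis .
qed

text \<open>
  Here \<open>exp (x - ln (cosh x)) = 1 + tanh x\<close>.  Averaging over the reflection \<open>x \<mapsto> - x\<close> removes the linear
  term in \<open>tanh x\<close>, so that the second moment exceeds 1 only by the mean of \<open>(tanh x)\<^sup>2\<close>.
\<close>

lemma split_kernel_ratio:
  assumes q0: "q0 > 0" "q0 \<le> q"
  shows "(\<integral>\<^sup>+ x. ennreal (split_kernel q x) * ennreal ((exp (x - ln (cosh x)))\<^sup>2) \<partial>lborel) \<le> ennreal (1 + 1 / (2 * q0))"
proof -
  have q: "q > 0" using q0 by simp
  let ?f = "\<lambda>x. ennreal (split_kernel q x) * ennreal ((exp (x - ln (cosh x)))\<^sup>2)"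
  let ?I = "\<integral>\<^sup>+ x. ?f x \<partial>lborel"
  have pt: "split_kernel q x * (exp (x - ln (cosh x)))\<^sup>2 + split_kernel q x * (exp (- x - ln (cosh x)))\<^sup>2 \<le>
      2 * split_kernel q x + 2 * (split_kernel q x * (sinh x)\<^sup>2)" for x
  proof -
    have C: "cosh x \<ge> 1" by (rule cosh_real_ge_1)
    then have e: "exp (x - ln (cosh x)) = 1 + tanh x" "exp (- x - ln (cosh x)) = 1 - tanh x"
      using sinh_plus_cosh[of x] cosh_minus_sinh[of x]
      by (simp_all add: exp_diff tanh_def field_simps)
    have "(tanh x)\<^sup>2 \<le> (sinh x)\<^sup>2"
      using C by (simp add: tanh_def power_divide divide_le_eq mult_le_cancel_left1)
    then have "(exp (x - ln (cosh x)))\<^sup>2 + (exp (- x - ln (cosh x)))\<^sup>2 \<le> 2 + 2 * (sinh x)\<^sup>2"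
      unfolding e by (simp add: power2_eq_square algebra_simps)
    from mult_left_mono[OF this split_kernel_nonneg[of q x]] q show ?thesis
      by (simp add: algebra_simps)
  qed
  have "2 * ?I = ?I + (\<integral>\<^sup>+ x. ?f (- x) \<partial>lborel)"
    unfolding nn_integral_reflect[of ?f, simplified] by (subst nn_integral_reflect) (auto simp: mult_2)
  also have "\<dots> = (\<integral>\<^sup>+ x. ?f x + ?f (- x) \<partial>lborel)"
    by (rule nn_integral_add[symmetric]) measurable
  also have "\<dots> \<le> (\<integral>\<^sup>+ x. 2 * ennreal (split_kernel q x) + 2 * ennreal (split_kernel q x * (sinh x)\<^sup>2) \<partial>lborel)"
  proof (rule nn_integral_mono)
    fix x
    have nn: "split_kernel q x \<ge> 0" using q by (simp add: split_kernel_nonneg)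
    have "?f x + ?f (- x) = ennreal (split_kernel q x * (exp (x - ln (cosh x)))\<^sup>2 + split_kernel q x * (exp (- x - ln (cosh x)))\<^sup>2)"
      using nn by (simp add: ennreal_mult[symmetric] ennreal_plus[symmetric] del: ennreal_plus)
    also have "\<dots> \<le> ennreal (2 * split_kernel q x + 2 * (split_kernel q x * (sinh x)\<^sup>2))"
      by (rule ennreal_leI[OF pt])
    also have "\<dots> = 2 * ennreal (split_kernel q x) + 2 * ennreal (split_kernel q x * (sinh x)\<^sup>2)"
      using nn by (simp add: ennreal_mult)
    finally show "?f x + ?f (- x) \<le> 2 * ennreal (split_kernel q x) + 2 * ennreal (split_kernel q x * (sinh x)\<^sup>2)" .
  qed
  also have "\<dots> = 2 * ennreal (1 + 1 / (2 * q))"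
    using split_kernel_variance[OF q] split_kernel_total[OF q] q
    by (simp add: nn_integral_add nn_integral_cmult distrib_left)
  finally have "?I \<le> ennreal (1 + 1 / (2 * q))"
    by (simp add: ennreal_mult_le_mult_iff)
  also have "\<dots> \<le> ennreal (1 + 1 / (2 * q0))"
    using q0 by (intro ennreal_leI) (simp add: frac_le)
  finally show ?thesis .
qed

lemma u_density_cong:
  assumes "\<And>k. k \<in> V \<Longrightarrow> u k = v k"
  shows "u_density V W h \<eta> u = u_density V W h \<eta> v"
proof -
  have "M_mat V W h u k l + (\<eta> k * exp (u k)) * (\<eta> l * exp (u l)) =
      M_mat V W h v k l + (\<eta> k * exp (v k)) * (\<eta> l * exp (v l))" if "k \<in> V" "l \<in> V" for k l
    using that assms by (auto simp: M_mat_def)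
  then have "det_on V (\<lambda>k l. M_mat V W h u k l + (\<eta> k * exp (u k)) * (\<eta> l * exp (u l))) =
      det_on V (\<lambda>k l. M_mat V W h v k l + (\<eta> k * exp (v k)) * (\<eta> l * exp (v l)))"
    by (rule det_on_cong)
  then show ?thesis
    unfolding u_density_def using assms by (simp cong: sum.cong prod.cong)
qed

lemma borel_measurable_M_mat:
  assumes "i \<in> V" "j \<in> V"
  shows "(\<lambda>u. M_mat V W h u i j) \<in> borel_measurable (\<Pi>\<^sub>M i\<in>V. lborel)"
proof -
  have [measurable]: "(\<lambda>u. u k) \<in> borel_measurable (\<Pi>\<^sub>M i\<in>V. lborel)" if "k \<in> V" for k
    using measurable_component_singleton[OF that, of "\<lambda>_. lborel"] by simp
  note [measurable] = assms
  have "(\<lambda>u. \<Sum>k\<in>V - {i}. W i k * exp (u i + u k)) \<in> borel_measurable (\<Pi>\<^sub>M i\<in>V. lborel)"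
    by (rule borel_measurable_sum) measurable
  then show ?thesis
    unfolding M_mat_def by (cases "i = j") simp_all
qed

lemma borel_measurable_u_density:
  "u_density V W h \<eta> \<in> borel_measurable (\<Pi>\<^sub>M i\<in>V. lborel)"
proof -
  have [measurable]: "(\<lambda>u. u k) \<in> borel_measurable (\<Pi>\<^sub>M i\<in>V. lborel)" if "k \<in> V" for k
    using measurable_component_singleton[OF that, of "\<lambda>_. lborel"] by simp
  have [measurable]: "(\<lambda>u. det_on V (\<lambda>i j. M_mat V W h u i j + (\<eta> i * exp (u i)) * (\<eta> j * exp (u j))))
      \<in> borel_measurable (\<Pi>\<^sub>M i\<in>V. lborel)"
    by (intro borel_measurable_det_on borel_measurable_add borel_measurable_M_mat) measurable
  have "(\<lambda>u. \<Sum>i\<in>V. \<Sum>j\<in>V. W i j * (cosh (u i - u j) - 1)) \<in> borel_measurable (\<Pi>\<^sub>M i\<in>V. lborel)"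
    "(\<lambda>u. \<Sum>i\<in>V. h i * (cosh (u i) - 1)) \<in> borel_measurable (\<Pi>\<^sub>M i\<in>V. lborel)"
    "(\<lambda>u. \<Prod>i\<in>V. exp (- u i) / sqrt (2 * pi)) \<in> borel_measurable (\<Pi>\<^sub>M i\<in>V. lborel)"
    by (intro borel_measurable_sum borel_measurable_prod; measurable)+
  then show ?thesis
    unfolding u_density_def[abs_def] by measurable
qed

text \<open>
  The inverse of merging: the heights on the larger graph, given those on the merged graph and the half-difference \<open>x\<close>.
\<close>

definition split_pair :: "'v set \<Rightarrow> 'v \<Rightarrow> 'v \<Rightarrow> 'v \<Rightarrow> ('v \<Rightarrow> real) \<Rightarrow> real \<Rightarrow> 'v \<Rightarrow> real" where
  "split_pair V a i j u x = (\<lambda>k\<in>insert i (insert j V).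
     if k = i then u a + x - ln (cosh x) else if k = j then u a - x - ln (cosh x) else u k)"

lemma (in sibling_pair) split_pair_simps:
  "split_pair V a i j u x i = u a + x - ln (cosh x)"
  "split_pair V a i j u x j = u a - x - ln (cosh x)"
  "k \<in> V \<Longrightarrow> split_pair V a i j u x k = u k"
  using new by (auto simp: split_pair_def)

text \<open>
  Nonnegative weights guarantee a lower bound on the precision that depends on \<open>W i j\<close> only.
\<close>

locale ferromagnetic_pair = sibling_pair +
  assumes nonneg: "\<And>k l. 0 \<le> W k l" "\<And>k. 0 \<le> h k"
begin

lemma split_precision_ge: "4 * W i j \<le> split_precision V W h u a i j"
  unfolding split_precision_def
  by (simp add: nonneg sum_nonneg)

text \<open>
  Integrated form of \<open>u_density_split\<close>: to integrate over the larger graph, draw the heights of the merged graph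
  first and then split \<open>a\<close> by one step of the Gaussian kernel, whose precision depends on these heights.
\<close>

lemma nn_integral_u_density_merge:
  assumes F: "F \<in> borel_measurable (\<Pi>\<^sub>M k\<in>insert i (insert j V). lborel)"
  shows "(\<integral>\<^sup>+ u. ennreal (u_density (insert i (insert j V)) W h \<eta> u) * F u \<partial>(\<Pi>\<^sub>M k\<in>insert i (insert j V). lborel)) =
    (\<integral>\<^sup>+ u. ennreal (u_density (insert a V) W h \<eta> u) *
       (\<integral>\<^sup>+ x. ennreal (split_kernel (split_precision V W h u a i j) x) * F (split_pair V a i j u x) \<partial>lborel)
       \<partial>(\<Pi>\<^sub>M k\<in>insert a V. lborel))"
proof -
  interpret product_sigma_finite "\<lambda>_::'v. lborel :: real measure"
    by standard
  let ?U = "insert i (insert j V)"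
  let ?g = "\<lambda>u. ennreal (u_density ?U W h \<eta> u) * F u"
  let ?q = "\<lambda>u. split_precision V W h u a i j"
  let ?K = "\<lambda>u x. ennreal (split_kernel (?q u) x) * F (split_pair V a i j u x)"
  let ?G = "\<lambda>u. ennreal (u_density (insert a V) W h \<eta> u) * (\<integral>\<^sup>+ x. ?K u x \<partial>lborel)"
  let ?L = "\<lambda>x::real. ln (cosh x)"
  note [measurable] = F borel_measurable_u_density
  have g [measurable]: "?g \<in> borel_measurable (\<Pi>\<^sub>M k\<in>?U. lborel)"
    by measurable
  have comp [measurable]: "(\<lambda>u. u k) \<in> borel_measurable (\<Pi>\<^sub>M i\<in>insert a V. lborel)" if "k \<in> insert a V" for k
    using measurable_component_singleton[OF that, of "\<lambda>_. lborel"] by simp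
  have "(\<lambda>u. \<Sum>k\<in>V. W a k * exp (u k)) \<in> borel_measurable (\<Pi>\<^sub>M i\<in>insert a V. lborel)"
    by (rule borel_measurable_sum) measurable
  then have q [measurable]: "?q \<in> borel_measurable (\<Pi>\<^sub>M i\<in>insert a V. lborel)"
    unfolding split_precision_def by measurable
  have fst_k: "(\<lambda>y. fst y k) \<in> borel_measurable ((\<Pi>\<^sub>M i\<in>insert a V. lborel :: real measure) \<Otimes>\<^sub>M (lborel :: real measure))" if "k \<in> insert a V" for k
    by (rule measurable_compose[OF measurable_fst comp[OF that]])
  have snd_x: "(\<lambda>y. snd y) \<in> borel_measurable ((\<Pi>\<^sub>M i\<in>insert a V. lborel :: real measure) \<Otimes>\<^sub>M (lborel :: real measure))"
    and lncosh: "(\<lambda>y. ln (cosh (snd y :: real))) \<in> borel_measurable ((\<Pi>\<^sub>M i\<in>insert a V. lborel :: real measure) \<Otimes>\<^sub>M (lborel :: real measure))"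
    by measurable
  have split [measurable]: "(\<lambda>(u, x). split_pair V a i j u x) \<in> (\<Pi>\<^sub>M i\<in>insert a V. lborel) \<Otimes>\<^sub>M lborel \<rightarrow>\<^sub>M (\<Pi>\<^sub>M k\<in>?U. lborel)"
    unfolding split_pair_def case_prod_unfold
  proof (rule measurable_restrict)
    fix k assume "k \<in> ?U"
    then consider "k = i" | "k = j" "k \<noteq> i" | "k \<in> V" "k \<noteq> i" "k \<noteq> j"
      by blast
    then show "(\<lambda>y. if k = i then fst y a + snd y - ln (cosh (snd y))
        else if k = j then fst y a - snd y - ln (cosh (snd y)) else fst y k)
        \<in> (\<Pi>\<^sub>M i\<in>insert a V. lborel :: real measure) \<Otimes>\<^sub>M (lborel :: real measure) \<rightarrow>\<^sub>M lborel"
    proof cases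
      case 1
      have "(\<lambda>y. fst y a + snd y - ln (cosh (snd y))) \<in> borel_measurable ((\<Pi>\<^sub>M i\<in>insert a V. lborel :: real measure) \<Otimes>\<^sub>M (lborel :: real measure))"
        by (rule borel_measurable_diff[OF borel_measurable_add[OF fst_k snd_x] lncosh]) simp
      then show ?thesis using 1 by (simp only: simp_thms if_True if_False measurable_lborel1)
    next
      case 2
      have "(\<lambda>y. fst y a - snd y - ln (cosh (snd y))) \<in> borel_measurable ((\<Pi>\<^sub>M i\<in>insert a V. lborel :: real measure) \<Otimes>\<^sub>M (lborel :: real measure))"
        by (rule borel_measurable_diff[OF borel_measurable_diff[OF fst_k snd_x] lncosh]) simp
      then show ?thesis using 2 by (simp only: simp_thms if_True if_False measurable_lborel1)
    next
      case 3
      have "(\<lambda>y. fst y k) \<in> borel_measurable ((\<Pi>\<^sub>M i\<in>insert a V. lborel :: real measure) \<Otimes>\<^sub>M (lborel :: real measure))"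
        by (rule fst_k) (use 3 in simp)
      then show ?thesis using 3 by (simp only: simp_thms if_True if_False measurable_lborel1)
    qed
  qed
  have K [measurable]: "case_prod ?K \<in> borel_measurable ((\<Pi>\<^sub>M i\<in>insert a V. lborel) \<Otimes>\<^sub>M lborel)"
    unfolding split_kernel_def by measurable
  have G: "?G \<in> borel_measurable (\<Pi>\<^sub>M k\<in>insert a V. lborel)"
    by measurable
  have pt: "2 * ?g (w(j := t - x - ?L x, i := t + x - ?L x)) =
      ennreal (u_density (insert a V) W h \<eta> (w(a := t))) * ?K (w(a := t)) x"
    if w: "w \<in> space (\<Pi>\<^sub>M k\<in>V. lborel)" for w t x
  proof -
    \<comment> \<open>A single function that carries the heights of both graphs.\<close>
    let ?m = "w(a := t, j := t - x - ?L x, i := t + x - ?L x)"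
    have off: "k \<noteq> a" "k \<noteq> i" "k \<noteq> j" if "k \<in> V" for k
      using that new by auto
    have sp: "split_pair V a i j (w(a := t)) x = w(j := t - x - ?L x, i := t + x - ?L x)"
    proof
      fix k
      show "split_pair V a i j (w(a := t)) x k = (w(j := t - x - ?L x, i := t + x - ?L x)) k"
        using w new off[of k] by (auto simp: split_pair_def space_PiM PiE_def extensional_def)
    qed
    have "u_density ?U W h \<eta> (w(j := t - x - ?L x, i := t + x - ?L x)) = u_density ?U W h \<eta> ?m"
      using new off by (intro u_density_cong) auto
    also have "\<dots> = u_density (insert a V) W h \<eta> ?m * (split_kernel (?q ?m) x / 2)"
      using new by (intro u_density_split) auto
    also have "u_density (insert a V) W h \<eta> ?m = u_density (insert a V) W h \<eta> (w(a := t))"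
      using new off by (intro u_density_cong) auto
    also have "?q ?m = ?q (w(a := t))"
      using new off by (simp add: split_precision_def cong: sum.cong)
    finally have d: "2 * u_density ?U W h \<eta> (w(j := t - x - ?L x, i := t + x - ?L x)) =
        split_kernel (?q (w(a := t))) x * u_density (insert a V) W h \<eta> (w(a := t))"
      by (simp add: mult.commute del: fun_upd_apply)
    have "2 * ennreal (u_density ?U W h \<eta> (w(j := t - x - ?L x, i := t + x - ?L x))) =
      ennreal (u_density (insert a V) W h \<eta> (w(a := t))) * ennreal (split_kernel (?q (w(a := t))) x)"
    proof -
      have "2 * ennreal (u_density ?U W h \<eta> (w(j := t - x - ?L x, i := t + x - ?L x))) =
        ennreal (2 * u_density ?U W h \<eta> (w(j := t - x - ?L x, i := t + x - ?L x)))"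
        by (subst ennreal_mult') simp_all
      also have "\<dots> = ennreal (u_density (insert a V) W h \<eta> (w(a := t)) * split_kernel (?q (w(a := t))) x)"
        unfolding d by (simp only: mult.commute)
      also have "\<dots> = ennreal (u_density (insert a V) W h \<eta> (w(a := t))) * ennreal (split_kernel (?q (w(a := t))) x)"
        using split_precision_ge[of "w(a := t)"] nonneg(1)[of i j] by (intro ennreal_mult'' split_kernel_nonneg) linarith
      finally show ?thesis .
    qed
    then show ?thesis
      unfolding sp by (simp only: mult.assoc[symmetric])
  qed
  have inner: "(\<integral>\<^sup>+ z. \<integral>\<^sup>+ y. ?g (w(j := z, i := y)) \<partial>lborel \<partial>lborel) = (\<integral>\<^sup>+ t. ?G (w(a := t)) \<partial>lborel)"
    if w: "w \<in> space (\<Pi>\<^sub>M k\<in>V. lborel)" for w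
  proof -
    have m: "(\<lambda>(y, z). w(j := z, i := y)) \<in> lborel \<Otimes>\<^sub>M lborel \<rightarrow>\<^sub>M (\<Pi>\<^sub>M k\<in>?U. lborel)"
      unfolding case_prod_unfold
    proof (rule measurable_PiM_single')
      fix k assume "k \<in> ?U"
      show "(\<lambda>p. (w(j := snd p, i := fst p)) k) \<in> lborel \<Otimes>\<^sub>M lborel \<rightarrow>\<^sub>M lborel"
        by (cases "k = i"; cases "k = j") auto
    qed (use w in \<open>auto simp: space_PiM PiE_def extensional_def\<close>)
    have "(\<integral>\<^sup>+ z. \<integral>\<^sup>+ y. ?g (w(j := z, i := y)) \<partial>lborel \<partial>lborel) =
      (\<integral>\<^sup>+ t. \<integral>\<^sup>+ x. 2 * ?g (w(j := t - x - ?L x, i := t + x - ?L x)) \<partial>lborel \<partial>lborel)"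
      using nn_integral_split_coordinates[of "\<lambda>y z. ?g (w(j := z, i := y))"] measurable_compose[OF m g]
      by (simp add: case_prod_unfold)
    also have "\<dots> = (\<integral>\<^sup>+ t. ?G (w(a := t)) \<partial>lborel)"
    proof (rule nn_integral_cong)
      fix t :: real
      have "w(a := t) \<in> space (\<Pi>\<^sub>M k\<in>insert a V. lborel)"
        using w by (auto simp: space_PiM PiE_def extensional_def)
      then have "?K (w(a := t)) \<in> borel_measurable lborel"
        using measurable_Pair2[OF K] by simp
      then show "(\<integral>\<^sup>+ x. 2 * ?g (w(j := t - x - ?L x, i := t + x - ?L x)) \<partial>lborel) = ?G (w(a := t))"
        unfolding pt[OF w] by (rule nn_integral_cmult)
    qed
    finally show ?thesis .
  qed
  have "(\<integral>\<^sup>+ u. ?g u \<partial>(\<Pi>\<^sub>M k\<in>?U. lborel)) =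
    (\<integral>\<^sup>+ v. \<integral>\<^sup>+ y. ?g (v(i := y)) \<partial>lborel \<partial>(\<Pi>\<^sub>M k\<in>insert j V. lborel))"
    using fin new by (intro product_nn_integral_insert g) auto
  also have "\<dots> = (\<integral>\<^sup>+ w. \<integral>\<^sup>+ z. \<integral>\<^sup>+ y. ?g (w(j := z, i := y)) \<partial>lborel \<partial>lborel \<partial>(\<Pi>\<^sub>M k\<in>V. lborel))"
  proof (intro product_nn_integral_insert)
    have "(\<lambda>(v, y). ?g (v(i := y))) \<in> borel_measurable ((\<Pi>\<^sub>M k\<in>insert j V. lborel) \<Otimes>\<^sub>M lborel)"
      using measurable_compose[OF measurable_add_dim g] by (simp add: case_prod_unfold)
    then show "(\<lambda>v. \<integral>\<^sup>+ y. ?g (v(i := y)) \<partial>lborel) \<in> borel_measurable (\<Pi>\<^sub>M k\<in>insert j V. lborel)"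
      by (rule lborel.borel_measurable_nn_integral)
  qed (use fin new in auto)
  also have "\<dots> = (\<integral>\<^sup>+ w. \<integral>\<^sup>+ t. ?G (w(a := t)) \<partial>lborel \<partial>(\<Pi>\<^sub>M k\<in>V. lborel))"
    by (rule nn_integral_cong) (rule inner)
  also have "\<dots> = (\<integral>\<^sup>+ u. ?G u \<partial>(\<Pi>\<^sub>M k\<in>insert a V. lborel))"
    using fin new by (intro product_nn_integral_insert[symmetric] G) auto
  finally show ?thesis .
qed

end

text \<open>
  Integration against the density of the heights, an expectation whenever the total mass is 1.
\<close>

definition expect :: "'v set \<Rightarrow> ('v \<Rightarrow> 'v \<Rightarrow> real) \<Rightarrow> ('v \<Rightarrow> real) \<Rightarrow> ('v \<Rightarrow> real) \<Rightarrow> (('v \<Rightarrow> real) \<Rightarrow> ennreal) \<Rightarrow> ennreal" where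
  "expect V W h \<eta> F = (\<integral>\<^sup>+ u. ennreal (u_density V W h \<eta> u) * F u \<partial>(\<Pi>\<^sub>M k\<in>V. lborel))"

lemma expect_add:
  assumes "F \<in> borel_measurable (\<Pi>\<^sub>M k\<in>V. lborel)" "G \<in> borel_measurable (\<Pi>\<^sub>M k\<in>V. lborel)"
  shows "expect V W h \<eta> (\<lambda>u. F u + G u) = expect V W h \<eta> F + expect V W h \<eta> G"
  unfolding expect_def distrib_left using assms borel_measurable_u_density[of V W h \<eta>]
  by (intro nn_integral_add) auto

lemma expect_cmult:
  assumes "F \<in> borel_measurable (\<Pi>\<^sub>M k\<in>V. lborel)"
  shows "expect V W h \<eta> (\<lambda>u. c * F u) = c * expect V W h \<eta> F"
proof -
  have "(\<lambda>u. ennreal (u_density V W h \<eta> u) * F u) \<in> borel_measurable (\<Pi>\<^sub>M k\<in>V. lborel)"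
    using assms borel_measurable_u_density[of V W h \<eta>] by auto
  from nn_integral_cmult[OF this, of c] show ?thesis
    unfolding expect_def by (simp only: mult.left_commute)
qed

lemma expect_mono:
  assumes "\<And>u. F u \<le> G u"
  shows "expect V W h \<eta> F \<le> expect V W h \<eta> G"
  unfolding expect_def by (intro nn_integral_mono mult_left_mono assms) auto

context ferromagnetic_pair
begin

text \<open>
  Functions that only see the merged graph have the same integral over both graphs, because the Gaussian kernel has
  total mass 1.
\<close>

lemma expect_coarse:
  assumes pos: "W i j > 0" and F: "F \<in> borel_measurable (\<Pi>\<^sub>M k\<in>insert i (insert j V). lborel)"
    and FG: "\<And>u x. F (split_pair V a i j u x) = G u"
  shows "expect (insert i (insert j V)) W h \<eta> F = expect (insert a V) W h \<eta> G"
  unfolding expect_def nn_integral_u_density_merge[OF F] FG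
proof (rule nn_integral_cong)
  fix u
  have "split_precision V W h u a i j > 0"
    using split_precision_ge[of u] pos by linarith
  then show "ennreal (u_density (insert a V) W h \<eta> u) *
      (\<integral>\<^sup>+ x. ennreal (split_kernel (split_precision V W h u a i j) x) * G u \<partial>lborel) =
      ennreal (u_density (insert a V) W h \<eta> u) * G u"
    by (simp add: nn_integral_multc split_kernel_total)
qed

text \<open>
  One step down the tree.  The weight \<open>T\<close> and the reference height \<open>R\<close> are visible in the merged graph, so the
  distance to \<open>R\<close> grows at most by the mean displacement of a single split.
\<close>

lemma expect_displacement:
  assumes pos: "W i j > 0"
    and T: "T \<in> borel_measurable (\<Pi>\<^sub>M k\<in>insert i (insert j V). lborel)"
    and R: "R \<in> borel_measurable (\<Pi>\<^sub>M k\<in>insert i (insert j V). lborel)"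
    and T': "T' \<in> borel_measurable (\<Pi>\<^sub>M k\<in>insert a V. lborel)"
    and R': "R' \<in> borel_measurable (\<Pi>\<^sub>M k\<in>insert a V. lborel)"
    and inv: "\<And>u x. T (split_pair V a i j u x) = T' u" "\<And>u x. R (split_pair V a i j u x) = R' u"
  shows "expect (insert i (insert j V)) W h \<eta> (\<lambda>u. T u * ennreal \<bar>u i - R u\<bar>) \<le>
    expect (insert a V) W h \<eta> (\<lambda>u. T' u * ennreal \<bar>u a - R' u\<bar>) +
    expect (insert a V) W h \<eta> T' * ennreal (2 / sqrt (4 * W i j))"
proof -
  let ?c = "ennreal (2 / sqrt (4 * W i j))"
  note [measurable] = T R T' R' borel_measurable_u_density
  have [measurable]: "(\<lambda>u. u i) \<in> borel_measurable (\<Pi>\<^sub>M k\<in>insert i (insert j V). lborel)"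
    "(\<lambda>u. u a) \<in> borel_measurable (\<Pi>\<^sub>M k\<in>insert a V. lborel)"
    using measurable_component_singleton[of i "insert i (insert j V)" "\<lambda>_. lborel"]
      measurable_component_singleton[of a "insert a V" "\<lambda>_. lborel"] by simp_all
  have F: "(\<lambda>u. T u * ennreal \<bar>u i - R u\<bar>) \<in> borel_measurable (\<Pi>\<^sub>M k\<in>insert i (insert j V). lborel)"
    by measurable
  have "expect (insert i (insert j V)) W h \<eta> (\<lambda>u. T u * ennreal \<bar>u i - R u\<bar>) \<le>
    (\<integral>\<^sup>+ u. ennreal (u_density (insert a V) W h \<eta> u) * (T' u * ennreal \<bar>u a - R' u\<bar>) +
      ennreal (u_density (insert a V) W h \<eta> u) * T' u * ?c \<partial>(\<Pi>\<^sub>M k\<in>insert a V. lborel))"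
    unfolding expect_def nn_integral_u_density_merge[OF F] inv split_pair_simps
  proof (rule nn_integral_mono)
    fix u :: "'a \<Rightarrow> real"
    let ?q = "split_precision V W h u a i j"
    have q: "0 < 4 * W i j" "4 * W i j \<le> ?q"
      using split_precision_ge[of u] pos by auto
    let ?D = "\<lambda>x::real. \<bar>x - ln (cosh x)\<bar>"
    have "(\<integral>\<^sup>+ x. ennreal (split_kernel ?q x) * (T' u * ennreal \<bar>u a + x - ln (cosh x) - R' u\<bar>) \<partial>lborel) \<le>
      (\<integral>\<^sup>+ x. ennreal (split_kernel ?q x) * (T' u * ennreal \<bar>u a - R' u\<bar>) +
        T' u * (ennreal (split_kernel ?q x) * ennreal (?D x)) \<partial>lborel)"
    proof (rule nn_integral_mono)
      fix x :: real
      have "ennreal \<bar>u a + x - ln (cosh x) - R' u\<bar> \<le> ennreal (\<bar>u a - R' u\<bar> + ?D x)"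
        by (rule ennreal_leI) linarith
      also have "\<dots> = ennreal \<bar>u a - R' u\<bar> + ennreal (?D x)"
        by simp
      finally have "ennreal (split_kernel ?q x) * (T' u * ennreal \<bar>u a + x - ln (cosh x) - R' u\<bar>) \<le>
        ennreal (split_kernel ?q x) * (T' u * (ennreal \<bar>u a - R' u\<bar> + ennreal (?D x)))"
        by (intro mult_left_mono) auto
      then show "ennreal (split_kernel ?q x) * (T' u * ennreal \<bar>u a + x - ln (cosh x) - R' u\<bar>) \<le>
        ennreal (split_kernel ?q x) * (T' u * ennreal \<bar>u a - R' u\<bar>) +
        T' u * (ennreal (split_kernel ?q x) * ennreal (?D x))"
        by (simp add: distrib_left mult_ac)
    qed
    also have "\<dots> = T' u * ennreal \<bar>u a - R' u\<bar> + T' u * (\<integral>\<^sup>+ x. ennreal (split_kernel ?q x) * ennreal (?D x) \<partial>lborel)"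
      using q by (simp add: nn_integral_add nn_integral_cmult nn_integral_multc split_kernel_total)
    also have "\<dots> \<le> T' u * ennreal \<bar>u a - R' u\<bar> + T' u * ?c"
      by (intro add_left_mono mult_left_mono split_kernel_displacement[OF q]) auto
    finally have "(\<integral>\<^sup>+ x. ennreal (split_kernel ?q x) * (T' u * ennreal \<bar>u a + x - ln (cosh x) - R' u\<bar>) \<partial>lborel) \<le>
      T' u * ennreal \<bar>u a - R' u\<bar> + T' u * ?c" .
    from mult_left_mono[OF this, of "ennreal (u_density (insert a V) W h \<eta> u)"]
    show "ennreal (u_density (insert a V) W h \<eta> u) *
        (\<integral>\<^sup>+ x. ennreal (split_kernel ?q x) * (T' u * ennreal \<bar>u a + x - ln (cosh x) - R' u\<bar>) \<partial>lborel) \<le>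
      ennreal (u_density (insert a V) W h \<eta> u) * (T' u * ennreal \<bar>u a - R' u\<bar>) +
      ennreal (u_density (insert a V) W h \<eta> u) * T' u * ?c"
      by (simp add: distrib_left mult.assoc)
  qed
  also have "\<dots> = expect (insert a V) W h \<eta> (\<lambda>u. T' u * ennreal \<bar>u a - R' u\<bar>) + expect (insert a V) W h \<eta> T' * ?c"
    unfolding expect_def by (subst nn_integral_add) (auto simp: nn_integral_multc)
  finally show ?thesis .
qed

text \<open>
  The analogue of \<open>expect_displacement\<close> for second moments of \<open>exp (u i - R)\<close>, which are multiplicative along the tree.
\<close>

lemma expect_ratio:
  assumes pos: "W i j > 0"
    and T: "T \<in> borel_measurable (\<Pi>\<^sub>M k\<in>insert i (insert j V). lborel)"
    and R: "R \<in> borel_measurable (\<Pi>\<^sub>M k\<in>insert i (insert j V). lborel)"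
    and T': "T' \<in> borel_measurable (\<Pi>\<^sub>M k\<in>insert a V. lborel)"
    and R': "R' \<in> borel_measurable (\<Pi>\<^sub>M k\<in>insert a V. lborel)"
    and inv: "\<And>u x. T (split_pair V a i j u x) = T' u" "\<And>u x. R (split_pair V a i j u x) = R' u"
  shows "expect (insert i (insert j V)) W h \<eta> (\<lambda>u. T u * ennreal ((exp (u i - R u))\<^sup>2)) \<le>
    expect (insert a V) W h \<eta> (\<lambda>u. T' u * ennreal ((exp (u a - R' u))\<^sup>2)) * ennreal (1 + 1 / (2 * (4 * W i j)))"
proof -
  let ?c = "ennreal (1 + 1 / (2 * (4 * W i j)))"
  have kernel_meas: "(\<lambda>x. ennreal (split_kernel q x) * ennreal ((exp (x - ln (cosh x)))\<^sup>2)) \<in> borel_measurable lborel" for q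
    by measurable
  note [measurable] = T R T' R' borel_measurable_u_density
  have [measurable]: "(\<lambda>u. u i) \<in> borel_measurable (\<Pi>\<^sub>M k\<in>insert i (insert j V). lborel)"
    "(\<lambda>u. u a) \<in> borel_measurable (\<Pi>\<^sub>M k\<in>insert a V. lborel)"
    using measurable_component_singleton[of i "insert i (insert j V)" "\<lambda>_. lborel"]
      measurable_component_singleton[of a "insert a V" "\<lambda>_. lborel"] by simp_all
  have F: "(\<lambda>u. T u * ennreal ((exp (u i - R u))\<^sup>2)) \<in> borel_measurable (\<Pi>\<^sub>M k\<in>insert i (insert j V). lborel)"
    by measurable
  have "expect (insert i (insert j V)) W h \<eta> (\<lambda>u. T u * ennreal ((exp (u i - R u))\<^sup>2)) \<le>
    (\<integral>\<^sup>+ u. ennreal (u_density (insert a V) W h \<eta> u) * (T' u * ennreal ((exp (u a - R' u))\<^sup>2)) * ?c \<partial>(\<Pi>\<^sub>M k\<in>insert a V. lborel))"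
    unfolding expect_def nn_integral_u_density_merge[OF F] inv split_pair_simps
  proof (rule nn_integral_mono)
    fix u :: "'a \<Rightarrow> real"
    let ?q = "split_precision V W h u a i j" and ?E = "T' u * ennreal ((exp (u a - R' u))\<^sup>2)"
    have q: "0 < 4 * W i j" "4 * W i j \<le> ?q"
      using split_precision_ge[of u] pos by auto
    have e: "ennreal ((exp (u a + x - ln (cosh x) - R' u))\<^sup>2) =
      ennreal ((exp (u a - R' u))\<^sup>2) * ennreal ((exp (x - ln (cosh x)))\<^sup>2)" for x
      by (simp add: ennreal_mult[symmetric] power_mult_distrib[symmetric] exp_add[symmetric] algebra_simps)
    have "(\<integral>\<^sup>+ x. ennreal (split_kernel ?q x) * (T' u * ennreal ((exp (u a + x - ln (cosh x) - R' u))\<^sup>2)) \<partial>lborel) =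
      (\<integral>\<^sup>+ x. ?E * (ennreal (split_kernel ?q x) * ennreal ((exp (x - ln (cosh x)))\<^sup>2)) \<partial>lborel)"
      unfolding e by (simp only: mult.assoc mult.commute mult.left_commute)
    also have "\<dots> = ?E * (\<integral>\<^sup>+ x. ennreal (split_kernel ?q x) * ennreal ((exp (x - ln (cosh x)))\<^sup>2) \<partial>lborel)"
      by (rule nn_integral_cmult[OF kernel_meas])
    also have "\<dots> \<le> ?E * ?c"
      by (intro mult_left_mono split_kernel_ratio[OF q]) auto
    finally have "(\<integral>\<^sup>+ x. ennreal (split_kernel ?q x) * (T' u * ennreal ((exp (u a + x - ln (cosh x) - R' u))\<^sup>2)) \<partial>lborel) \<le> ?E * ?c" .
    from mult_left_mono[OF this, of "ennreal (u_density (insert a V) W h \<eta> u)"]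
    show "ennreal (u_density (insert a V) W h \<eta> u) *
        (\<integral>\<^sup>+ x. ennreal (split_kernel ?q x) * (T' u * ennreal ((exp (u a + x - ln (cosh x) - R' u))\<^sup>2)) \<partial>lborel) \<le>
      ennreal (u_density (insert a V) W h \<eta> u) * ?E * ?c"
      by (simp add: mult.assoc)
  qed
  also have "\<dots> = expect (insert a V) W h \<eta> (\<lambda>u. T' u * ennreal ((exp (u a - R' u))\<^sup>2)) * ?c"
    unfolding expect_def by (rule nn_integral_multc) measurable
  finally show ?thesis .
qed

lemma swapped: "ferromagnetic_pair V W h \<eta> a j i"
  using fin new W_sym W_half h_half \<eta>_half nonneg by unfold_locales auto

end

section \<open>Blocks of the binary tree\<close>

text \<open>
  A word of length at most \<open>N\<close> stands for the block of all leaves that end with it; a block \<open>k\<close> lies at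
  level \<open>N - length k\<close>.  The distance of two blocks is the least level above both
  of them at which they lie in a common block.  For leaves this is the hierarchical distance.
\<close>

definition block_dist :: "nat \<Rightarrow> bool list \<Rightarrow> bool list \<Rightarrow> nat" where
  "block_dist N k l = (LEAST m. N - length k \<le> m \<and> N - length l \<le> m \<and>
     drop (m - (N - length k)) k = drop (m - (N - length l)) l)"

text \<open>
  The sum of the weights over all pairs of leaves of two disjoint blocks.
\<close>

definition block_weight :: "nat \<Rightarrow> (nat \<Rightarrow> real) \<Rightarrow> bool list \<Rightarrow> bool list \<Rightarrow> real" where
  "block_weight N w k l = 2 ^ (N - length k) * 2 ^ (N - length l) * w (block_dist N k l)"

lemma block_dist_sym: "block_dist N k l = block_dist N l k"
  unfolding block_dist_def by (rule arg_cong[where f=Least]) auto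

lemma block_dist_words:
  assumes "k \<in> words N" "l \<in> words N"
  shows "block_dist N k l = hdist k l"
proof -
  have "(tl ^^ m) k = drop m k" for m and k :: "bool list"
    by (induction m arbitrary: k) (auto simp: drop_Suc funpow_Suc_right simp del: funpow.simps(2))
  then show ?thesis
    using assms by (simp add: block_dist_def hdist_def words_def)
qed

lemma block_dist_child:
  assumes "length a < N" "length k \<le> N" "\<not> suffix (b # a) k"
  shows "block_dist N (b # a) k = block_dist N a k"
  unfolding block_dist_def
proof (rule arg_cong[where f=Least], rule ext)
  fix m
  show "(N - length (b # a) \<le> m \<and> N - length k \<le> m \<and>
      drop (m - (N - length (b # a))) (b # a) = drop (m - (N - length k)) k) =
    (N - length a \<le> m \<and> N - length k \<le> m \<and> drop (m - (N - length a)) a = drop (m - (N - length k)) k)"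
  proof (cases "N - length a \<le> m")
    case True
    then have "m - (N - length (b # a)) = Suc (m - (N - length a))"
      using assms(1) by simp
    then show ?thesis
      using True by auto
  next
    case False
    have "\<not> (N - length (b # a) \<le> m \<and> N - length k \<le> m \<and>
      drop (m - (N - length (b # a))) (b # a) = drop (m - (N - length k)) k)"
    proof
      assume *: "N - length (b # a) \<le> m \<and> N - length k \<le> m \<and>
        drop (m - (N - length (b # a))) (b # a) = drop (m - (N - length k)) k"
      have m0: "m - (N - length (b # a)) = 0"
        using False by simp
      from * have "drop (m - (N - length (b # a))) (b # a) = drop (m - (N - length k)) k"
        by blast
      then have "b # a = drop (m - (N - length k)) k"
        unfolding m0 drop_0 .
      then show False
        using assms(3) suffix_drop by metis
    qed
    then show ?thesis using False by simp
  qed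
qed

lemma block_dist_siblings:
  assumes "length a < N"
  shows "block_dist N (False # a) (True # a) = N - length a"
  unfolding block_dist_def
proof (rule Least_equality)
  show "N - length (False # a) \<le> N - length a \<and> N - length (True # a) \<le> N - length a \<and>
    drop (N - length a - (N - length (False # a))) (False # a) = drop (N - length a - (N - length (True # a))) (True # a)"
  proof -
    have "N - length a - (N - length (b # a)) = 1" for b :: bool
      using assms by simp
    then show ?thesis by simp
  qed
next
  fix m
  assume *: "N - length (False # a) \<le> m \<and> N - length (True # a) \<le> m \<and>
    drop (m - (N - length (False # a))) (False # a) = drop (m - (N - length (True # a))) (True # a)"
  show "N - length a \<le> m"
  proof (rule ccontr)
    assume "\<not> N - length a \<le> m"
    then have "m - (N - length (b # a)) = 0" for b :: bool
      by simp
    then show False using * by simp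
  qed
qed

text \<open>
  The vertex sets that occur while the leaves are merged up to the root \<open>[]\<close>: the leaf sets of the full binary
  trees of depth at most \<open>N\<close>, grown downwards from the root.
\<close>

inductive block_partition :: "nat \<Rightarrow> bool list set \<Rightarrow> bool" for N where
  root: "block_partition N {[]}"
| split: "block_partition N (insert a V) \<Longrightarrow> a \<notin> V \<Longrightarrow> length a < N \<Longrightarrow> block_partition N (insert (False # a) (insert (True # a) V))"

lemma block_partition_finite: "block_partition N V \<Longrightarrow> finite V"
  by (induction rule: block_partition.induct) auto

lemma block_partition_length: "block_partition N V \<Longrightarrow> k \<in> V \<Longrightarrow> length k \<le> N"
  by (induction arbitrary: k rule: block_partition.induct) auto

text \<open>
  No block of such a partition contains another one.  This is what makes siblings indistinguishable for all other blocks.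
\<close>

lemma block_partition_antichain: "block_partition N V \<Longrightarrow> k \<in> V \<Longrightarrow> l \<in> V \<Longrightarrow> suffix k l \<Longrightarrow> k = l"
proof (induction arbitrary: k l rule: block_partition.induct)
  case root
  then show ?case by simp
next
  case (split a V)
  have child: "suffix a (b # a)" for b :: bool
    by (simp add: suffix_def)
  have down: "\<not> suffix k (b # a)" if "k \<in> V" for k b
    using that split by (metis child insertCI suffix_Cons)
  have up: "\<not> suffix (b # a) k" if "k \<in> V" for k b
    using that split child suffix_order.order_trans by (metis insertCI)
  have "\<not> suffix (b # a) a" for b
    using suffix_length_le[of "b # a" a] by auto
  then show ?case
    using split.prems up down split.IH by (auto simp: suffix_Cons)
qed

lemma words_Suc: "words (Suc n) = (\<Union>a\<in>words n. {False # a, True # a})"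
  by (auto simp: words_def length_Suc_conv)

lemma finite_words: "finite (words n)"
  unfolding words_def using finite_lists_length_eq[of "UNIV :: bool set" n] by simp

lemma block_partition_words: "n \<le> N \<Longrightarrow> block_partition N (words n)"
proof (induction n)
  case 0
  have "words 0 = {[]}" by (auto simp: words_def)
  then show ?case by (simp add: block_partition.root)
next
  case (Suc n)
  have "block_partition N ((\<Union>a\<in>S. {False # a, True # a}) \<union> (words n - S))" if "S \<subseteq> words n" for S
    using finite_subset[OF that finite_words] that
  proof (induction S rule: finite_induct)
    case empty
    then show ?case using Suc by simp
  next
    case (insert a S)
    let ?V = "(\<Union>a\<in>S. {False # a, True # a}) \<union> (words n - insert a S)"
    have a: "length a = n" using insert.prems by (simp add: words_def)
    have "block_partition N (insert a ?V)"
    proof -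
      have "insert a ?V = (\<Union>a\<in>S. {False # a, True # a}) \<union> (words n - S)"
        using insert.hyps insert.prems by auto
      then show ?thesis using insert by simp
    qed
    moreover have "a \<notin> ?V"
    proof -
      have "length a' = n" if "a' \<in> S" for a'
        using insert.prems that by (auto simp: words_def)
      then have "length k = Suc n" if "k \<in> (\<Union>a\<in>S. {False # a, True # a})" for k
        using that by auto
      then have "a \<notin> (\<Union>a\<in>S. {False # a, True # a})"
        using a by (metis n_not_Suc_n)
      then show ?thesis by blast
    qed
    ultimately have "block_partition N (insert (False # a) (insert (True # a) ?V))"
      using Suc.prems a by (intro block_partition.split) auto
    then show ?case
      by (simp add: insert_commute Un_insert_left)
  qed
  from this[of "words n"] show ?case
    by (simp add: words_Suc)
qed

text \<open>
  The height that the root has after everything has been merged, as a function of the heights on a partition into blocks.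
\<close>

definition root_height :: "bool list set \<Rightarrow> (bool list \<Rightarrow> real) \<Rightarrow> real" where
  "root_height V u = ln (\<Sum>k\<in>V. exp (u k) / 2 ^ length k)"

text \<open>
  Bound for the mean displacement when a block at level \<open>d\<close> splits into its halves.
\<close>

definition jump :: "(nat \<Rightarrow> real) \<Rightarrow> nat \<Rightarrow> real" where
  "jump w d = 2 / sqrt (4 ^ d * w d)"

lemma borel_measurable_root_height:
  "root_height V \<in> borel_measurable (\<Pi>\<^sub>M k\<in>V. lborel)"
proof -
  have [measurable]: "(\<lambda>u. u k) \<in> borel_measurable (\<Pi>\<^sub>M i\<in>V. lborel :: real measure)" if "k \<in> V" for k
    using measurable_component_singleton[OF that, of "\<lambda>_. lborel :: real measure"] by simp
  have "(\<lambda>u. \<Sum>k\<in>V. exp (u k) / 2 ^ length k) \<in> borel_measurable (\<Pi>\<^sub>M i\<in>V. lborel :: real measure)"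
    by (rule borel_measurable_sum) measurable
  then show ?thesis
    unfolding root_height_def[abs_def] by measurable
qed

lemma ferromagnetic_block_partition:
  fixes w :: "nat \<Rightarrow> real"
  assumes "block_partition N (insert a V)" "a \<notin> V" "length a < N" and w: "\<And>l. w l > 0" and \<epsilon>: "\<epsilon> \<ge> 0"
  shows "ferromagnetic_pair V (block_weight N w) (\<lambda>k. \<epsilon> * 2 ^ (N - length k)) (\<lambda>k. c * 2 ^ (N - length k))
    a (False # a) (True # a)"
proof -
  have child: "suffix a (b # a)" for b :: bool
    by (simp add: suffix_def)
  have ac: "\<not> suffix a k" if "k \<in> V" for k
    using block_partition_antichain[OF assms(1), of a k] that assms(2) by auto
  then have new: "b # a \<notin> V" for b
    using child by blast
  have dbl: "(2::real) ^ (N - length a) = 2 * 2 ^ (N - length (b # a))" for b :: bool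
  proof -
    have "N - length a = Suc (N - length (b # a))" using assms(3) by simp
    then show ?thesis by simp
  qed
  have half: "block_weight N w (b # a) k = block_weight N w a k / 2" if "k \<in> V" for k b
  proof -
    have "\<not> suffix (b # a) k"
      using ac[OF that] child[of b] suffix_order.order_trans by blast
    then show ?thesis
      using block_dist_child[of a N k b] block_partition_length[OF assms(1), of k] that assms(3) dbl[of b]
      by (simp add: block_weight_def)
  qed
  have sym: "block_weight N w k l = block_weight N w l k" for k l
    by (simp add: block_weight_def block_dist_sym[of N k l])
  show ?thesis
  proof unfold_locales
    show "finite V"
      using block_partition_finite[OF assms(1)] by simp
  qed (use new half sym assms dbl[of False] dbl[of True] less_imp_le[OF w]
      in \<open>auto simp: block_weight_def intro!: mult_nonneg_nonneg\<close>)
qed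

lemma root_height_split:
  assumes "finite V" "a \<notin> V" "False # a \<notin> V" "True # a \<notin> V"
  shows "root_height (insert (False # a) (insert (True # a) V)) (split_pair V a (False # a) (True # a) u x) =
    root_height (insert a V) u"
proof -
  let ?v = "split_pair V a (False # a) (True # a) u x" and ?m = "\<lambda>u k. exp (u k) / 2 ^ length k"
  have C: "cosh x > 0" by (rule cosh_real_pos)
  have "?v (False # a) = u a + x - ln (cosh x)" "?v (True # a) = u a - x - ln (cosh x)"
    by (simp_all add: split_pair_def)
  then have "exp (?v (False # a)) + exp (?v (True # a)) = exp (u a) * (exp x + exp (- x)) / cosh x"
    using C by (simp only: exp_add exp_diff exp_ln[OF C]) (simp add: exp_minus field_simps)
  also have "\<dots> = 2 * exp (u a)"
    using C by (simp add: cosh_def)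
  finally have avg: "?m ?v (False # a) + ?m ?v (True # a) = ?m u a"
    by (simp add: field_simps)
  have "?v k = u k" if "k \<in> V" for k
    using that assms by (auto simp: split_pair_def)
  then have "(\<Sum>k\<in>V. ?m ?v k) = (\<Sum>k\<in>V. ?m u k)"
    by simp
  then have "(\<Sum>k\<in>insert (False # a) (insert (True # a) V). ?m ?v k) = (\<Sum>k\<in>insert a V. ?m u k)"
    using assms avg by (simp add: add.assoc[symmetric])
  then show ?thesis
    by (simp add: root_height_def)
qed

text \<open>
  Refining the partition downwards, a vertex at depth \<open>n\<close> has gone through the splits at the levels
  \<open>N - n + 1, \<dots>, N\<close>; each split adds its displacement to the first moment and its factor to the second moment.
  The function \<open>\<theta>\<close> of the root height carries the pinning in the case where \<open>h = 0\<close>.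
\<close>

lemma block_partition_bounds:
  fixes w :: "nat \<Rightarrow> real" and N \<epsilon> c
  defines "W \<equiv> block_weight N w" and "h \<equiv> \<lambda>k. \<epsilon> * 2 ^ (N - length k)" and "\<eta> \<equiv> \<lambda>k. c * 2 ^ (N - length k)"
  assumes w: "\<And>l. w l > 0" and \<epsilon>: "\<epsilon> \<ge> 0"
    and \<theta>: "\<theta> \<in> borel_measurable borel"
    and base: "expect {[]} W h \<eta> (\<lambda>u. \<theta> (u [])) \<le> 1"
    and V: "block_partition N V"
  shows "expect V W h \<eta> (\<lambda>u. \<theta> (root_height V u)) \<le> 1 \<and>
    (\<forall>k\<in>V. expect V W h \<eta> (\<lambda>u. \<theta> (root_height V u) * ennreal \<bar>u k - root_height V u\<bar>)
        \<le> ennreal (\<Sum>d\<in>{N - length k<..N}. jump w d)) \<and>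
    (\<forall>k\<in>V. expect V W h \<eta> (\<lambda>u. \<theta> (root_height V u) * ennreal ((exp (u k - root_height V u))\<^sup>2))
        \<le> ennreal (\<Prod>d\<in>{N - length k<..N}. 1 + (jump w d)\<^sup>2))"
  using V
proof (induction V rule: block_partition.induct)
  case root
  have "root_height {[]} u = u []" for u
    by (simp add: root_height_def)
  then show ?case
    using base by (simp add: expect_def)
next
  case (split a V)
  let ?i = "False # a" and ?j = "True # a" and ?d = "N - length a"
  let ?U = "insert ?i (insert ?j V)" and ?V = "insert a V"
  let ?T = "\<lambda>V u. \<theta> (root_height V u)"
  interpret ferromagnetic_pair V W h \<eta> a ?i ?j
    unfolding W_def h_def \<eta>_def using split w \<epsilon> by (intro ferromagnetic_block_partition) auto
  interpret sw: ferromagnetic_pair V W h \<eta> a ?j ?i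
    by (rule swapped)
  note [measurable] = \<theta> borel_measurable_root_height
  have Tm: "?T V \<in> borel_measurable (\<Pi>\<^sub>M k\<in>V. lborel)" for V
    by measurable
  note Rm = borel_measurable_root_height
  have [measurable]: "(\<lambda>u. u k) \<in> borel_measurable (\<Pi>\<^sub>M i\<in>V. lborel :: real measure)" if "k \<in> V" for k and V :: "bool list set"
    using measurable_component_singleton[OF that, of "\<lambda>_. lborel :: real measure"] by simp
  have inv: "root_height ?U (split_pair V a ?i ?j u x) = root_height ?V u" for u x
    using fin new by (intro root_height_split)
  have swap: "split_pair V a ?j ?i u x = split_pair V a ?i ?j u (- x)" for u x
    by (auto simp: split_pair_def fun_eq_iff)
  have Wij: "4 * W ?i ?j = 4 ^ ?d * w ?d"
  proof -
    have "?d = Suc (N - length ?i)" using split.hyps by simp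
    then have "(4::real) ^ ?d = 4 * (2 ^ (N - length ?i) * 2 ^ (N - length ?i))"
      by (simp add: power_mult_distrib[symmetric])
    then show ?thesis
      using block_dist_siblings[OF split.hyps(3)] by (simp add: W_def block_weight_def)
  qed
  have "0 < 4 * W ?i ?j"
    unfolding Wij using w[of ?d] by simp
  then have pos: "W ?i ?j > 0" "W ?j ?i > 0"
    using W_sym[of ?i ?j] by simp_all
  have Wji: "W ?j ?i = W ?i ?j" by (rule W_sym)
  have jmp: "2 / sqrt (4 * W ?i ?j) = jump w ?d"
    unfolding Wij jump_def ..
  have jnn: "0 \<le> jump w d" for d
    using less_imp_le[OF w[of d]] by (simp add: jump_def)
  \<comment> \<open>A precision \<open>q0\<close> gives \<open>jump\<^sup>2 = 4 / q0\<close>, more than the second moment needs.\<close>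
  have rat: "1 + 1 / (2 * (4 * W ?i ?j)) \<le> 1 + (jump w ?d)\<^sup>2"
    using pos(1) by (simp add: jmp[symmetric] power_divide field_simps)
  have total: "expect ?U W h \<eta> (?T ?U) \<le> 1"
    using split.IH expect_coarse[OF pos(1) Tm, of "?T ?V"] inv by simp
  have range: "{N - length (b # a)<..N} = insert ?d {?d<..N}" for b
    using split.hyps by (auto simp: Suc_diff_Suc)
  have disp: "expect ?U W h \<eta> (\<lambda>u. ?T ?U u * ennreal \<bar>u k - root_height ?U u\<bar>)
        \<le> ennreal (\<Sum>d\<in>{N - length k<..N}. jump w d)" if k: "k \<in> ?U" for k
  proof -
    let ?S = "\<Sum>d\<in>{?d<..N}. jump w d"
    have S: "?S \<ge> 0" by (intro sum_nonneg jnn)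
    have up: "expect ?V W h \<eta> (\<lambda>u. ?T ?V u * ennreal \<bar>u a - root_height ?V u\<bar>) +
        expect ?V W h \<eta> (?T ?V) * ennreal (jump w ?d) \<le> ennreal (jump w ?d + ?S)"
    proof -
      have "expect ?V W h \<eta> (?T ?V) * ennreal (jump w ?d) \<le> 1 * ennreal (jump w ?d)"
        using split.IH by (intro mult_right_mono) auto
      moreover have "expect ?V W h \<eta> (\<lambda>u. ?T ?V u * ennreal \<bar>u a - root_height ?V u\<bar>) \<le> ennreal ?S"
        using split.IH by auto
      ultimately show ?thesis
        using jnn S by (simp add: add.commute add_mono)
    qed
    consider "k = ?i" | "k = ?j" | "k \<in> V" using k by blast
    then show ?thesis
    proof cases
      case 1
      have "expect ?U W h \<eta> (\<lambda>u. ?T ?U u * ennreal \<bar>u ?i - root_height ?U u\<bar>) \<le>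
        expect ?V W h \<eta> (\<lambda>u. ?T ?V u * ennreal \<bar>u a - root_height ?V u\<bar>) +
        expect ?V W h \<eta> (?T ?V) * ennreal (jump w ?d)"
        unfolding jmp[symmetric] by (rule expect_displacement[OF pos(1) Tm Rm Tm Rm]) (simp_all add: inv)
      from order_trans[OF this up] show ?thesis
        unfolding 1 range by simp
    next
      case 2
      have "expect (insert ?j (insert ?i V)) W h \<eta>
          (\<lambda>u. ?T (insert ?j (insert ?i V)) u * ennreal \<bar>u ?j - root_height (insert ?j (insert ?i V)) u\<bar>) \<le>
        expect ?V W h \<eta> (\<lambda>u. ?T ?V u * ennreal \<bar>u a - root_height ?V u\<bar>) +
        expect ?V W h \<eta> (?T ?V) * ennreal (2 / sqrt (4 * W ?j ?i))"
        by (rule sw.expect_displacement[OF pos(2) Tm Rm Tm Rm]) (simp_all only: swap inv insert_commute[of ?j ?i])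
      from order_trans[OF this[unfolded Wji insert_commute[of ?j ?i] jmp] up] show ?thesis
        unfolding 2 range by simp
    next
      case 3
      have "expect ?U W h \<eta> (\<lambda>u. ?T ?U u * ennreal \<bar>u k - root_height ?U u\<bar>) =
        expect ?V W h \<eta> (\<lambda>u. ?T ?V u * ennreal \<bar>u k - root_height ?V u\<bar>)"
        using 3 by (intro expect_coarse[OF pos(1)]) (simp_all add: inv split_pair_simps)
      then show ?thesis
        using split.IH 3 by auto
    qed
  qed
  have ratio: "expect ?U W h \<eta> (\<lambda>u. ?T ?U u * ennreal ((exp (u k - root_height ?U u))\<^sup>2))
        \<le> ennreal (\<Prod>d\<in>{N - length k<..N}. 1 + (jump w d)\<^sup>2)" if k: "k \<in> ?U" for k
  proof -
    let ?S = "\<Prod>d\<in>{?d<..N}. 1 + (jump w d)\<^sup>2"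
    have S: "?S \<ge> 0" by (intro prod_nonneg) simp
    have up: "expect ?V W h \<eta> (\<lambda>u. ?T ?V u * ennreal ((exp (u a - root_height ?V u))\<^sup>2)) *
        ennreal (1 + 1 / (2 * (4 * W ?i ?j))) \<le> ennreal ((1 + (jump w ?d)\<^sup>2) * ?S)"
    proof -
      have "expect ?V W h \<eta> (\<lambda>u. ?T ?V u * ennreal ((exp (u a - root_height ?V u))\<^sup>2)) *
          ennreal (1 + 1 / (2 * (4 * W ?i ?j))) \<le> ennreal ?S * ennreal (1 + (jump w ?d)\<^sup>2)"
        using split.IH by (intro mult_mono ennreal_leI rat) auto
      also have "\<dots> = ennreal ((1 + (jump w ?d)\<^sup>2) * ?S)"
        using S by (subst ennreal_mult[symmetric]) (auto simp: mult.commute)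
      finally show ?thesis .
    qed
    consider "k = ?i" | "k = ?j" | "k \<in> V" using k by blast
    then show ?thesis
    proof cases
      case 1
      have "expect ?U W h \<eta> (\<lambda>u. ?T ?U u * ennreal ((exp (u ?i - root_height ?U u))\<^sup>2)) \<le>
        expect ?V W h \<eta> (\<lambda>u. ?T ?V u * ennreal ((exp (u a - root_height ?V u))\<^sup>2)) *
        ennreal (1 + 1 / (2 * (4 * W ?i ?j)))"
        by (rule expect_ratio[OF pos(1) Tm Rm Tm Rm]) (simp_all add: inv)
      from order_trans[OF this up] show ?thesis
        unfolding 1 range by simp
    next
      case 2
      have "expect (insert ?j (insert ?i V)) W h \<eta>
          (\<lambda>u. ?T (insert ?j (insert ?i V)) u * ennreal ((exp (u ?j - root_height (insert ?j (insert ?i V)) u))\<^sup>2)) \<le>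
        expect ?V W h \<eta> (\<lambda>u. ?T ?V u * ennreal ((exp (u a - root_height ?V u))\<^sup>2)) *
        ennreal (1 + 1 / (2 * (4 * W ?j ?i)))"
        by (rule sw.expect_ratio[OF pos(2) Tm Rm Tm Rm]) (simp_all only: swap inv insert_commute[of ?j ?i])
      from order_trans[OF this[unfolded Wji insert_commute[of ?j ?i]] up] show ?thesis
        unfolding 2 range by simp
    next
      case 3
      have "expect ?U W h \<eta> (\<lambda>u. ?T ?U u * ennreal ((exp (u k - root_height ?U u))\<^sup>2)) =
        expect ?V W h \<eta> (\<lambda>u. ?T ?V u * ennreal ((exp (u k - root_height ?V u))\<^sup>2))"
        using 3 by (intro expect_coarse[OF pos(1)]) (simp_all add: inv split_pair_simps)
      then show ?thesis
        using split.IH 3 by auto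
    qed
  qed
  show ?case
    using total disp ratio by blast
qed

section \<open>Integrating out the s-coordinates\<close>

lemma M_mat_quadratic_form:
  assumes V: "finite V" and sym: "\<And>i j. W i j = W j i"
  shows "(\<Sum>i\<in>V. \<Sum>j\<in>V. s i * M_mat V W h u i j * s j) =
    (\<Sum>i\<in>V. \<Sum>j\<in>V. W i j * exp (u i + u j) * (s i - s j)\<^sup>2) + (\<Sum>i\<in>V. h i * exp (u i) * (s i)\<^sup>2)"
proof -
  let ?c = "\<lambda>i j. W i j * exp (u i + u j)"
  have row: "(\<Sum>j\<in>V. s i * M_mat V W h u i j * s j) =
      (\<Sum>j\<in>V. 2 * ?c i j * (s i * (s i - s j))) + h i * exp (u i) * (s i)\<^sup>2" if "i \<in> V" for i
  proof -
    have off: "(\<Sum>j\<in>V - {i}. s i * M_mat V W h u i j * s j) = (\<Sum>j\<in>V - {i}. - (2 * ?c i j * (s i * s j)))"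
      by (intro sum.cong) (auto simp: M_mat_def)
    have "(\<Sum>j\<in>V. s i * M_mat V W h u i j * s j) =
      s i * M_mat V W h u i i * s i + (\<Sum>j\<in>V - {i}. s i * M_mat V W h u i j * s j)"
      using V that by (simp add: sum.remove)
    also have "s i * M_mat V W h u i i * s i =
      h i * exp (u i) * (s i)\<^sup>2 + (\<Sum>j\<in>V - {i}. 2 * ?c i j * (s i)\<^sup>2)"
      by (simp add: M_mat_def power2_eq_square sum_distrib_left algebra_simps)
    also have "h i * exp (u i) * (s i)\<^sup>2 + (\<Sum>j\<in>V - {i}. 2 * ?c i j * (s i)\<^sup>2) +
        (\<Sum>j\<in>V - {i}. s i * M_mat V W h u i j * s j) =
      h i * exp (u i) * (s i)\<^sup>2 + (\<Sum>j\<in>V - {i}. 2 * ?c i j * (s i * (s i - s j)))"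
      unfolding off by (simp add: sum_negf sum_subtractf right_diff_distrib power2_eq_square)
    also have "(\<Sum>j\<in>V - {i}. 2 * ?c i j * (s i * (s i - s j))) = (\<Sum>j\<in>V. 2 * ?c i j * (s i * (s i - s j)))"
      using V that by (simp add: sum.remove)
    finally show ?thesis by simp
  qed
  have swap: "(\<Sum>i\<in>V. \<Sum>j\<in>V. ?c i j * (s i * (s i - s j))) = (\<Sum>i\<in>V. \<Sum>j\<in>V. ?c i j * (s j * (s j - s i)))"
    by (subst sum.swap) (simp add: sym add.commute)
  have "(\<Sum>i\<in>V. \<Sum>j\<in>V. ?c i j * (s i - s j)\<^sup>2) =
    (\<Sum>i\<in>V. \<Sum>j\<in>V. ?c i j * (s i * (s i - s j))) + (\<Sum>i\<in>V. \<Sum>j\<in>V. ?c i j * (s j * (s j - s i)))"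
    unfolding sum.distrib[symmetric] by (intro sum.cong refl) (simp add: power2_eq_square algebra_simps)
  also have "\<dots> = (\<Sum>i\<in>V. \<Sum>j\<in>V. 2 * ?c i j * (s i * (s i - s j)))"
    unfolding swap[symmetric] sum.distrib[symmetric] by (intro sum.cong refl) simp
  finally show ?thesis
    by (simp add: row sum.distrib)
qed

text \<open>
  All weights are strictly positive, so the Laplacian part of the quadratic form vanishes only on constants, and on these the
  pinning at \<open>z\<close> is strictly positive.
\<close>

lemma M_mat_gaussian:
  assumes V: "finite V" and sym: "\<And>i j. W i j = W j i"
    and W: "\<And>i j. i \<in> V \<Longrightarrow> j \<in> V \<Longrightarrow> i \<noteq> j \<Longrightarrow> W i j > 0"
    and h: "\<And>i. i \<in> V \<Longrightarrow> h i \<ge> 0" and z: "z \<in> V" "h z > 0"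
  shows "det_on V (M_mat V W h u) > 0 \<and>
    (\<integral>\<^sup>+ s. ennreal (exp (- (\<Sum>i\<in>V. \<Sum>j\<in>V. s i * M_mat V W h u i j * s j) / 2)) \<partial>(\<Pi>\<^sub>M i\<in>V. lborel))
      = ennreal (sqrt ((2 * pi) ^ card V / det_on V (M_mat V W h u)))"
proof (rule nn_integral_gaussian_quadratic_form[OF V])
  show "M_mat V W h u i j = M_mat V W h u j i" for i j
    using sym[of i j] by (simp add: M_mat_def add.commute)
next
  fix s :: "'a \<Rightarrow> real"
  assume "\<exists>i\<in>V. s i \<noteq> 0"
  then obtain i where i: "i \<in> V" "s i \<noteq> 0" by blast
  let ?e = "\<lambda>i j. W i j * exp (u i + u j) * (s i - s j)\<^sup>2" and ?p = "\<lambda>i. h i * exp (u i) * (s i)\<^sup>2"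
  have e: "0 \<le> ?e k l" if "k \<in> V" "l \<in> V" for k l
    using W[OF that] by (cases "k = l") (auto intro!: mult_nonneg_nonneg less_imp_le)
  have p: "0 \<le> ?p k" if "k \<in> V" for k
    using h[OF that] by simp
  have E: "0 \<le> (\<Sum>l\<in>V. ?e k l)" if "k \<in> V" for k
    using that e by (intro sum_nonneg)
  have P0: "0 \<le> (\<Sum>k\<in>V. ?p k)" and E0: "0 \<le> (\<Sum>k\<in>V. \<Sum>l\<in>V. ?e k l)"
    using p E by (auto intro: sum_nonneg)
  show "0 < (\<Sum>i\<in>V. \<Sum>j\<in>V. s i * M_mat V W h u i j * s j)"
  proof (cases "s z = 0")
    case True
    then have "i \<noteq> z" using i by auto
    then have "0 < ?e i z"
      using W[of i z] i z True by simp
    also have "\<dots> \<le> (\<Sum>l\<in>V. ?e i l)"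
      using V i z e by (intro member_le_sum) auto
    also have "\<dots> \<le> (\<Sum>k\<in>V. \<Sum>l\<in>V. ?e k l)"
      using V i E by (intro member_le_sum) auto
    finally show ?thesis
      unfolding M_mat_quadratic_form[OF V sym] using P0 by simp
  next
    case False
    then have "0 < ?p z"
      using z by simp
    also have "\<dots> \<le> (\<Sum>k\<in>V. ?p k)"
      using V z p by (intro member_le_sum) auto
    finally show ?thesis
      unfolding M_mat_quadratic_form[OF V sym] using E0 by simp
  qed
qed

text \<open>
  The Gaussian integral over \<open>s\<close> leaves the square root of the determinant and of each factor \<open>2 * pi\<close>.
\<close>

lemma nn_integral_h22_density:
  assumes V: "finite V" and sym: "\<And>i j. W i j = W j i"
    and W: "\<And>i j. i \<in> V \<Longrightarrow> j \<in> V \<Longrightarrow> i \<noteq> j \<Longrightarrow> W i j > 0"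
    and h: "\<And>i. i \<in> V \<Longrightarrow> h i \<ge> 0" and z: "z \<in> V" "h z > 0"
  shows "(\<integral>\<^sup>+ s. ennreal (h22_density V W h u s) \<partial>(\<Pi>\<^sub>M i\<in>V. lborel)) = ennreal (u_density V W h (\<lambda>_. 0) u)"
proof -
  let ?D = "det_on V (M_mat V W h u)"
  let ?E = "exp (- (\<Sum>i\<in>V. \<Sum>j\<in>V. W i j * (cosh (u i - u j) - 1))) * exp (- (\<Sum>i\<in>V. h i * (cosh (u i) - 1)))"
  let ?C = "?E * ?D * (\<Prod>i\<in>V. exp (- u i) / (2 * pi))"
  let ?Q = "\<lambda>s. \<Sum>i\<in>V. \<Sum>j\<in>V. s i * M_mat V W h u i j * s j"
  have gauss: "?D > 0 \<and> (\<integral>\<^sup>+ s. ennreal (exp (- ?Q s / 2)) \<partial>(\<Pi>\<^sub>M i\<in>V. lborel)) = ennreal (sqrt ((2 * pi) ^ card V / ?D))"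
    by (rule M_mat_gaussian[where z=z]) (use V W h z in \<open>auto intro: sym\<close>)
  then have D: "?D > 0" and I: "(\<integral>\<^sup>+ s. ennreal (exp (- ?Q s / 2)) \<partial>(\<Pi>\<^sub>M i\<in>V. lborel)) = ennreal (sqrt ((2 * pi) ^ card V / ?D))"
    by blast+
  have C: "?C \<ge> 0"
    using D by (intro mult_nonneg_nonneg prod_nonneg) auto
  have eq: "h22_density V W h u s = ?C * exp (- ?Q s / 2)" for s
  proof -
    have edges: "(\<Sum>i\<in>V. \<Sum>j\<in>V. W i j * (B_edge u s i j - 1)) =
      (\<Sum>i\<in>V. \<Sum>j\<in>V. W i j * (cosh (u i - u j) - 1)) +
      (\<Sum>i\<in>V. \<Sum>j\<in>V. W i j * exp (u i + u j) * (s i - s j)\<^sup>2) / 2"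
      unfolding B_edge_def sum_divide_distrib sum.distrib[symmetric]
      by (intro sum.cong refl) (simp add: field_simps)
    have pins: "(\<Sum>i\<in>V. h i * (B_pin u s i - 1)) =
      (\<Sum>i\<in>V. h i * (cosh (u i) - 1)) + (\<Sum>i\<in>V. h i * exp (u i) * (s i)\<^sup>2) / 2"
      unfolding B_pin_def sum_divide_distrib sum.distrib[symmetric]
      by (intro sum.cong refl) (simp add: field_simps)
    have "(\<Sum>i\<in>V. \<Sum>j\<in>V. W i j * (B_edge u s i j - 1)) + (\<Sum>i\<in>V. h i * (B_pin u s i - 1)) =
      (\<Sum>i\<in>V. \<Sum>j\<in>V. W i j * (cosh (u i - u j) - 1)) + (\<Sum>i\<in>V. h i * (cosh (u i) - 1)) + ?Q s / 2"
      unfolding M_mat_quadratic_form[OF V sym] edges pins by simp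
    then have "exp (- (\<Sum>i\<in>V. \<Sum>j\<in>V. W i j * (B_edge u s i j - 1))) * exp (- (\<Sum>i\<in>V. h i * (B_pin u s i - 1))) =
      ?E * exp (- ?Q s / 2)"
      by (simp add: exp_add[symmetric] algebra_simps)
    then show ?thesis
      unfolding h22_density_def by simp
  qed
  have "(\<integral>\<^sup>+ s. ennreal (h22_density V W h u s) \<partial>(\<Pi>\<^sub>M i\<in>V. lborel)) =
    ennreal ?C * ennreal (sqrt ((2 * pi) ^ card V / ?D))"
  proof -
    have "(\<lambda>s. ennreal (exp (- ?Q s / 2))) \<in> borel_measurable (\<Pi>\<^sub>M i\<in>V. lborel)"
      by (intro measurable_compose[OF _ measurable_ennreal] borel_measurable_exp borel_measurable_divide borel_measurable_uminus
       borel_measurable_sum borel_measurable_times borel_measurable_const) auto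
    from nn_integral_cmult[OF this, of "ennreal ?C"] show ?thesis
      by (simp only: eq ennreal_mult[OF C exp_ge_zero] I)
  qed
  also have "\<dots> = ennreal (?C * sqrt ((2 * pi) ^ card V / ?D))"
    using C D by (simp add: ennreal_mult)
  also have "?C * sqrt ((2 * pi) ^ card V / ?D) = u_density V W h (\<lambda>_. 0) u"
  proof -
    have d: "?D * sqrt (P / ?D) = sqrt ?D * sqrt P" for P
      using D by (simp add: real_sqrt_divide real_div_sqrt field_simps)
    have "(\<Prod>i\<in>V. exp (- u i) / (2 * pi)) * sqrt ((2 * pi) ^ card V) = (\<Prod>i\<in>V. exp (- u i) / (2 * pi) * sqrt (2 * pi))"
      by (simp only: prod.distrib prod_constant real_sqrt_power)
    also have "\<dots> = (\<Prod>i\<in>V. exp (- u i) / sqrt (2 * pi))"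
    proof -
      have "e / (2 * pi) * sqrt (2 * pi) = e / sqrt (2 * pi)" for e
        using real_sqrt_mult_self[of "2 * pi"] by (simp add: field_simps)
      then show ?thesis by simp
    qed
    finally have p: "(\<Prod>i\<in>V. exp (- u i) / (2 * pi)) * sqrt ((2 * pi) ^ card V) = (\<Prod>i\<in>V. exp (- u i) / sqrt (2 * pi))" .
    have "?C * sqrt ((2 * pi) ^ card V / ?D) =
      ?E * (?D * sqrt ((2 * pi) ^ card V / ?D)) * (\<Prod>i\<in>V. exp (- u i) / (2 * pi))"
      by (simp only: mult.assoc mult.commute mult.left_commute)
    also have "\<dots> = ?E * sqrt ?D * ((\<Prod>i\<in>V. exp (- u i) / (2 * pi)) * sqrt ((2 * pi) ^ card V))"
      unfolding d by (simp only: mult.assoc mult.commute mult.left_commute)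
    finally show ?thesis
      unfolding p u_density_def by simp
  qed
  finally show ?thesis .
qed

lemma borel_measurable_h22_density:
  "(\<lambda>(u, s). h22_density V W h u s) \<in> borel_measurable ((\<Pi>\<^sub>M i\<in>V. lborel) \<Otimes>\<^sub>M (\<Pi>\<^sub>M i\<in>V. lborel))"
proof -
  let ?M = "(\<Pi>\<^sub>M i\<in>V. lborel :: real measure) \<Otimes>\<^sub>M (\<Pi>\<^sub>M i\<in>V. lborel :: real measure)"
  have comp: "(\<lambda>u. u k) \<in> borel_measurable (\<Pi>\<^sub>M i\<in>V. lborel :: real measure)" if "k \<in> V" for k
    using measurable_component_singleton[OF that, of "\<lambda>_. lborel :: real measure"] by simp
  have f: "(\<lambda>p. fst p k) \<in> borel_measurable ?M" and s: "(\<lambda>p. snd p k) \<in> borel_measurable ?M" if "k \<in> V" for k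
    using measurable_compose[OF measurable_fst comp[OF that]] measurable_compose[OF measurable_snd comp[OF that]] by auto
  have edge: "(\<lambda>p. B_edge (fst p) (snd p) i j) \<in> borel_measurable ?M" if "i \<in> V" "j \<in> V" for i j
    unfolding B_edge_def using f[OF that(1)] f[OF that(2)] s[OF that(1)] s[OF that(2)]
    by (intro borel_measurable_add borel_measurable_divide borel_measurable_times borel_measurable_power borel_measurable_diff
        measurable_compose[OF _ borel_measurable_exp] measurable_compose[OF _ borel_measurable_sinh_cosh(2)] borel_measurable_const)
  have pin: "(\<lambda>p. B_pin (fst p) (snd p) i) \<in> borel_measurable ?M" if "i \<in> V" for i
    unfolding B_pin_def using f[OF that] s[OF that]
    by (intro borel_measurable_add borel_measurable_divide borel_measurable_times borel_measurable_power
        measurable_compose[OF _ borel_measurable_exp] measurable_compose[OF _ borel_measurable_sinh_cosh(2)] borel_measurable_const)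
  have M: "(\<lambda>p. M_mat V W h (fst p) i j) \<in> borel_measurable ?M" if "i \<in> V" "j \<in> V" for i j
    by (rule measurable_compose[OF measurable_fst borel_measurable_M_mat[OF that]])
  show ?thesis
    unfolding h22_density_def case_prod_unfold
    by (intro borel_measurable_times measurable_compose[OF _ borel_measurable_exp] borel_measurable_uminus borel_measurable_sum borel_measurable_diff
        borel_measurable_const borel_measurable_prod borel_measurable_divide borel_measurable_det_on edge pin M f)
qed

lemma emeasure_h22_law:
  assumes V: "finite V" and sym: "\<And>i j. W i j = W j i"
    and W: "\<And>i j. i \<in> V \<Longrightarrow> j \<in> V \<Longrightarrow> i \<noteq> j \<Longrightarrow> W i j > 0"
    and h: "\<And>i. i \<in> V \<Longrightarrow> h i \<ge> 0" and z: "z \<in> V" "h z > 0"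
    and P: "Measurable.pred (\<Pi>\<^sub>M i\<in>V. lborel) P"
  shows "emeasure (h22_law V W h) {(u, s) \<in> space (h22_law V W h). P u} =
    expect V W h (\<lambda>_. 0) (\<lambda>u. indicator {u. P u} u)"
proof -
  let ?L = "\<Pi>\<^sub>M i\<in>V. lborel :: real measure"
  let ?f = "\<lambda>p. ennreal (h22_density V W h (fst p) (snd p)) * indicator {u. P u} (fst p)"
  interpret product_sigma_finite "\<lambda>_::'a. lborel :: real measure" by standard
  interpret L: sigma_finite_measure ?L by (rule sigma_finite[OF V])
  note [measurable] = P borel_measurable_h22_density
  have S: "{(u, s) \<in> space (h22_law V W h). P u} = {p \<in> space (?L \<Otimes>\<^sub>M ?L). P (fst p)}"
    by (auto simp: h22_law_def)
  have "Measurable.pred (?L \<Otimes>\<^sub>M ?L) (\<lambda>p. P (fst p))"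
    by measurable
  then have S': "{p \<in> space (?L \<Otimes>\<^sub>M ?L). P (fst p)} \<in> sets (?L \<Otimes>\<^sub>M ?L)"
    by (simp add: pred_def)
  have hm: "(\<lambda>p. ennreal (h22_density V W h (fst p) (snd p))) \<in> borel_measurable (?L \<Otimes>\<^sub>M ?L)"
    using borel_measurable_h22_density[of V W h] by (simp add: case_prod_unfold)
  have fm: "?f \<in> borel_measurable (?L \<Otimes>\<^sub>M ?L)"
  proof (rule borel_measurable_times_ennreal[OF hm])
    have "{u \<in> space ?L. P u} \<in> sets ?L" using P by (simp add: pred_def)
    then have "(\<lambda>u. indicator {u. P u} u :: ennreal) \<in> borel_measurable ?L"
      by (subst measurable_cong[where g="indicator {u \<in> space ?L. P u}"]) (auto simp: indicator_def)
    from measurable_compose[OF measurable_fst this]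
    show "(\<lambda>p. indicator {u. P u} (fst p) :: ennreal) \<in> borel_measurable (?L \<Otimes>\<^sub>M ?L)" .
  qed
  have "emeasure (h22_law V W h) {(u, s) \<in> space (h22_law V W h). P u} = (\<integral>\<^sup>+ p. ?f p \<partial>(?L \<Otimes>\<^sub>M ?L))"
    unfolding S unfolding h22_law_def case_prod_unfold
    by (subst emeasure_density[OF hm S']) (auto intro!: nn_integral_cong simp: indicator_def)
  also have "\<dots> = (\<integral>\<^sup>+ u. \<integral>\<^sup>+ s. ?f (u, s) \<partial>?L \<partial>?L)"
    by (rule L.nn_integral_fst[OF fm, symmetric])
  also have "\<dots> = expect V W h (\<lambda>_. 0) (\<lambda>u. indicator {u. P u} u)"
    unfolding expect_def
  proof (rule nn_integral_cong)
    fix u assume u: "u \<in> space ?L"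
    have "(\<lambda>s. ennreal (h22_density V W h u s)) \<in> borel_measurable ?L"
      using measurable_Pair2[OF hm u] by simp
    from nn_integral_multc[OF this, of "indicator {u. P u} u"]
    show "(\<integral>\<^sup>+ s. ?f (u, s) \<partial>?L) = ennreal (u_density V W h (\<lambda>_. 0) u) * indicator {u. P u} u"
      by (subst (asm) nn_integral_h22_density[where z=z]) (use V W h z in \<open>auto intro: sym\<close>)
  qed
  finally show ?thesis .
qed

section \<open>Moving the pinned point\<close>

lemma nn_integral_PiM_shift:
  fixes f :: "('v \<Rightarrow> real) \<Rightarrow> ennreal"
  assumes "finite V" "f \<in> borel_measurable (\<Pi>\<^sub>M i\<in>V. lborel)"
  shows "(\<integral>\<^sup>+ u. f (\<lambda>i\<in>V. u i + c) \<partial>(\<Pi>\<^sub>M i\<in>V. lborel)) = (\<integral>\<^sup>+ u. f u \<partial>(\<Pi>\<^sub>M i\<in>V. lborel))"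
  using assms
proof (induction V arbitrary: f rule: finite_induct)
  case empty
  then show ?case by (simp add: PiM_empty restrict_def nn_integral_count_space_finite)
next
  case (insert v V)
  interpret product_sigma_finite "\<lambda>_::'v. lborel :: real measure"
    by standard
  note [measurable] = insert.prems
  have r: "(\<lambda>i\<in>insert v V. (x(v := y)) i + c) = (\<lambda>i\<in>V. x i + c)(v := y + c)" for x y
    using insert.hyps by (auto simp: fun_eq_iff)
  have shift [measurable]: "(\<lambda>u. \<lambda>i\<in>W. u i + c) \<in> (\<Pi>\<^sub>M i\<in>W. lborel) \<rightarrow>\<^sub>M (\<Pi>\<^sub>M i\<in>W. lborel)" for W :: "'v set"
    by (rule measurable_restrict) auto
  have m2 [measurable]: "(\<lambda>(x, y). f (x(v := y))) \<in> borel_measurable ((\<Pi>\<^sub>M i\<in>V. lborel) \<Otimes>\<^sub>M lborel)"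
    using measurable_compose[OF measurable_add_dim insert.prems] by (simp add: case_prod_unfold)
  have "(\<integral>\<^sup>+ u. f (\<lambda>i\<in>insert v V. u i + c) \<partial>(\<Pi>\<^sub>M i\<in>insert v V. lborel)) =
    (\<integral>\<^sup>+ x. \<integral>\<^sup>+ y. f ((\<lambda>i\<in>V. x i + c)(v := y + c)) \<partial>lborel \<partial>(\<Pi>\<^sub>M i\<in>V. lborel))"
    unfolding r[symmetric] by (rule product_nn_integral_insert[OF insert.hyps(1,2) measurable_compose[OF shift insert.prems]])
  also have "\<dots> = (\<integral>\<^sup>+ x. \<integral>\<^sup>+ y. f ((\<lambda>i\<in>V. x i + c)(v := y)) \<partial>lborel \<partial>(\<Pi>\<^sub>M i\<in>V. lborel))"
  proof (rule nn_integral_cong)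
    fix x assume "x \<in> space (\<Pi>\<^sub>M i\<in>V. lborel :: real measure)"
    then have "(\<lambda>i\<in>V. x i + c) \<in> space (\<Pi>\<^sub>M i\<in>V. lborel)"
      by (simp add: space_PiM)
    then have "(\<lambda>y. f ((\<lambda>i\<in>V. x i + c)(v := y))) \<in> borel_measurable lborel"
      using measurable_Pair2[OF m2] by simp
    then show "(\<integral>\<^sup>+ y. f ((\<lambda>i\<in>V. x i + c)(v := y + c)) \<partial>lborel) = (\<integral>\<^sup>+ y. f ((\<lambda>i\<in>V. x i + c)(v := y)) \<partial>lborel)"
      using nn_integral_real_affine[of "\<lambda>y. f ((\<lambda>i\<in>V. x i + c)(v := y))" 1 c] by (simp add: add.commute)
  qed
  also have "\<dots> = (\<integral>\<^sup>+ x. \<integral>\<^sup>+ y. f (x(v := y)) \<partial>lborel \<partial>(\<Pi>\<^sub>M i\<in>V. lborel))"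
    by (rule insert.IH) measurable
  also have "\<dots> = (\<integral>\<^sup>+ u. f u \<partial>(\<Pi>\<^sub>M i\<in>insert v V. lborel))"
    using insert.hyps insert.prems by (subst product_nn_integral_insert) auto
  finally show ?case .
qed

text \<open>
  Both sides fix the free additive constant of \<open>u\<close> by giving a prescribed law to one
  functional that moves along with shifts.  Insert \<open>1 = \<integral> k (b u + c) dc\<close>, shift \<open>u\<close> by \<open>- c\<close>, and
  integrate out the factor with \<open>a\<close> instead.
\<close>

lemma gauge_exchange:
  fixes k :: "real \<Rightarrow> ennreal" and G :: "('v \<Rightarrow> real) \<Rightarrow> ennreal" and a b :: "('v \<Rightarrow> real) \<Rightarrow> real"
  assumes V: "finite V"
    and meas: "k \<in> borel_measurable borel" "G \<in> borel_measurable (\<Pi>\<^sub>M i\<in>V. lborel)"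
      "a \<in> borel_measurable (\<Pi>\<^sub>M i\<in>V. lborel)" "b \<in> borel_measurable (\<Pi>\<^sub>M i\<in>V. lborel)"
    and k: "(\<integral>\<^sup>+ t. k t \<partial>lborel) = 1"
    and G: "\<And>u c. G (\<lambda>i\<in>V. u i + c) = G u"
    and ab: "\<And>u c. a (\<lambda>i\<in>V. u i + c) = a u + c" "\<And>u c. b (\<lambda>i\<in>V. u i + c) = b u + c"
  shows "(\<integral>\<^sup>+ u. G u * k (a u) \<partial>(\<Pi>\<^sub>M i\<in>V. lborel)) = (\<integral>\<^sup>+ u. G u * k (b u) \<partial>(\<Pi>\<^sub>M i\<in>V. lborel))"
proof -
  let ?L = "\<Pi>\<^sub>M i\<in>V. lborel :: real measure"
  interpret product_sigma_finite "\<lambda>_::'v. lborel :: real measure" by standard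
  interpret L: sigma_finite_measure ?L by (rule sigma_finite[OF V])
  interpret p: pair_sigma_finite ?L "lborel :: real measure" by unfold_locales
  note [measurable] = meas
  have one: "(\<integral>\<^sup>+ c. k (x + c) \<partial>lborel) = 1" "(\<integral>\<^sup>+ c. k (x - c) \<partial>lborel) = 1" for x
    using k nn_integral_real_affine[OF meas(1), of 1 x] nn_integral_real_affine[OF meas(1), of "-1" x] by simp_all
  have "(\<integral>\<^sup>+ u. G u * k (a u) \<partial>?L) = (\<integral>\<^sup>+ u. \<integral>\<^sup>+ c. G u * k (a u) * k (b u + c) \<partial>lborel \<partial>?L)"
    by (simp add: nn_integral_cmult one)
  also have "\<dots> = (\<integral>\<^sup>+ c. \<integral>\<^sup>+ u. G u * k (a u) * k (b u + c) \<partial>?L \<partial>lborel)"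
    by (rule p.Fubini'[symmetric]) measurable
  also have "\<dots> = (\<integral>\<^sup>+ c. \<integral>\<^sup>+ u. G u * k (a u - c) * k (b u) \<partial>?L \<partial>lborel)"
  proof (rule nn_integral_cong)
    fix c :: real
    have "(\<lambda>u. G u * k (a u - c) * k (b u)) \<in> borel_measurable ?L"
      by measurable
    from nn_integral_PiM_shift[OF V this, of c]
    show "(\<integral>\<^sup>+ u. G u * k (a u) * k (b u + c) \<partial>?L) = (\<integral>\<^sup>+ u. G u * k (a u - c) * k (b u) \<partial>?L)"
      unfolding G ab by simp
  qed
  also have "\<dots> = (\<integral>\<^sup>+ u. \<integral>\<^sup>+ c. G u * k (a u - c) * k (b u) \<partial>lborel \<partial>?L)"
    by (rule p.Fubini') measurable
  also have "\<dots> = (\<integral>\<^sup>+ u. G u * k (b u) \<partial>?L)"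
  proof (rule nn_integral_cong)
    fix u
    have "(\<integral>\<^sup>+ c. (G u * k (b u)) * k (a u - c) \<partial>lborel) = G u * k (b u)"
      by (simp add: nn_integral_cmult one)
    then show "(\<integral>\<^sup>+ c. G u * k (a u - c) * k (b u) \<partial>lborel) = G u * k (b u)"
      by (simp add: mult_ac)
  qed
  finally show ?thesis .
qed

lemma u_density_shift:
  assumes V: "finite V"
  shows "u_density V W (\<lambda>_. 0) \<eta> (\<lambda>i\<in>V. u i + c) = u_density V W (\<lambda>_. 0) \<eta> u"
proof -
  let ?v = "\<lambda>i\<in>V. u i + c"
  let ?A = "\<lambda>u i j. M_mat V W (\<lambda>_. 0) u i j + (\<eta> i * exp (u i)) * (\<eta> j * exp (u j))"
  have e: "exp (?v k + ?v l) = exp (2 * c) * exp (u k + u l)" if "k \<in> V" "l \<in> V" for k l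
    using that by (simp add: exp_add[symmetric] algebra_simps)
  have "?A ?v i j = exp (2 * c) * ?A u i j" if ij: "i \<in> V" "j \<in> V" for i j
  proof -
    have s: "(\<Sum>k\<in>V - {i}. W i k * exp (?v i + ?v k)) = exp (2 * c) * (\<Sum>k\<in>V - {i}. W i k * exp (u i + u k))"
      unfolding sum_distrib_left using e[OF ij(1)] by (intro sum.cong) auto
    have m: "M_mat V W (\<lambda>_. 0) ?v i j = exp (2 * c) * M_mat V W (\<lambda>_. 0) u i j"
      unfolding M_mat_def s e[OF ij] by simp
    have "(\<eta> i * exp (?v i)) * (\<eta> j * exp (?v j)) = exp (2 * c) * ((\<eta> i * exp (u i)) * (\<eta> j * exp (u j)))"
      using e[OF ij] by (simp add: exp_add)
    with m show ?thesis
      by (simp only: distrib_left)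
  qed
  then have "det_on V (?A ?v) = det_on V (\<lambda>i j. exp (2 * c) * ?A u i j)"
    by (rule det_on_cong)
  also have "\<dots> = exp (2 * c) ^ card V * det_on V (?A u)"
    by (rule det_on_scale[OF V])
  finally have det: "det_on V (?A ?v) = exp (2 * c) ^ card V * det_on V (?A u)" .
  have sq: "sqrt (exp (2 * c) ^ card V * d) = exp c ^ card V * sqrt d" for d
  proof -
    have "exp (2 * c) = (exp c)\<^sup>2"
      by (simp add: exp_double)
    then show ?thesis
      by (simp add: real_sqrt_mult real_sqrt_power)
  qed
  have prod: "(\<Prod>i\<in>V. exp (- ?v i) / sqrt (2 * pi)) = exp (- c) ^ card V * (\<Prod>i\<in>V. exp (- u i) / sqrt (2 * pi))"
  proof -
    have "(\<Prod>i\<in>V. exp (- ?v i) / sqrt (2 * pi)) = (\<Prod>i\<in>V. exp (- c) * (exp (- u i) / sqrt (2 * pi)))"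
      by (intro prod.cong refl) (simp add: exp_add[symmetric] add.commute)
    then show ?thesis
      by (simp only: prod.distrib prod_constant)
  qed
  have edge: "(\<Sum>i\<in>V. \<Sum>j\<in>V. W i j * (cosh (?v i - ?v j) - 1)) = (\<Sum>i\<in>V. \<Sum>j\<in>V. W i j * (cosh (u i - u j) - 1))"
    by (intro sum.cong refl) auto
  have one: "exp c ^ card V * exp (- c) ^ card V = 1"
    by (simp add: power_mult_distrib[symmetric] exp_add[symmetric])
  have arrange: "E * F * (x * d) * (y * p) = E * F * d * p" if "x * y = 1" for E F x d y p :: real
  proof -
    have "E * F * (x * d) * (y * p) = (x * y) * (E * F * d * p)" by simp
    then show ?thesis using that by simp
  qed
  show ?thesis
    unfolding u_density_def det sq prod edge mult_zero_left sum.neutral_const by (rule arrange[OF one])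
qed

text \<open>
  Both determinants are rank-one perturbations of the same Laplacian, so \<open>det_on_rank_one\<close> gives their ratio.
\<close>

lemma u_density_one_point:
  assumes V: "finite V" and z: "z \<in> V" and sym: "\<And>i j. W i j = W j i" and \<epsilon>: "\<epsilon> > 0"
  shows "u_density V W (\<lambda>i. if i = z then \<epsilon> else 0) (\<lambda>_. 0) u * (\<Sum>k\<in>V. exp (u k)) =
    u_density V W (\<lambda>_. 0) (\<lambda>_. 1) u * (sqrt (\<epsilon> * exp (u z)) * exp (- \<epsilon> * (cosh (u z) - 1)))"
proof -
  obtain U where U: "V = insert z U" "z \<notin> U" "finite U"
    using z V by (metis Set.set_insert finite_insert)
  let ?L = "M_mat V W (\<lambda>_. 0) u" and ?S = "\<Sum>k\<in>V. exp (u k)"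
  define D where "D = det_on U ?L"
  have S: "?S > 0"
    using V z by (intro sum_pos) auto
  have rows: "(\<Sum>j\<in>V. ?L i j) = 0" if "i \<in> V" for i
  proof -
    have "(\<Sum>j\<in>V - {i}. ?L i j) = (\<Sum>j\<in>V - {i}. - (2 * (W i j * exp (u i + u j))))"
      by (intro sum.cong) (auto simp: M_mat_def)
    moreover have "?L i i = (\<Sum>j\<in>V - {i}. 2 * (W i j * exp (u i + u j)))"
      by (simp add: M_mat_def sum_distrib_left)
    moreover have "(\<Sum>j\<in>V. ?L i j) = ?L i i + (\<Sum>j\<in>V - {i}. ?L i j)"
      by (rule sum.remove[OF V that])
    ultimately show ?thesis
      by (simp only: sum_negf)
  qed
  have Lsym: "?L i j = ?L j i" for i j
    using sym[of i j] by (cases "i = j") (simp_all add: M_mat_def add.commute)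
  have cols: "(\<Sum>i\<in>V. ?L i j) = 0" if "j \<in> V" for j
  proof -
    have "(\<Sum>i\<in>V. ?L i j) = (\<Sum>i\<in>V. ?L j i)"
      by (rule sum.cong[OF refl]) (rule Lsym)
    then show ?thesis using rows[OF that] by simp
  qed
  have "det_on V (\<lambda>i j. ?L i j + exp (u i) * exp (u j)) = ?S * ?S * D"
    using det_on_rank_one[OF U(3,2), of ?L "\<lambda>i. exp (u i)" "\<lambda>j. exp (u j)"] S rows cols
    by (simp add: U(1)[symmetric] D_def)
  then have det1: "sqrt (det_on V (\<lambda>i j. ?L i j + (1 * exp (u i)) * (1 * exp (u j)))) = ?S * sqrt D"
    using S by (simp add: real_sqrt_mult)
  have "det_on V (\<lambda>i j. M_mat V W (\<lambda>i. if i = z then \<epsilon> else 0) u i j + (0 * exp (u i)) * (0 * exp (u j))) =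
    det_on V (\<lambda>i j. ?L i j + (if i = z then \<epsilon> * exp (u z) else 0) * (if j = z then 1 else 0))"
    by (intro det_on_cong) (auto simp: M_mat_def)
  also have "\<dots> = \<epsilon> * exp (u z) * D"
  proof -
    have "(\<Sum>i\<in>V. if i = z then \<epsilon> * exp (u z) else 0) = \<epsilon> * exp (u z)" "(\<Sum>j\<in>V. if j = z then 1 else 0) = (1::real)"
      using V z by simp_all
    then show ?thesis
      using det_on_rank_one[OF U(3,2), of ?L "\<lambda>i. if i = z then \<epsilon> * exp (u z) else 0" "\<lambda>j. if j = z then 1 else 0"]
        rows cols \<epsilon> by (simp add: U(1)[symmetric] D_def)
  qed
  finally have det2: "det_on V (\<lambda>i j. M_mat V W (\<lambda>i. if i = z then \<epsilon> else 0) u i j + (0 * exp (u i)) * (0 * exp (u j))) =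
    \<epsilon> * exp (u z) * D" .
  have pin: "(\<Sum>i\<in>V. (if i = z then \<epsilon> else 0) * (cosh (u i) - 1)) = \<epsilon> * (cosh (u z) - 1)"
    using V z by (simp add: if_distrib[of "\<lambda>x. x * _"] cong: if_cong)
  show ?thesis
    unfolding u_density_def det1 det2 pin
    by (simp add: real_sqrt_mult)
qed

lemma root_height_shift:
  assumes "finite V" "V \<noteq> {}"
  shows "root_height V (\<lambda>i\<in>V. u i + c) = root_height V u + c"
proof -
  have "(\<Sum>k\<in>V. exp ((\<lambda>i\<in>V. u i + c) k) / 2 ^ length k) = (\<Sum>k\<in>V. exp (u k) / 2 ^ length k) * exp c"
    unfolding sum_distrib_right by (intro sum.cong) (auto simp: exp_add)
  moreover have "(\<Sum>k\<in>V. exp (u k) / 2 ^ length k) > 0"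
    using assms by (intro sum_pos) auto
  ultimately show ?thesis
    by (simp add: root_height_def ln_mult)
qed

section \<open>Tail bounds for both kinds of pinning\<close>

lemma u_density_cong_parameters:
  assumes "\<And>k l. k \<in> V \<Longrightarrow> l \<in> V \<Longrightarrow> k \<noteq> l \<Longrightarrow> W k l = W' k l"
    and "\<And>k. k \<in> V \<Longrightarrow> h k = h' k" "\<And>k. k \<in> V \<Longrightarrow> \<eta> k = \<eta>' k"
  shows "u_density V W h \<eta> u = u_density V W' h' \<eta>' u"
proof -
  have 1: "W k l * (cosh (u k - u l) - 1) = W' k l * (cosh (u k - u l) - 1)" if "k \<in> V" "l \<in> V" for k l
    using assms(1)[OF that] by (cases "k = l") auto
  have 2: "M_mat V W h u k l = M_mat V W' h' u k l" if "k \<in> V" "l \<in> V" for k l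
  proof (cases "k = l")
    case True
    have "(\<Sum>x\<in>V - {k}. W k x * exp (u k + u x)) = (\<Sum>x\<in>V - {k}. W' k x * exp (u k + u x))"
      using assms(1)[OF that(1)] by (intro sum.cong) auto
    then show ?thesis
      using True assms(2)[OF that(1)] by (simp add: M_mat_def)
  next
    case False
    then show ?thesis
      using assms(1)[OF that] by (simp add: M_mat_def)
  qed
  have "det_on V (\<lambda>i j. M_mat V W h u i j + (\<eta> i * exp (u i)) * (\<eta> j * exp (u j))) =
    det_on V (\<lambda>i j. M_mat V W' h' u i j + (\<eta>' i * exp (u i)) * (\<eta>' j * exp (u j)))"
    using 2 assms(3) by (intro det_on_cong) auto
  moreover have "(\<Sum>i\<in>V. \<Sum>j\<in>V. W i j * (cosh (u i - u j) - 1)) = (\<Sum>i\<in>V. \<Sum>j\<in>V. W' i j * (cosh (u i - u j) - 1))"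
    using 1 by (intro sum.cong refl)
  moreover have "(\<Sum>i\<in>V. h i * (cosh (u i) - 1)) = (\<Sum>i\<in>V. h' i * (cosh (u i) - 1))"
    using assms(2) by (intro sum.cong) auto
  ultimately show ?thesis
    by (simp only: u_density_def)
qed

lemma u_density_singleton:
  "u_density {k} W h \<eta> u =
    exp (- h k * (cosh (u k) - 1)) * sqrt (h k * exp (u k) + (\<eta> k * exp (u k))\<^sup>2) * exp (- u k) / sqrt (2 * pi)"
  by (simp add: u_density_def det_on_def M_mat_def power2_eq_square)

lemma nn_integral_singleton_PiM:
  fixes f :: "real \<Rightarrow> ennreal"
  assumes "f \<in> borel_measurable borel"
  shows "(\<integral>\<^sup>+ u. f (u k) \<partial>(\<Pi>\<^sub>M i\<in>{k}. lborel)) = (\<integral>\<^sup>+ t. f t \<partial>lborel)"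
proof -
  interpret product_sigma_finite "\<lambda>_::'a. lborel :: real measure" by standard
  show ?thesis
    using assms by (intro product_nn_integral_singleton) simp
qed

lemma expect_root_uniform:
  assumes "\<epsilon> > 0"
  shows "expect {[]} W (\<lambda>k. \<epsilon> * 2 ^ (N - length k)) (\<lambda>k. 0 * 2 ^ (N - length k)) (\<lambda>u. (\<lambda>_. 1) (u [])) = 1"
proof -
  let ?H = "\<epsilon> * 2 ^ N"
  have H: "?H > 0" using assms by simp
  have "u_density {[]} W (\<lambda>k. \<epsilon> * 2 ^ (N - length k)) (\<lambda>k. 0 * 2 ^ (N - length k)) u = root_density ?H (u [])" for u
  proof -
    have "sqrt (exp (u [])) = exp (u [] / 2)"
      by (rule real_sqrt_unique) (simp_all add: exp_double[symmetric])
    then have e: "sqrt (exp (u [])) * exp (- u []) = exp (- u [] / 2)"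
      by (simp add: exp_add[symmetric])
    have "u_density {[]} W (\<lambda>k. \<epsilon> * 2 ^ (N - length k)) (\<lambda>k. 0 * 2 ^ (N - length k)) u =
        exp (- ?H * (cosh (u []) - 1)) * (sqrt ?H / sqrt (2 * pi)) * (sqrt (exp (u [])) * exp (- u []))"
      unfolding u_density_singleton by (simp add: real_sqrt_mult)
    then show ?thesis
      unfolding e root_density_def real_sqrt_divide by (simp only: mult.assoc mult.commute mult.left_commute)
  qed
  then show ?thesis
    using nn_integral_singleton_PiM[of "\<lambda>t. ennreal (root_density ?H t)"] root_density_total[OF H]
    by (simp add: expect_def)
qed

lemma expect_root_one_point:
  assumes "\<epsilon> > 0"
  shows "expect {[]} W (\<lambda>k. 0 * 2 ^ (N - length k)) (\<lambda>k. 1 * 2 ^ (N - length k))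
    (\<lambda>u. ennreal (sqrt (2 * pi) / 2 ^ N * root_density \<epsilon> (u []))) = 1"
proof -
  have "u_density {[]} W (\<lambda>k. 0 * 2 ^ (N - length k)) (\<lambda>k. 1 * 2 ^ (N - length k)) u = 2 ^ N / sqrt (2 * pi)" for u
    unfolding u_density_singleton by (simp add: exp_minus)
  moreover have "ennreal (2 ^ N / sqrt (2 * pi)) * ennreal (sqrt (2 * pi) / 2 ^ N * r) = ennreal r" if "r \<ge> 0" for r
    using that by (simp add: ennreal_mult[symmetric])
  moreover have "root_density \<epsilon> t \<ge> 0" for t
    using assms by (simp add: root_density_def)
  ultimately show ?thesis
    using nn_integral_singleton_PiM[of "\<lambda>t. ennreal (root_density \<epsilon> t)"] root_density_total[OF assms]
    by (simp add: expect_def)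
qed

lemma hweight_sym: "hweight w i j = hweight w j i"
  by (auto simp: hweight_def hdist_def eq_commute)

lemma u_density_words:
  assumes "\<And>k. k \<in> words N \<Longrightarrow> h k = \<epsilon>" "\<And>k. k \<in> words N \<Longrightarrow> \<eta> k = c"
  shows "u_density (words N) (hweight w) h \<eta> u =
    u_density (words N) (block_weight N w) (\<lambda>k. \<epsilon> * 2 ^ (N - length k)) (\<lambda>k. c * 2 ^ (N - length k)) u"
proof (rule u_density_cong_parameters)
  fix k l assume *: "k \<in> words N" "l \<in> words N" "k \<noteq> l"
  have "length k = N" "length l = N" using * by (auto simp: words_def)
  then show "hweight w k l = block_weight N w k l"
    using * by (simp add: hweight_def block_weight_def block_dist_words)
qed (use assms in \<open>auto simp: words_def\<close>)

text \<open>
  As \<open>4 ^ (l + 2) * w (l + 2) = 8 * \<beta> l\<close> and the logarithm is at least 1, the jump at level \<open>l + 2\<close> is dominated by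
  the \<open>l\<close>-th term of the given series.
\<close>

lemma summable_jump:
  fixes w \<beta> :: "nat \<Rightarrow> real"
  assumes w_pos: "\<And>l. w l > 0"
    and \<beta>_eq: "\<And>l. \<beta> l = 2 ^ (2 * l + 1) * w (l + 2)"
    and summ: "summable (\<lambda>l. sqrt (ln (max (\<beta> l) (exp 1)) / \<beta> l))"
  shows "summable (jump w)"
proof (subst summable_iff_shift[symmetric, of _ 2], rule summable_comparison_test'[OF summ, of 0])
  fix l :: nat
  have \<beta>: "\<beta> l > 0" using w_pos by (simp add: \<beta>_eq)
  have e: "4 ^ (l + 2) * w (l + 2) = 8 * \<beta> l"
    by (simp add: \<beta>_eq power_add power_mult)
  have "1 \<le> ln (max (\<beta> l) (exp 1))"
    by (subst ln_ge_iff) (auto simp: max.strict_coboundedI2)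
  then have "1 / \<beta> l \<le> ln (max (\<beta> l) (exp 1)) / \<beta> l"
    using \<beta> by (simp add: divide_right_mono)
  then have le: "sqrt (1 / \<beta> l) \<le> sqrt (ln (max (\<beta> l) (exp 1)) / \<beta> l)"
    by simp
  have "2 / sqrt (8 * \<beta> l) \<le> sqrt (1 / \<beta> l)"
  proof -
    have "2 * sqrt (\<beta> l) \<le> sqrt (8 * \<beta> l)"
      using \<beta> by (intro real_le_rsqrt) (simp add: power_mult_distrib)
    then show ?thesis
      using \<beta> by (simp add: real_sqrt_divide field_simps)
  qed
  from order_trans[OF this le] show "norm (jump w (l + 2)) \<le> sqrt (ln (max (\<beta> l) (exp 1)) / \<beta> l)"
    using \<beta> unfolding jump_def e by simp
qed

locale summable_jumps =
  fixes w :: "nat \<Rightarrow> real"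
  assumes w_pos: "\<And>l. w l > 0" and summable: "summable (jump w)"
begin

lemma jump_nonneg: "0 \<le> jump w d"
  using less_imp_le[OF w_pos[of d]] by (simp add: jump_def)

definition jump_total :: real where "jump_total = (\<Sum>d. jump w d)"

lemma jump_total_nonneg: "0 \<le> jump_total"
  unfolding jump_total_def by (rule suminf_nonneg[OF summable jump_nonneg])

lemma sum_jump_le: "finite D \<Longrightarrow> (\<Sum>d\<in>D. jump w d) \<le> jump_total"
  unfolding jump_total_def by (rule sum_le_suminf[OF summable]) (auto simp: jump_nonneg)

lemma prod_jump_le:
  assumes "finite D"
  shows "(\<Prod>d\<in>D. 1 + (jump w d)\<^sup>2) \<le> exp (2 * jump_total)"
proof -
  have "1 + (jump w d)\<^sup>2 \<le> exp (2 * jump w d)" for d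
  proof -
    have "1 + (jump w d)\<^sup>2 \<le> (1 + jump w d)\<^sup>2"
      using jump_nonneg[of d] by (simp add: power2_eq_square algebra_simps)
    also have "\<dots> \<le> (exp (jump w d))\<^sup>2"
      using jump_nonneg[of d] exp_ge_add_one_self[of "jump w d"] by (intro power_mono) auto
    finally show ?thesis by (simp add: exp_double)
  qed
  then have "(\<Prod>d\<in>D. 1 + (jump w d)\<^sup>2) \<le> (\<Prod>d\<in>D. exp (2 * jump w d))"
    by (intro prod_mono) auto
  also have "\<dots> = exp (2 * (\<Sum>d\<in>D. jump w d))"
    using assms by (simp add: exp_sum sum_distrib_left)
  also have "\<dots> \<le> exp (2 * jump_total)"
    using sum_jump_le[OF assms] by simp
  finally show ?thesis .
qed

abbreviation far :: "real \<Rightarrow> bool list \<Rightarrow> bool list \<Rightarrow> (bool list \<Rightarrow> real) set" where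
  "far M p q \<equiv> {u. \<bar>u p - u q\<bar> \<ge> M}"

lemma markov_split:
  assumes "M > 0"
  shows "(indicator (far M p q) u :: ennreal) \<le>
    ennreal (1 / M) * (ennreal \<bar>u p - R\<bar> + ennreal \<bar>u q - R\<bar>)"
proof (cases "u \<in> far M p q")
  case True
  then have "M \<le> \<bar>u p - R\<bar> + \<bar>u q - R\<bar>" by simp
  then have "1 \<le> 1 / M * (\<bar>u p - R\<bar> + \<bar>u q - R\<bar>)"
    using assms by (simp add: field_simps)
  then have "1 \<le> ennreal (1 / M * (\<bar>u p - R\<bar> + \<bar>u q - R\<bar>))"
    by simp
  also have "\<dots> = ennreal (1 / M) * (ennreal \<bar>u p - R\<bar> + ennreal \<bar>u q - R\<bar>)"
  proof -
    have "ennreal (1 / M * (\<bar>u p - R\<bar> + \<bar>u q - R\<bar>)) = ennreal (1 / M) * ennreal (\<bar>u p - R\<bar> + \<bar>u q - R\<bar>)"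
      by (rule ennreal_mult) (use assms in auto)
    then show ?thesis by simp
  qed
  finally show ?thesis using True by simp
qed simp

lemma measurable_words:
  "k \<in> words N \<Longrightarrow> (\<lambda>u. u k) \<in> borel_measurable (\<Pi>\<^sub>M k\<in>words N. lborel :: real measure)"
  using measurable_component_singleton[of k "words N" "\<lambda>_. lborel :: real measure"] by simp

lemma pred_far:
  fixes M :: real
  assumes "p \<in> words N" "q \<in> words N"
  shows "Measurable.pred (\<Pi>\<^sub>M k\<in>words N. lborel) (\<lambda>u. \<bar>u p - u q\<bar> \<ge> M)"
proof -
  have "(\<lambda>u. \<bar>u p - u q\<bar>) \<in> borel_measurable (\<Pi>\<^sub>M k\<in>words N. lborel :: real measure)"
    by (intro borel_measurable_abs borel_measurable_diff measurable_words assms)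
  then show ?thesis
    unfolding pred_def by (rule borel_measurable_le[OF borel_measurable_const])
qed

lemma expect_far:
  assumes pq: "p \<in> words N" "q \<in> words N" and M: "M > 0" and \<epsilon>: "\<epsilon> \<ge> 0"
    and \<theta>: "\<theta> \<in> borel_measurable borel"
    and base: "expect {[]} (block_weight N w) (\<lambda>k. \<epsilon> * 2 ^ (N - length k)) (\<lambda>k. c * 2 ^ (N - length k)) (\<lambda>u. \<theta> (u [])) \<le> 1"
  shows "expect (words N) (block_weight N w) (\<lambda>k. \<epsilon> * 2 ^ (N - length k)) (\<lambda>k. c * 2 ^ (N - length k))
    (\<lambda>u. \<theta> (root_height (words N) u) * indicator (far M p q) u) \<le> ennreal (2 * jump_total / M)"
proof -
  let ?E = "expect (words N) (block_weight N w) (\<lambda>k. \<epsilon> * 2 ^ (N - length k)) (\<lambda>k. c * 2 ^ (N - length k))"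
  let ?R = "root_height (words N)" and ?L = "\<Pi>\<^sub>M k\<in>words N. lborel :: real measure"
  let ?D = "\<lambda>k u. \<theta> (?R u) * ennreal \<bar>u k - ?R u\<bar>"
  have D: "?E (?D k) \<le> ennreal jump_total" if "k \<in> words N" for k
  proof -
    have "?E (?D k) \<le> ennreal (\<Sum>d\<in>{N - length k<..N}. jump w d)"
      using block_partition_bounds[OF w_pos \<epsilon> \<theta> base block_partition_words[OF order_refl]] that by blast
    also have "\<dots> \<le> ennreal jump_total"
      by (intro ennreal_leI sum_jump_le) simp
    finally show ?thesis .
  qed
  have Dm: "?D k \<in> borel_measurable ?L" if "k \<in> words N" for k
    using measurable_words[OF that] borel_measurable_root_height[of "words N"] \<theta> by measurable
  have "?E (\<lambda>u. \<theta> (?R u) * indicator (far M p q) u) \<le> ?E (\<lambda>u. ennreal (1 / M) * (?D p u + ?D q u))"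
  proof (rule expect_mono)
    fix u
    show "\<theta> (?R u) * indicator (far M p q) u \<le> ennreal (1 / M) * (?D p u + ?D q u)"
      using mult_left_mono[OF markov_split[OF M, of p q u "?R u"], of "\<theta> (?R u)"]
      by (simp add: distrib_left mult_ac)
  qed
  also have "\<dots> = ennreal (1 / M) * (?E (?D p) + ?E (?D q))"
    using Dm pq by (subst expect_cmult) (auto simp: expect_add)
  also have "\<dots> \<le> ennreal (1 / M) * (ennreal jump_total + ennreal jump_total)"
    by (intro mult_left_mono add_mono D pq) auto
  also have "\<dots> = ennreal (2 * jump_total / M)"
    using M jump_total_nonneg by (simp add: ennreal_plus[symmetric] ennreal_mult[symmetric] del: ennreal_plus)
  finally show ?thesis .
qed

lemma hweight_pos: "i \<noteq> j \<Longrightarrow> hweight w i j > 0"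
  by (simp add: hweight_def w_pos)

lemma uniform_tail:
  assumes pq: "p \<in> words N" "q \<in> words N" and M: "M > 0" and \<epsilon>: "\<epsilon> > 0"
  shows "emeasure (h22_law (words N) (hweight w) (\<lambda>_. \<epsilon>))
    {(u, s) \<in> space (h22_law (words N) (hweight w) (\<lambda>_. \<epsilon>)). \<bar>u p - u q\<bar> \<ge> M} \<le> ennreal (2 * jump_total / M)"
proof -
  have "emeasure (h22_law (words N) (hweight w) (\<lambda>_. \<epsilon>))
      {(u, s) \<in> space (h22_law (words N) (hweight w) (\<lambda>_. \<epsilon>)). \<bar>u p - u q\<bar> \<ge> M} =
    expect (words N) (hweight w) (\<lambda>_. \<epsilon>) (\<lambda>_. 0) (\<lambda>u. indicator (far M p q) u)"
    by (rule emeasure_h22_law[where z=p])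
      (use pq \<epsilon> in \<open>auto intro: finite_words hweight_sym hweight_pos pred_far\<close>)
  also have "\<dots> = expect (words N) (block_weight N w) (\<lambda>k. \<epsilon> * 2 ^ (N - length k)) (\<lambda>k. 0 * 2 ^ (N - length k))
    (\<lambda>u. (\<lambda>_. 1) (root_height (words N) u) * indicator (far M p q) u)"
    unfolding expect_def by (subst u_density_words[where \<epsilon>=\<epsilon> and c=0]) auto
  also have "\<dots> \<le> ennreal (2 * jump_total / M)"
    by (rule expect_far[OF pq M _ _ expect_root_uniform[OF \<epsilon>, THEN eq_refl]]) (use \<epsilon> in auto)
  finally show ?thesis .
qed

text \<open>
  The factor \<open>r = exp (u z - root_height)\<close> that links pinning at \<open>z\<close> to pinning at the root is not bounded uniformly in
  \<open>N\<close>, but its second moment is; use \<open>r \<le> r\<^sup>2 / c + c\<close>, with \<open>c = sqrt M\<close> balancing the two contributions.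
\<close>

lemma one_point_tail:
  assumes pq: "p \<in> words N" "q \<in> words N" and z: "z \<in> words N" and M: "M > 0" and \<epsilon>: "\<epsilon> > 0"
  defines "h \<equiv> \<lambda>i. if i = z then \<epsilon> else 0"
  shows "emeasure (h22_law (words N) (hweight w) h)
    {(u, s) \<in> space (h22_law (words N) (hweight w) h). \<bar>u p - u q\<bar> \<ge> M} \<le>
    ennreal ((2 * jump_total + exp (2 * jump_total)) / sqrt M)"
proof -
  let ?V = "words N" and ?L = "\<Pi>\<^sub>M k\<in>words N. lborel :: real measure"
  let ?R = "root_height ?V" and ?I = "\<lambda>u. indicator (far M p q) u :: ennreal"
  let ?d = "u_density ?V (hweight w) (\<lambda>_. 0) (\<lambda>_. 1)"
  let ?c = "sqrt (2 * pi) / 2 ^ N"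
  let ?\<theta> = "\<lambda>t. ennreal (?c * root_density \<epsilon> t)"
  \<comment> \<open>The shift-invariant part of the integrand.\<close>
  let ?G = "\<lambda>u. ennreal (?d u) * (ennreal ?c * (ennreal (exp (u z - ?R u)) * ?I u))"
  let ?E = "expect ?V (block_weight N w) (\<lambda>k. 0 * 2 ^ (N - length k)) (\<lambda>k. 1 * 2 ^ (N - length k))"
  have ne: "?V \<noteq> {}" using z by auto
  have rd: "0 \<le> root_density \<epsilon> t" for t
    using \<epsilon> by (simp add: root_density_def)
  have len: "length k = N" if "k \<in> ?V" for k
    using that by (simp add: words_def)
  have Rm: "?R \<in> borel_measurable ?L" by (rule borel_measurable_root_height)
  have zm: "(\<lambda>u. u z) \<in> borel_measurable ?L" by (rule measurable_words[OF z])
  have Im: "?I \<in> borel_measurable ?L"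
  proof -
    have "{u \<in> space ?L. u \<in> far M p q} \<in> sets ?L"
      using pred_far[OF pq, of M] by (simp add: pred_def)
    then show ?thesis
      by (subst measurable_cong[where g="indicator {u \<in> space ?L. u \<in> far M p q}"]) (auto simp: indicator_def)
  qed
  note [measurable] = Rm zm Im borel_measurable_u_density
  have exp_height: "(\<Sum>k\<in>?V. exp (u k)) = 2 ^ N * exp (?R u)" for u
  proof -
    have "(\<Sum>k\<in>?V. exp (u k) / 2 ^ length k) > 0"
      using finite_words ne by (intro sum_pos) auto
    then have "exp (?R u) = (\<Sum>k\<in>?V. exp (u k) / 2 ^ length k)"
      by (simp add: root_height_def)
    also have "\<dots> = (\<Sum>k\<in>?V. exp (u k)) / 2 ^ N"
      by (simp add: len sum_divide_distrib)
    finally show ?thesis by simp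
  qed
  have dens: "u_density ?V (hweight w) h (\<lambda>_. 0) u = ?d u * (?c * (exp (u z - ?R u) * root_density \<epsilon> (u z)))" for u
  proof -
    have r: "sqrt (\<epsilon> * exp (u z)) * exp (- \<epsilon> * (cosh (u z) - 1)) = sqrt (2 * pi) * exp (u z) * root_density \<epsilon> (u z)"
    proof -
      have "sqrt (exp (u z)) = exp (u z / 2)"
        by (rule real_sqrt_unique) (simp_all add: exp_double[symmetric])
      also have "exp (u z / 2) = exp (u z) * exp (- u z / 2)"
        by (simp add: exp_add[symmetric])
      finally have "sqrt (\<epsilon> * exp (u z)) = sqrt (2 * pi) * (sqrt (\<epsilon> / (2 * pi)) * (exp (u z) * exp (- u z / 2)))"
        by (simp add: real_sqrt_mult real_sqrt_divide)
      then show ?thesis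
        unfolding root_density_def by (simp only: mult.assoc mult.commute mult.left_commute)
    qed
    have "u_density ?V (hweight w) h (\<lambda>_. 0) u * (2 ^ N * exp (?R u)) =
      ?d u * (sqrt (2 * pi) * exp (u z) * root_density \<epsilon> (u z))"
      unfolding h_def exp_height[symmetric] r[symmetric]
      by (rule u_density_one_point[OF finite_words z hweight_sym \<epsilon>])
    then show ?thesis
      by (simp add: exp_diff field_simps)
  qed
  have "emeasure (h22_law ?V (hweight w) h) {(u, s) \<in> space (h22_law ?V (hweight w) h). \<bar>u p - u q\<bar> \<ge> M} =
    expect ?V (hweight w) h (\<lambda>_. 0) ?I"
    by (rule emeasure_h22_law[where z=z])
      (use pq z \<epsilon> in \<open>auto simp: h_def intro: finite_words hweight_sym hweight_pos pred_far\<close>)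
  also have "\<dots> = (\<integral>\<^sup>+ u. ?G u * ennreal (root_density \<epsilon> (u z)) \<partial>?L)"
  proof -
    have "ennreal (x * (?c * (e * r))) = ennreal x * (ennreal ?c * (ennreal e * ennreal r))" if "e \<ge> 0" "r \<ge> 0" for x e r
    proof -
      have "ennreal (x * (?c * (e * r))) = ennreal x * ennreal (?c * (e * r))"
        by (rule ennreal_mult'') (use that in simp)
      also have "ennreal (?c * (e * r)) = ennreal ?c * ennreal (e * r)"
        by (rule ennreal_mult) (use that in auto)
      also have "ennreal (e * r) = ennreal e * ennreal r"
        by (rule ennreal_mult) (use that in auto)
      finally show ?thesis .
    qed
    then show ?thesis
      unfolding expect_def dens by (intro nn_integral_cong) (simp only: rd exp_ge_zero mult_ac)
  qed
  also have "\<dots> = (\<integral>\<^sup>+ u. ?G u * ennreal (root_density \<epsilon> (?R u)) \<partial>?L)"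
  proof (rule gauge_exchange[OF finite_words _ _ zm Rm])
    show "?G \<in> borel_measurable ?L" by measurable
    show "(\<integral>\<^sup>+ t. ennreal (root_density \<epsilon> t) \<partial>lborel) = 1"
      by (rule root_density_total[OF \<epsilon>])
    show "(\<lambda>i\<in>?V. u i + c) z = u z + c" for u c using z by simp
    show shift: "?R (\<lambda>i\<in>?V. u i + c) = ?R u + c" for u c
      by (rule root_height_shift[OF finite_words ne])
    show "?G (\<lambda>i\<in>?V. u i + c) = ?G u" for u c
      unfolding u_density_shift[OF finite_words] shift using z pq by (simp add: indicator_def)
  qed simp
  also have "\<dots> = ?E (\<lambda>u. ?\<theta> (?R u) * (ennreal (exp (u z - ?R u)) * ?I u))"
  proof -
    have split: "ennreal (?c * root_density \<epsilon> t) = ennreal ?c * ennreal (root_density \<epsilon> t)" for t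
      by (rule ennreal_mult) (use rd in auto)
    have leaf: "?d u = u_density ?V (block_weight N w) (\<lambda>k. 0 * 2 ^ (N - length k)) (\<lambda>k. 1 * 2 ^ (N - length k)) u" for u
      by (rule u_density_words) auto
    show ?thesis
      unfolding expect_def split leaf by (intro nn_integral_cong) (simp only: mult_ac)
  qed
  also have "\<dots> \<le> ?E (\<lambda>u. ennreal (1 / sqrt M) * (?\<theta> (?R u) * ennreal ((exp (u z - ?R u))\<^sup>2)) +
      ennreal (sqrt M) * (?\<theta> (?R u) * ?I u))"
  proof (rule expect_mono)
    fix u
    let ?r = "exp (u z - ?R u)"
    have c: "sqrt M > 0" using M by simp
    have "?r \<le> 1 / sqrt M * ?r\<^sup>2 + sqrt M"
    proof (cases "?r \<le> sqrt M")
      case False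
      then have "?r * sqrt M \<le> ?r * ?r" by (intro mult_left_mono) auto
      then have "?r \<le> 1 / sqrt M * ?r\<^sup>2" using c by (simp add: field_simps power2_eq_square)
      then show ?thesis using c by linarith
    qed (use c in \<open>simp add: add_increasing\<close>)
    then have "ennreal ?r \<le> ennreal (1 / sqrt M * ?r\<^sup>2 + sqrt M)"
      by (rule ennreal_leI)
    also have "\<dots> = ennreal (1 / sqrt M) * ennreal (?r\<^sup>2) + ennreal (sqrt M)"
    proof -
      have "ennreal (1 / sqrt M * ?r\<^sup>2 + sqrt M) = ennreal (1 / sqrt M * ?r\<^sup>2) + ennreal (sqrt M)"
        by (rule ennreal_plus) (use c in auto)
      also have "ennreal (1 / sqrt M * ?r\<^sup>2) = ennreal (1 / sqrt M) * ennreal (?r\<^sup>2)"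
        by (rule ennreal_mult) (use c in auto)
      finally show ?thesis .
    qed
    finally have le: "ennreal ?r \<le> ennreal (1 / sqrt M) * ennreal (?r\<^sup>2) + ennreal (sqrt M)" .
    show "?\<theta> (?R u) * (ennreal ?r * ?I u) \<le> ennreal (1 / sqrt M) * (?\<theta> (?R u) * ennreal (?r\<^sup>2)) +
      ennreal (sqrt M) * (?\<theta> (?R u) * ?I u)"
    proof (cases "u \<in> far M p q")
      case True
      then show ?thesis
        using mult_left_mono[OF le, of "?\<theta> (?R u)"] by (simp add: distrib_left mult_ac)
    qed simp
  qed
  also have "\<dots> = ennreal (1 / sqrt M) * ?E (\<lambda>u. ?\<theta> (?R u) * ennreal ((exp (u z - ?R u))\<^sup>2)) +
      ennreal (sqrt M) * ?E (\<lambda>u. ?\<theta> (?R u) * ?I u)"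
    by (subst expect_add) (measurable, simp add: expect_cmult)
  also have "\<dots> \<le> ennreal (1 / sqrt M) * ennreal (exp (2 * jump_total)) + ennreal (sqrt M) * ennreal (2 * jump_total / M)"
  proof (intro add_mono mult_left_mono)
    note base = expect_root_one_point[OF \<epsilon>, of "block_weight N w" N, THEN eq_refl]
    have "?E (\<lambda>u. ?\<theta> (?R u) * ennreal ((exp (u z - ?R u))\<^sup>2)) \<le> ennreal (\<Prod>d\<in>{N - length z<..N}. 1 + (jump w d)\<^sup>2)"
      using block_partition_bounds[OF w_pos _ _ base block_partition_words[OF order_refl]] z by auto
    also have "\<dots> \<le> ennreal (exp (2 * jump_total))"
      by (intro ennreal_leI prod_jump_le) simp
    finally show "?E (\<lambda>u. ?\<theta> (?R u) * ennreal ((exp (u z - ?R u))\<^sup>2)) \<le> ennreal (exp (2 * jump_total))" .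
    show "?E (\<lambda>u. ?\<theta> (?R u) * ?I u) \<le> ennreal (2 * jump_total / M)"
      by (rule expect_far[OF pq M _ _ base]) auto
  qed auto
  also have "\<dots> = ennreal ((2 * jump_total + exp (2 * jump_total)) / sqrt M)"
  proof -
    have "1 / sqrt M * exp (2 * jump_total) + sqrt M * (2 * jump_total / M) = (2 * jump_total + exp (2 * jump_total)) / sqrt M"
    proof -
      have "sqrt M * (2 * jump_total / M) = 2 * jump_total / sqrt M"
        using M real_div_sqrt[of M] by (simp add: field_simps)
      then show ?thesis by (simp add: add_divide_distrib)
    qed
    then show ?thesis
      using M jump_total_nonneg by (simp add: ennreal_mult[symmetric] ennreal_plus[symmetric] del: ennreal_plus)
  qed
  finally show ?thesis .
qed

end

theorem theorem2p1:
  fixes w \<beta> :: "nat \<Rightarrow> real"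
  assumes w_pos: "\<And>l. w l > 0"
    and \<beta>_eq: "\<And>l. \<beta> l = 2 ^ (2 * l + 1) * w (l + 2)"
    and summ: "summable (\<lambda>l. sqrt (ln (max (\<beta> l) (exp 1)) / \<beta> l))"
  shows "((\<lambda>M :: real.
            SUP N \<in> {1..}.
            SUP h \<in> uniform_pinnings \<union> one_point_pinnings (words N).
            SUP (p, q) \<in> words N \<times> words N.
              emeasure (h22_law (words N) (hweight w) h)
                {(u, s) \<in> space (h22_law (words N) (hweight w) h). \<bar>u p - u q\<bar> \<ge> M})
          \<longlongrightarrow> 0) at_top"
proof -
  interpret summable_jumps w
    by unfold_locales (rule w_pos, rule summable_jump[OF w_pos \<beta>_eq summ])
  let ?C = "2 * jump_total + exp (2 * jump_total)"
  let ?S = "\<lambda>M :: real. SUP N \<in> {1..}.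
    SUP h \<in> uniform_pinnings \<union> one_point_pinnings (words N).
    SUP (p, q) \<in> words N \<times> words N.
      emeasure (h22_law (words N) (hweight w) h)
        {(u, s) \<in> space (h22_law (words N) (hweight w) h). \<bar>u p - u q\<bar> \<ge> M}"
  have bound: "?S M \<le> ennreal (?C / sqrt M)" if M: "M \<ge> 1" for M
  proof (intro SUP_least)
    fix N :: nat and h :: "bool list \<Rightarrow> real" and pq
    assume h: "h \<in> uniform_pinnings \<union> one_point_pinnings (words N)" and "pq \<in> words N \<times> words N"
    then obtain p q where pq: "pq = (p, q)" "p \<in> words N" "q \<in> words N" by auto
    have "emeasure (h22_law (words N) (hweight w) h)
        {(u, s) \<in> space (h22_law (words N) (hweight w) h). \<bar>u p - u q\<bar> \<ge> M} \<le> ennreal (?C / sqrt M)"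
    proof (cases "h \<in> uniform_pinnings")
      case True
      then obtain \<epsilon> where \<epsilon>: "\<epsilon> > 0" "h = (\<lambda>_. \<epsilon>)"
        by (auto simp: uniform_pinnings_def)
      have "2 * jump_total / M \<le> ?C / sqrt M"
      proof (rule frac_le)
        show "sqrt M \<le> M" using M by (intro real_le_lsqrt) (auto simp: power2_eq_square)
      qed (use M jump_total_nonneg in auto)
      then show ?thesis
        using uniform_tail[OF pq(2,3) _ \<epsilon>(1), of M] M unfolding \<epsilon>(2)
        by (meson ennreal_leI order_trans less_le_trans zero_less_one)
    next
      case False
      then obtain \<epsilon> z where "\<epsilon> > 0" "z \<in> words N" "h = (\<lambda>i. if i = z then \<epsilon> else 0)"
        using h by (auto simp: one_point_pinnings_def)
      then show ?thesis
        using one_point_tail[OF pq(2,3), of z M \<epsilon>] M by simp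
    qed
    then show "(case pq of (p, q) \<Rightarrow> emeasure (h22_law (words N) (hweight w) h)
        {(u, s) \<in> space (h22_law (words N) (hweight w) h). \<bar>u p - u q\<bar> \<ge> M}) \<le> ennreal (?C / sqrt M)"
      by (simp add: pq(1))
  qed
  have "((\<lambda>M. ?C / sqrt M) \<longlongrightarrow> 0) at_top"
    by (intro tendsto_divide_0[OF tendsto_const] filterlim_at_top_imp_at_infinity sqrt_at_top)
  then have "((\<lambda>M. ennreal (?C / sqrt M)) \<longlongrightarrow> 0) at_top"
    using tendsto_ennrealI by fastforce
  then show ?thesis
  proof (rule tendsto_sandwich[OF _ _ tendsto_const, rotated 2])
    show "\<forall>\<^sub>F M in at_top. ?S M \<le> ennreal (?C / sqrt M)"
      using eventually_ge_at_top[of 1] by eventually_elim (rule bound)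
  qed simp
qed

end
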